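(* Let $M$ be a finite von Neumann algebra with a normal faithful trace $\tau$ and let $\mathcal G\subset\mathcal U(M)$ be a group which generates $M$ as a von Neumann algebra. Then for any operator $T\in\mathcal B(L^2(M,\tau))$ the weak closure of the convex hull of $$\{\,u(JvJ)T(Jv^*J)u^* \mid u,v\in\mathcal G\,\}$$ intersects $\mathcal Z(M)$.
   Context: $\tau$ is a faithful normal tracial state; $M$ acts on $L^2(M,\tau)$ by left multiplication and is viewed as a subalgebra of $\mathcal B(L^2(M,\tau))$; $J$ is the canonical conjugation on $L^2(M,\tau)$, $J\hat x=\widehat{x^*}$; $\mathcal U(M)$ is the unitary group of $M$; $\mathcal Z(M)$ is the center of $M$. "Weak closure" refers to the weak operator topology. (When $M$ is a finite factor and $\mathcal G=\mathcal U(M)$, the conclusion says that $M$ has the so-called MV-property: the weakly closed convex hull intersects the scalars.) *)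

theory Defs
  imports "HOL-Analysis.Analysis" "HOL-Algebra.Group"
begin

text \<open>
  Complex Hilbert spaces. The inner product is linear in its first argument; the real structure
  inherited from \<^class>\<open>real_inner\<close> is the underlying one, with real inner product the real part of
  the complex one, so that the library norm and topology are those of the complex Hilbert space.
\<close>

class complex_hilbert_space = real_inner + complete_space +
  fixes scaleC :: "complex \<Rightarrow> 'a \<Rightarrow> 'a"  (infixr \<open>*\<^sub>C\<close> 75)
    and cinner :: "'a \<Rightarrow> 'a \<Rightarrow> complex"
  assumes scaleC_add_right: "c *\<^sub>C (x + y) = c *\<^sub>C x + c *\<^sub>C y"
    and scaleC_add_left: "(c + d) *\<^sub>C x = c *\<^sub>C x + d *\<^sub>C x"
    and scaleC_scaleC: "c *\<^sub>C (d *\<^sub>C x) = (c * d) *\<^sub>C x"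
    and scaleC_of_real: "complex_of_real r *\<^sub>C x = r *\<^sub>R x"
    and cinner_commute: "cinner x y = cnj (cinner y x)"
    and cinner_add_left: "cinner (x + y) z = cinner x z + cinner y z"
    and cinner_scaleC_left: "cinner (c *\<^sub>C x) y = c * cinner x y"
    and Re_cinner: "Re (cinner x y) = inner x y"

lemma cinner_self: "cinner x x = complex_of_real ((norm x)\<^sup>2)"
proof (rule complex_eqI)
  show "Re (cinner x x) = Re (complex_of_real ((norm x)\<^sup>2))"
    by (simp add: Re_cinner power2_norm_eq_inner)
  show "Im (cinner x x) = Im (complex_of_real ((norm x)\<^sup>2))"
    using arg_cong[OF cinner_commute[of x x], of Im] by simp
qed

lemma norm_scaleC: "norm (c *\<^sub>C (x::'a::complex_hilbert_space)) = cmod c * norm x"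
proof -
  have "cinner (c *\<^sub>C x) (c *\<^sub>C x) = c * cnj (c * cinner x x)"
    by (metis cinner_commute cinner_scaleC_left)
  also have "\<dots> = complex_of_real ((cmod c * norm x)\<^sup>2)"
    by (simp add: cinner_self power_mult_distrib complex_norm_square[unfolded of_real_power] ac_simps)
  finally have "(norm (c *\<^sub>C x))\<^sup>2 = (cmod c * norm x)\<^sup>2"
    unfolding cinner_self by (simp only: of_real_eq_iff)
  then show ?thesis by simp
qed

lemma bounded_linear_scaleC: "bounded_linear (\<lambda>x::'a::complex_hilbert_space. c *\<^sub>C x)"
  by (rule bounded_linear_intro[where K = "cmod c"])
    (simp_all add: scaleC_add_right norm_scaleC scaleC_scaleC mult.commute
      flip: scaleC_of_real)

text \<open>
  The library type of bounded operators consists of the real-linear ones. It contains both the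
  algebra of bounded complex-linear operators, singled out here, and conjugate-linear ones such as
  the canonical conjugation of a tracial algebra.
\<close>

definition bounded_ops :: "('a::complex_hilbert_space \<Rightarrow>\<^sub>L 'a) set" where
  "bounded_ops = {T. \<forall>c x. blinfun_apply T (c *\<^sub>C x) = c *\<^sub>C blinfun_apply T x}"

definition scalar_op :: "complex \<Rightarrow> ('a::complex_hilbert_space \<Rightarrow>\<^sub>L 'a)" where
  "scalar_op c = Blinfun (\<lambda>x. c *\<^sub>C x)"

lemma scalar_op_apply [simp]: "blinfun_apply (scalar_op c) x = c *\<^sub>C x"
  by (simp add: scalar_op_def bounded_linear_Blinfun_apply bounded_linear_scaleC)

definition adj :: "('a::complex_hilbert_space \<Rightarrow>\<^sub>L 'a) \<Rightarrow> ('a \<Rightarrow>\<^sub>L 'a)" where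
  "adj T = (THE S. \<forall>x y. cinner (blinfun_apply S x) y = cinner x (blinfun_apply T y))"

text \<open>Both topologies below have \<^const>\<open>bounded_ops\<close> as their underlying space.\<close>

definition weak_operator_topology :: "('a::complex_hilbert_space \<Rightarrow>\<^sub>L 'a) topology" where
  "weak_operator_topology = topology_generated_by
     {{T \<in> bounded_ops. cinner (blinfun_apply T x) y \<in> U} | x y U. open U}"

definition ultraweak_topology :: "('a::complex_hilbert_space \<Rightarrow>\<^sub>L 'a) topology" where
  "ultraweak_topology = topology_generated_by
     {{T \<in> bounded_ops. (\<Sum>n. cinner (blinfun_apply T (\<xi> n)) (\<eta> n)) \<in> U} | \<xi> \<eta> U.
        summable (\<lambda>n::nat. (norm (\<xi> n))\<^sup>2) \<and> summable (\<lambda>n. (norm (\<eta> n))\<^sup>2) \<and> open U}"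

definition von_neumann_algebra :: "('a::complex_hilbert_space \<Rightarrow>\<^sub>L 'a) set \<Rightarrow> bool" where
  "von_neumann_algebra M \<longleftrightarrow>
     M \<subseteq> bounded_ops \<and> id_blinfun \<in> M \<and>
     (\<forall>x\<in>M. \<forall>y\<in>M. x + y \<in> M \<and> x o\<^sub>L y \<in> M) \<and>
     (\<forall>c. \<forall>x\<in>M. scalar_op c o\<^sub>L x \<in> M) \<and>
     (\<forall>x\<in>M. adj x \<in> M) \<and>
     closedin weak_operator_topology M"

definition finite_von_neumann_algebra :: "('a::complex_hilbert_space \<Rightarrow>\<^sub>L 'a) set \<Rightarrow> bool" where
  "finite_von_neumann_algebra M \<longleftrightarrow>
     von_neumann_algebra M \<and>
     (\<forall>v\<in>M. adj v o\<^sub>L v = id_blinfun \<longrightarrow> v o\<^sub>L adj v = id_blinfun)"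

definition center :: "('a::complex_hilbert_space \<Rightarrow>\<^sub>L 'a) set \<Rightarrow> ('a \<Rightarrow>\<^sub>L 'a) set" where
  "center M = {z \<in> M. \<forall>x\<in>M. z o\<^sub>L x = x o\<^sub>L z}"

definition unitary_group :: "('a::complex_hilbert_space \<Rightarrow>\<^sub>L 'a) set \<Rightarrow> ('a \<Rightarrow>\<^sub>L 'a) monoid" where
  "unitary_group M =
     \<lparr>carrier = {u \<in> M. adj u o\<^sub>L u = id_blinfun \<and> u o\<^sub>L adj u = id_blinfun},
      mult = (o\<^sub>L), one = id_blinfun\<rparr>"

text \<open>Only the values of \<open>\<tau>\<close> on \<open>M\<close> matter. Normality is ultraweak continuity.\<close>

definition faithful_normal_tracial_state ::
    "('a::complex_hilbert_space \<Rightarrow>\<^sub>L 'a) set \<Rightarrow> (('a \<Rightarrow>\<^sub>L 'a) \<Rightarrow> complex) \<Rightarrow> bool" where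
  "faithful_normal_tracial_state M \<tau> \<longleftrightarrow>
     (\<forall>x\<in>M. \<forall>y\<in>M. \<tau> (x + y) = \<tau> x + \<tau> y) \<and>
     (\<forall>c. \<forall>x\<in>M. \<tau> (scalar_op c o\<^sub>L x) = c * \<tau> x) \<and>
     \<tau> id_blinfun = 1 \<and>
     (\<forall>x\<in>M. \<tau> (adj x o\<^sub>L x) \<in> \<real>\<^sub>\<ge>\<^sub>0) \<and>
     (\<forall>x\<in>M. \<tau> (adj x o\<^sub>L x) = 0 \<longrightarrow> x = 0) \<and>
     (\<forall>x\<in>M. \<forall>y\<in>M. \<tau> (x o\<^sub>L y) = \<tau> (y o\<^sub>L x)) \<and>
     continuous_map (subtopology ultraweak_topology M) euclidean \<tau>"

text \<open>
  The space \<open>L\<^sup>2(M,\<tau>)\<close> is the Hilbert space completion of \<open>M\<close> for the inner product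
  \<open>\<tau>(y\<^sup>* x)\<close>. As a HOL type cannot depend on \<open>M\<close> and \<open>\<tau>\<close>, it is represented by an arbitrary
  completion: a Hilbert space type together with the canonical map \<open>hat\<close> from \<open>M\<close> onto a dense
  subspace. Such a completion is unique up to a unique unitary.
\<close>

definition L2_completion ::
    "('a::complex_hilbert_space \<Rightarrow>\<^sub>L 'a) set \<Rightarrow> (('a \<Rightarrow>\<^sub>L 'a) \<Rightarrow> complex) \<Rightarrow>
     (('a \<Rightarrow>\<^sub>L 'a) \<Rightarrow> 'b::complex_hilbert_space) \<Rightarrow> bool" where
  "L2_completion M \<tau> hat \<longleftrightarrow>
     (\<forall>x\<in>M. \<forall>y\<in>M. hat (x + y) = hat x + hat y) \<and>
     (\<forall>c. \<forall>x\<in>M. hat (scalar_op c o\<^sub>L x) = c *\<^sub>C hat x) \<and>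
     (\<forall>x\<in>M. \<forall>y\<in>M. cinner (hat x) (hat y) = \<tau> (adj y o\<^sub>L x)) \<and>
     closure (hat ` M) = UNIV"

text \<open>
  The left multiplication operator by \<open>x\<close> and the canonical conjugation, each being the unique
  continuous extension of its values on the dense subspace \<open>hat ` M\<close>.
\<close>

definition left_mult ::
    "('a::complex_hilbert_space \<Rightarrow>\<^sub>L 'a) set \<Rightarrow> (('a \<Rightarrow>\<^sub>L 'a) \<Rightarrow> 'b::complex_hilbert_space) \<Rightarrow>
     ('a \<Rightarrow>\<^sub>L 'a) \<Rightarrow> ('b \<Rightarrow>\<^sub>L 'b)" where
  "left_mult M hat x = (THE L. \<forall>y\<in>M. blinfun_apply L (hat y) = hat (x o\<^sub>L y))"

definition canonical_conj ::
    "('a::complex_hilbert_space \<Rightarrow>\<^sub>L 'a) set \<Rightarrow> (('a \<Rightarrow>\<^sub>L 'a) \<Rightarrow> 'b::complex_hilbert_space) \<Rightarrow>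
     ('b \<Rightarrow>\<^sub>L 'b)" where
  "canonical_conj M hat = (THE J. \<forall>x\<in>M. blinfun_apply J (hat x) = hat (adj x))"

end

theory Submission
  imports Defs
begin

text \<open>
  Write \<open>C\<close> for the weak closure of the convex hull in the theorem. It is convex, compact in the
  weak operator topology, and invariant under the two commuting actions
  \<open>X \<mapsto> u X u\<^sup>*\<close> and \<open>X \<mapsto> (J v J) X (J v\<^sup>* J)\<close> of \<open>G\<close>. An element fixed by both actions commutes with
  \<open>M\<close> and with \<open>J M J\<close>, hence lies in the center of \<open>M\<close>. As \<open>G\<close> need not be amenable, no fixed point
  theorem applies to the actions themselves; the theorem holds because a much weaker invariance
  already forces commutation.

  For a finite \<open>F \<subseteq> G\<close> let \<open>P\<close> and \<open>Q\<close> be the averages over \<open>F\<close> of the left and of the right conjugations.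
  These are just two commuting affine maps of \<open>C\<close> into itself, so the argument of Markov and Kakutani
  (\<open>Markov_fixed_point\<close>, \<open>exists_biharmonic\<close>) gives a biharmonic \<open>X \<in> C\<close>, that is \<open>P X = X = Q X\<close>. Now let \<open>P\<close> and
  \<open>Q\<close> act on functions of vectors as well, by averaging over the translates of the argument. The function
  \<open>q \<xi> = \<parallel>X \<xi>\<parallel>\<^sup>2\<close> satisfies \<open>P q - q = d\<close>, where \<open>d \<xi>\<close> is the average of \<open>\<parallel>[X, u\<^sup>*] \<xi>\<parallel>\<^sup>2\<close>, and \<open>d \<le> Q d\<close> since each
  commutator \<open>[X, u\<^sup>*]\<close> is again \<open>Q\<close>-harmonic. The left and the right translate of the trace vector \<open>\<Omega>\<close> by \<open>u\<^sup>*\<close>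
  coincide, so \<open>P\<close> and \<open>Q\<close>, which commute, have the same iterates at \<open>\<Omega>\<close>, and
  \<open>Q\<^sup>k d (\<Omega>) = P\<^sup>k d (\<Omega>) = P\<^sup>k\<^sup>+\<^sup>1 q (\<Omega>) - P\<^sup>k q (\<Omega>)\<close>. The left side is nonnegative and nondecreasing in \<open>k\<close>, while the
  right side has bounded partial sums. Hence both vanish: \<open>X\<close> commutes with \<open>F\<close> at the vectors
  \<open>w\<^sup>* \<Omega>\<close> with \<open>w \<in> F\<close> (\<open>biharmonic_commutes_on_orbit\<close>). Compactness of \<open>C\<close> makes one \<open>X \<in> C\<close> work for all finite \<open>F\<close>
  (\<open>exists_bicommuting_in_orbit_hull\<close>).

  Two steps remain. From \<open>G\<close> to \<open>M\<close>: the linear span of \<open>G\<close> is dense in \<open>L\<^sup>2(M,\<tau>)\<close> because \<open>G\<close> generates \<open>M\<close>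
  (\<open>group_span_eq_UNIV\<close>), so that \<open>X\<close> commutes with all left and right multiplications
  (\<open>commute_of_generators\<close>). From \<open>\<B>(L\<^sup>2(M,\<tau>))\<close> to \<open>M\<close>: such an operator is a left multiplication
  (\<open>bicommuting_in_L\<close>). In both, elements of \<open>M\<close> are first approximated without any bound on the norms, by
  strong convergence in the first and by convergence in \<open>L\<^sup>2\<close> in the second step, whereas normality of \<open>\<tau>\<close>
  only gives control on norm-bounded sets. The resolvents \<open>(y + i)\<^sup>-\<^sup>1\<close> of self-adjoint \<open>y\<close> repair this: they
  have norm at most \<open>1\<close>, and differences of resolvents are controlled by
  \<open>(y + i)\<^sup>-\<^sup>1 - (x + i)\<^sup>-\<^sup>1 = (y + i)\<^sup>-\<^sup>1 (x - y) (x + i)\<^sup>-\<^sup>1\<close>.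
\<close>

section \<open>Complex Hilbert spaces and adjoints\<close>

instance complex_hilbert_space \<subseteq> banach ..

lemma cinner_add_right: "cinner x (y + z) = cinner x y + cinner x (z::'a::complex_hilbert_space)"
  by (metis cinner_add_left cinner_commute complex_cnj_add)

lemma cinner_scaleC_right: "cinner x (c *\<^sub>C y) = cnj c * cinner x (y::'a::complex_hilbert_space)"
  by (metis cinner_commute cinner_scaleC_left complex_cnj_mult)

lemma scaleR_eq_scaleC: "r *\<^sub>R (x::'a::complex_hilbert_space) = complex_of_real r *\<^sub>C x"
  by (simp add: scaleC_of_real)

lemma cmod_cinner_le: "cmod (cinner x y) \<le> norm x * norm (y::'a::complex_hilbert_space)"
proof (cases "cinner x y = 0")
  case False
  define c where "c = cnj (cinner x y) / of_real (cmod (cinner x y))"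
  have c: "cmod c = 1" using False by (simp add: c_def norm_divide)
  have "cnj (cinner x y) * cinner x y = complex_of_real (cmod (cinner x y)) * complex_of_real (cmod (cinner x y))"
    by (metis complex_norm_square mult.commute of_real_power power2_eq_square of_real_mult)
  then have "cinner (c *\<^sub>C x) y = of_real (cmod (cinner x y))"
    using False by (simp add: cinner_scaleC_left c_def)
  then have "cmod (cinner x y) = inner (c *\<^sub>C x) y"
    by (metis Re_cinner Re_complex_of_real)
  also have "\<dots> \<le> norm (c *\<^sub>C x) * norm y" by (rule norm_cauchy_schwarz)
  finally show ?thesis by (simp add: norm_scaleC c)
qed simp

lemma bounded_bilinear_cinner: "bounded_bilinear (cinner :: 'a::complex_hilbert_space \<Rightarrow> 'a \<Rightarrow> complex)"
proof
  fix a a' b b' :: 'a and r :: real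
  show "cinner (a + a') b = cinner a b + cinner a' b" by (rule cinner_add_left)
  show "cinner a (b + b') = cinner a b + cinner a b'" by (rule cinner_add_right)
  show "cinner (r *\<^sub>R a) b = r *\<^sub>R cinner a b"
    by (simp add: scaleR_eq_scaleC cinner_scaleC_left scaleR_conv_of_real)
  show "cinner a (r *\<^sub>R b) = r *\<^sub>R cinner a b"
    by (simp add: scaleR_eq_scaleC cinner_scaleC_right scaleR_conv_of_real)
  show "\<exists>K. \<forall>a b::'a. norm (cinner a b) \<le> norm a * norm b * K"
    by (metis cmod_cinner_le mult.right_neutral)
qed

interpretation cinner: bounded_bilinear "cinner :: 'a::complex_hilbert_space \<Rightarrow> 'a \<Rightarrow> complex"
  by (rule bounded_bilinear_cinner)

lemmas scaleC_diff_right = linear_diff[OF bounded_linear.linear[OF bounded_linear_scaleC]]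
lemmas scaleC_scaleR_right = linear_scale[OF bounded_linear.linear[OF bounded_linear_scaleC]]
lemmas scaleC_zero_right [simp] = linear_0[OF bounded_linear.linear[OF bounded_linear_scaleC]]

lemmas continuous_on_cinner [continuous_intros] = bounded_bilinear.continuous_on[OF bounded_bilinear_cinner]
lemmas tendsto_cinner [tendsto_intros] = bounded_bilinear.tendsto[OF bounded_bilinear_cinner]

lemma scaleC_one [simp]: "1 *\<^sub>C (x::'a::complex_hilbert_space) = x"
  using scaleC_of_real[of 1 x] by simp

lemma scaleC_minus_left: "(- c) *\<^sub>C (x::'a::complex_hilbert_space) = - (c *\<^sub>C x)"
  by (metis scaleC_one scaleC_scaleC scaleC_of_real mult_minus1 scaleR_minus1_left of_real_1 of_real_minus)

lemma cinner_ext: "(\<And>y. cinner x y = cinner x' y) \<Longrightarrow> x = (x'::'a::complex_hilbert_space)"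
proof -
  assume "\<And>y. cinner x y = cinner x' y"
  then have "cinner (x - x') (x - x') = 0" by (simp add: cinner.diff_left)
  then show ?thesis by (simp add: cinner_self)
qed

text \<open>
  The projection theorem for a finite family of linear maps into a Hilbert space, that is for a
  subspace of a finite Hilbert sum without forming the sum: a minimizing sequence is Cauchy by the
  parallelogram law, and minimality makes the limiting residual orthogonal to the subspace. With one
  map it yields Riesz representation and the distance to a closed subspace; with evaluations at finitely
  many vectors it turns weak into strong approximation of operators.
\<close>

lemma orthogonal_residual:
  fixes \<phi> :: "'k \<Rightarrow> 'v::real_vector \<Rightarrow> 'a::{real_inner,complete_space}"
  assumes S: "subspace S" and I: "finite I" and lin: "\<And>k. k \<in> I \<Longrightarrow> linear (\<phi> k)"
  obtains y \<eta> where "\<And>n::nat. y n \<in> S" "\<And>k. k \<in> I \<Longrightarrow> (\<lambda>n. \<phi> k (x - y n)) \<longlonglongrightarrow> \<eta> k"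
    "\<And>s. s \<in> S \<Longrightarrow> (\<Sum>k\<in>I. inner (\<eta> k) (\<phi> k s)) = 0"
proof -
  define q where "q v = (\<Sum>k\<in>I. (norm (\<phi> k v))\<^sup>2)" for v
  define d where "d = Inf ((\<lambda>y. q (x - y)) ` S)"
  have q0: "q v \<ge> 0" for v unfolding q_def by (intro sum_nonneg) simp
  have bdd: "bdd_below ((\<lambda>y. q (x - y)) ` S)" using q0 by (intro bdd_belowI[of _ 0]) auto
  have ne: "S \<noteq> {}" using S subspace_0 by auto
  have d_le: "d \<le> q (x - y)" if "y \<in> S" for y
    unfolding d_def using bdd that by (intro cInf_lower) auto
  have "\<exists>y\<in>S. q (x - y) < d + 1 / Suc n" for n :: nat
    using cInf_lessD[of "(\<lambda>y. q (x - y)) ` S" "d + 1 / Suc n"] ne by (auto simp: d_def)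
  then obtain y where yS: "\<And>n. y n \<in> S" and yd: "\<And>n::nat. q (x - y n) < d + 1 / Suc n"
    by metis
  have par: "q (u - v) + q (u + v) = 2 * q u + 2 * q v" for u v
    unfolding q_def sum_distrib_left sum.distrib[symmetric]
    by (intro sum.cong refl) (simp add: lin linear_diff linear_add power2_norm_eq_inner
          inner_diff_left inner_diff_right inner_add_left inner_add_right)
  have qscale: "q (c *\<^sub>R u) = c\<^sup>2 * q u" for c u
    unfolding q_def sum_distrib_left
    by (intro sum.cong refl) (simp add: lin linear_scale power_mult_distrib)
  have q_close: "q (y m - y n) \<le> 2 / Suc n + 2 / Suc m" for m n
  proof -
    have "(1/2) *\<^sub>R (y n + y m) \<in> S" using S yS by (simp add: subspace_add subspace_scale)
    then have "d \<le> q (x - (1/2) *\<^sub>R (y n + y m))" by (rule d_le)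
    moreover have "(x - y n) + (x - y m) = 2 *\<^sub>R (x - (1/2) *\<^sub>R (y n + y m))"
      by (simp add: scaleR_diff_right scaleR_2 algebra_simps)
    then have "q ((x - y n) + (x - y m)) = 4 * q (x - (1/2) *\<^sub>R (y n + y m))" by (simp add: qscale)
    ultimately show ?thesis using par[of "x - y n" "x - y m"] yd[of n] yd[of m] by simp
  qed
  have "\<exists>l. (\<lambda>n. \<phi> k (x - y n)) \<longlonglongrightarrow> l" if k: "k \<in> I" for k
  proof -
    have "Cauchy (\<lambda>n. \<phi> k (x - y n))"
    proof (rule metric_CauchyI)
      fix e :: real assume e: "e > 0"
      then obtain N where N: "4 / e\<^sup>2 < real N" using reals_Archimedean2 by blast
      have Npos: "N > 0" using N e by (metis divide_nonneg_nonneg gr0I less_le_not_le of_nat_0 zero_le_numeral zero_le_power2)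
      have "dist (\<phi> k (x - y m)) (\<phi> k (x - y n)) < e" if "N \<le> m" "N \<le> n" for m n
      proof -
        have "(dist (\<phi> k (x - y m)) (\<phi> k (x - y n)))\<^sup>2 = (norm (\<phi> k (y n - y m)))\<^sup>2"
          by (simp add: dist_norm lin[OF k] linear_diff)
        also have "\<dots> \<le> q (y n - y m)"
          unfolding q_def using k I by (intro member_le_sum) auto
        also have "\<dots> \<le> 2 / Suc m + 2 / Suc n" by (rule q_close)
        also have "\<dots> \<le> 2 / N + 2 / N"
          using that Npos by (intro add_mono divide_left_mono) auto
        also have "\<dots> < e\<^sup>2" using N e Npos by (simp add: field_simps)
        finally show ?thesis using e power_less_imp_less_base by (metis less_imp_le)
      qed
      then show "\<exists>M. \<forall>m\<ge>M. \<forall>n\<ge>M. dist (\<phi> k (x - y m)) (\<phi> k (x - y n)) < e" by blast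
    qed
    then show ?thesis by (simp add: convergent_eq_Cauchy)
  qed
  then obtain \<eta> where \<eta>: "\<And>k. k \<in> I \<Longrightarrow> (\<lambda>n. \<phi> k (x - y n)) \<longlonglongrightarrow> \<eta> k" by metis
  have "(\<Sum>k\<in>I. inner (\<eta> k) (\<phi> k s)) = 0" if s: "s \<in> S" for s
  proof -
    have lim: "(\<lambda>n. q (x - (y n + t *\<^sub>R s))) \<longlonglongrightarrow> (\<Sum>k\<in>I. (norm (\<eta> k - t *\<^sub>R \<phi> k s))\<^sup>2)" for t
    proof -
      have "q (x - (y n + t *\<^sub>R s)) = (\<Sum>k\<in>I. (norm (\<phi> k (x - y n) - t *\<^sub>R \<phi> k s))\<^sup>2)" for n
        unfolding q_def using lin by (intro sum.cong refl) (simp add: linear_diff linear_add linear_scale diff_diff_eq)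
      then show ?thesis using \<eta> by (auto intro!: tendsto_intros)
    qed
    have ge: "(\<Sum>k\<in>I. (norm (\<eta> k - t *\<^sub>R \<phi> k s))\<^sup>2) \<ge> d" for t
      by (rule LIMSEQ_le_const[OF lim]) (use d_le S s yS in \<open>auto simp: subspace_add subspace_scale\<close>)
    have "(\<lambda>n. q (x - y n)) \<longlonglongrightarrow> d"
    proof (rule real_tendsto_sandwich[of "\<lambda>_. d" _ _ "\<lambda>n. d + inverse (real (Suc n))"])
      show "\<forall>\<^sub>F n in sequentially. q (x - y n) \<le> d + inverse (real (Suc n))"
        using yd by (intro always_eventually allI) (simp add: less_imp_le inverse_eq_divide)
    qed (use d_le yS LIMSEQ_inverse_real_of_nat_add in auto)
    then have d: "d = (\<Sum>k\<in>I. (norm (\<eta> k))\<^sup>2)" using lim[of 0] LIMSEQ_unique by auto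
    define B where "B = (\<Sum>k\<in>I. inner (\<eta> k) (\<phi> k s))"
    have sq: "(norm (a - t *\<^sub>R b))\<^sup>2 = (norm a)\<^sup>2 - 2 * t * inner a b + t\<^sup>2 * (norm b)\<^sup>2" for a b :: 'a and t
      by (simp add: power2_norm_eq_inner inner_diff_left inner_diff_right inner_commute)
        (simp add: power2_eq_square algebra_simps)
    have "(\<Sum>k\<in>I. (norm (\<eta> k - t *\<^sub>R \<phi> k s))\<^sup>2) = d - 2 * t * B + t\<^sup>2 * q s" for t
      unfolding d B_def q_def sum_distrib_left sq by (simp add: sum.distrib sum_subtractf)
    then have nn: "t\<^sup>2 * q s - 2 * t * B \<ge> 0" for t using ge[of t] by simp
    \<comment> \<open>The minimizing \<open>t\<close> would be \<open>B / q s\<close>; adding \<open>1\<close> covers \<open>q s = 0\<close> and is still good enough.\<close>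
    define t where "t = B / (q s + 1)"
    have tB: "t * (q s + 1) = B" using q0[of s] by (simp add: t_def)
    have "t * B = t\<^sup>2 * q s + t\<^sup>2"
      unfolding tB[symmetric] by (simp add: power2_eq_square algebra_simps)
    then have "t\<^sup>2 * (q s + 2) \<le> 0" using nn[of t] by (simp add: algebra_simps)
    then have "t = 0" using q0[of s]
      by (smt (verit) mult_pos_pos zero_less_power2)
    then show ?thesis using tB by (simp add: B_def)
  qed
  with yS \<eta> show ?thesis by (rule that)
qed

text \<open>
  A vector representing \<open>f\<close> is the residual of any \<open>a\<close> with \<open>f a = 1\<close> modulo the kernel of \<open>f\<close>, suitably scaled.
\<close>

lemma riesz_real:
  fixes f :: "'a::{real_inner,complete_space} \<Rightarrow> real"
  assumes f: "bounded_linear f"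
  shows "\<exists>z. \<forall>x. f x = inner x z"
proof (cases "\<forall>x. f x = 0")
  case True then show ?thesis by (intro exI[of _ 0]) auto
next
  case False
  interpret bounded_linear f by fact
  from False obtain a0 where "f a0 \<noteq> 0" by blast
  then have a: "f ((1 / f a0) *\<^sub>R a0) = 1" by (simp add: scale)
  define a where "a = (1 / f a0) *\<^sub>R a0"
  have "subspace {x. f x = 0}" by (auto simp: subspace_def add scale)
  then obtain y \<eta> where y: "\<And>n::nat. f (y n) = 0" and lim: "(\<lambda>n. a - y n) \<longlonglongrightarrow> \<eta> ()"
    and orth: "\<And>s. f s = 0 \<Longrightarrow> inner (\<eta> ()) s = 0"
    using orthogonal_residual[of "{x. f x = 0}" "{()}" "\<lambda>k x. x" a] by (auto simp: linear_id[unfolded id_def])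
  have "(\<lambda>n. f (a - y n)) \<longlonglongrightarrow> f (\<eta> ())" using lim by (rule tendsto)
  then have fe: "f (\<eta> ()) = 1" using y a by (simp add: diff a_def LIMSEQ_const_iff)
  define e where "e = \<eta> ()"
  have e0: "inner e e \<noteq> 0" using fe zero by (auto simp: e_def)
  have "f x = inner x ((1 / inner e e) *\<^sub>R e)" for x
  proof -
    have "f (x - f x *\<^sub>R e) = 0" using fe by (simp add: diff scale e_def)
    then have "inner e (x - f x *\<^sub>R e) = 0" using orth by (simp add: e_def)
    then show ?thesis using e0 by (simp add: inner_diff_right inner_commute field_simps)
  qed
  then show ?thesis by blast
qed

lemma riesz_complex:
  fixes f :: "'a::complex_hilbert_space \<Rightarrow> complex"
  assumes add: "\<And>x y. f (x + y) = f x + f y" and sc: "\<And>c x. f (c *\<^sub>C x) = c * f x"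
    and bd: "\<And>x. cmod (f x) \<le> K * norm x"
  shows "\<exists>z. \<forall>x. f x = cinner x z"
proof -
  have "bounded_linear (\<lambda>x. Re (f x))"
  proof (rule bounded_linear_intro[where K = K])
    show "norm (Re (f x)) \<le> norm x * K" for x
      using bd[of x] abs_Re_le_cmod[of "f x"] by (simp add: mult.commute)
  qed (simp_all add: add sc scaleR_eq_scaleC)
  then obtain z where z: "\<And>x. Re (f x) = inner x z" using riesz_real by blast
  have "f x = cinner x z" for x
  proof (rule complex_eqI)
    show "Re (f x) = Re (cinner x z)" by (simp add: z Re_cinner)
    have "Re (f (\<i> *\<^sub>C x)) = Re (cinner (\<i> *\<^sub>C x) z)" by (simp add: z Re_cinner)
    then show "Im (f x) = Im (cinner x z)" by (simp add: sc cinner_scaleC_left)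
  qed
  then show ?thesis by blast
qed

lemma bounded_opsD: "T \<in> bounded_ops \<Longrightarrow> T (c *\<^sub>C x) = c *\<^sub>C T x"
  by (simp add: bounded_ops_def)

text \<open>
  Used for adjoints, and for the compactness of operator balls, where a limit is first found among forms.
\<close>

lemma sesquilinear_form_operator:
  fixes b :: "'a::complex_hilbert_space \<Rightarrow> 'a \<Rightarrow> complex"
  assumes "\<And>x x' y. b (x + x') y = b x y + b x' y" "\<And>c x y. b (c *\<^sub>C x) y = c * b x y"
    "\<And>x y y'. b x (y + y') = b x y + b x y'" "\<And>c x y. b x (c *\<^sub>C y) = cnj c * b x y"
    and bd: "\<And>x y. cmod (b x y) \<le> r * norm x * norm y"
  obtains T where "T \<in> bounded_ops" "\<And>x y. cinner (blinfun_apply T x) y = b x y"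
proof -
  have "\<exists>z. \<forall>y. cnj (b x y) = cinner y z" for x
    by (rule riesz_complex[where K = "r * norm x"]) (use assms in \<open>auto\<close>)
  then obtain t where "\<And>x y. cnj (b x y) = cinner y (t x)" by metis
  then have t: "cinner (t x) y = b x y" for x y by (metis cinner_commute complex_cnj_cnj)
  have bl: "bounded_linear t"
  proof (rule bounded_linear_intro[where K = "r"])
    show "t (x + y) = t x + t y" for x y by (rule cinner_ext) (simp add: t assms cinner_add_left)
    show "t (c *\<^sub>R x) = c *\<^sub>R t x" for c x
      by (rule cinner_ext) (simp add: t assms scaleR_eq_scaleC cinner_scaleC_left)
    show "norm (t x) \<le> norm x * r" for x
    proof (cases "t x = 0")
      case False
      have "norm (t x) * norm (t x) = cmod (cinner (t x) (t x))"
        unfolding cinner_self by (simp add: power2_eq_square norm_mult)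
      also have "\<dots> \<le> (r * norm x) * norm (t x)" using bd[of x "t x"] by (simp add: t)
      finally show ?thesis using False by (simp add: mult.commute)
    next
      case True
      have "cmod (b x x) \<le> r * norm x * norm x" by (rule bd)
      then have "0 \<le> r * (norm x * norm x)" by (metis norm_ge_zero order_trans mult.assoc)
      then have "r \<ge> 0 \<or> x = 0" by (auto simp: zero_le_mult_iff mult_le_0_iff)
      then show ?thesis using True by auto
    qed
  qed
  have ap: "blinfun_apply (Blinfun t) = t" by (rule bounded_linear_Blinfun_apply[OF bl])
  have "t (c *\<^sub>C x) = c *\<^sub>C t x" for c x
    by (rule cinner_ext) (simp add: t assms(2) cinner_scaleC_left)
  then have "Blinfun t \<in> bounded_ops" by (simp add: bounded_ops_def ap)
  then show ?thesis by (rule that) (simp only: ap t)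
qed

lemma norm_le_of_cinner_le:
  fixes x :: "'a::complex_hilbert_space"
  assumes "\<And>y. cmod (cinner x y) \<le> r * norm y" "r \<ge> 0"
  shows "norm x \<le> r"
proof (cases "x = 0")
  case False
  have "norm x * norm x = cmod (cinner x x)"
    unfolding cinner_self by (simp add: power2_eq_square norm_mult)
  also have "\<dots> \<le> r * norm x" by (rule assms(1))
  finally show ?thesis using False by simp
qed (use assms in simp)

text \<open>
  The description in the definition of \<open>adj\<close> is meaningful on complex-linear operators, by Riesz representation.
\<close>

lemma adj_cinner:
  assumes T: "T \<in> bounded_ops"
  shows "cinner (blinfun_apply (adj T) x) y = cinner x (blinfun_apply T y)"
proof -
  have "\<exists>!S. \<forall>x y. cinner (blinfun_apply S x) y = cinner x (blinfun_apply T y)"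
  proof -
    obtain S where "S \<in> bounded_ops" "\<And>x y. cinner (blinfun_apply S x) y = cinner x (blinfun_apply T y)"
    proof (rule sesquilinear_form_operator[where b = "\<lambda>x y. cinner x (blinfun_apply T y)" and r = "norm T"])
      show "cmod (cinner x (blinfun_apply T y)) \<le> norm T * norm x * norm y" for x y
        using order_trans[OF cmod_cinner_le mult_left_mono[OF norm_blinfun norm_ge_zero]]
        by (metis mult.assoc mult.commute)
    qed (auto simp: cinner_add_left cinner_scaleC_left cinner_scaleC_right cinner_add_right
          blinfun.add_right bounded_opsD[OF T])
    then have S: "cinner (blinfun_apply S x) y = cinner x (blinfun_apply T y)" for x y by auto
    show ?thesis
    proof (rule ex1I)
      show "\<forall>x y. cinner (blinfun_apply S x) y = cinner x (blinfun_apply T y)" using S by blast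
      fix S' assume S': "\<forall>x y. cinner (blinfun_apply S' x) y = cinner x (blinfun_apply T y)"
      show "S' = S"
      proof (intro blinfun_eqI cinner_ext)
        show "cinner (blinfun_apply S' x) y = cinner (blinfun_apply S x) y" for x y
          using S[of x y] S' by metis
      qed
    qed
  qed
  then have "\<forall>x y. cinner (blinfun_apply (adj T) x) y = cinner x (blinfun_apply T y)"
    unfolding adj_def by (rule theI')
  then show ?thesis by blast
qed

lemma adj_cinner_right: "T \<in> bounded_ops \<Longrightarrow> cinner x ((adj T) y) = cinner (T x) y"
  by (metis adj_cinner cinner_commute)

lemma adj_eqI:
  assumes "T \<in> bounded_ops" "\<And>x y. cinner (blinfun_apply S x) y = cinner x (blinfun_apply T y)"
  shows "adj T = S"
  by (intro blinfun_eqI cinner_ext) (simp add: assms adj_cinner)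

lemma adj_bounded_ops [simp]:
  assumes "T \<in> bounded_ops" shows "adj T \<in> bounded_ops"
  unfolding bounded_ops_def mem_Collect_eq
  by (intro allI cinner_ext) (simp add: adj_cinner[OF assms] cinner_scaleC_left)

lemma adj_adj: "T \<in> bounded_ops \<Longrightarrow> adj (adj T) = T"
  by (rule adj_eqI) (auto simp: adj_cinner_right)

lemma id_bounded_ops [simp]: "id_blinfun \<in> bounded_ops" by (simp add: bounded_ops_def)
lemma compose_bounded_ops [simp]: "S \<in> bounded_ops \<Longrightarrow> T \<in> bounded_ops \<Longrightarrow> S o\<^sub>L T \<in> bounded_ops"
  by (simp add: bounded_ops_def)
lemma add_bounded_ops [simp]: "S \<in> bounded_ops \<Longrightarrow> T \<in> bounded_ops \<Longrightarrow> S + T \<in> bounded_ops"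
  by (simp add: bounded_ops_def blinfun.add_left scaleC_add_right)
lemma scalar_bounded_ops [simp]: "scalar_op c \<in> bounded_ops"
  by (simp add: bounded_ops_def scaleC_scaleC mult.commute)
lemma scaleR_bounded_ops [simp]: "T \<in> bounded_ops \<Longrightarrow> r *\<^sub>R T \<in> bounded_ops"
  by (simp add: bounded_ops_def blinfun.scaleR_left scaleC_scaleR_right)
lemma zero_bounded_ops [simp]: "0 \<in> bounded_ops" by (simp add: bounded_ops_def)

lemma scaleR_eq_scalar_op: "r *\<^sub>R (T::'a::complex_hilbert_space \<Rightarrow>\<^sub>L 'a) = scalar_op (complex_of_real r) o\<^sub>L T"
  by (rule blinfun_eqI) (simp add: blinfun.scaleR_left scaleR_eq_scaleC)

lemma adj_compose: "S \<in> bounded_ops \<Longrightarrow> T \<in> bounded_ops \<Longrightarrow> adj (S o\<^sub>L T) = adj T o\<^sub>L adj S"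
  by (rule adj_eqI) (auto simp: adj_cinner)
lemma adj_add: "S \<in> bounded_ops \<Longrightarrow> T \<in> bounded_ops \<Longrightarrow> adj (S + T) = adj S + adj T"
  by (rule adj_eqI) (auto simp: adj_cinner blinfun.add_left cinner_add_left cinner_add_right)
lemma adj_scaleR: "T \<in> bounded_ops \<Longrightarrow> adj (r *\<^sub>R T) = r *\<^sub>R adj T"
  by (rule adj_eqI) (auto simp: adj_cinner blinfun.scaleR_left cinner.scaleR_left cinner.scaleR_right)
lemma adj_scalar: "T \<in> bounded_ops \<Longrightarrow> adj (scalar_op c o\<^sub>L T) = scalar_op (cnj c) o\<^sub>L adj T"
  by (rule adj_eqI) (auto simp: adj_cinner cinner_scaleC_left cinner_scaleC_right)

lemma blinfun_compose_assoc: "(S o\<^sub>L T) o\<^sub>L U = S o\<^sub>L (T o\<^sub>L U)"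
  by (rule blinfun_eqI) simp
lemma blinfun_compose_id [simp]: "id_blinfun o\<^sub>L T = T" "T o\<^sub>L id_blinfun = T"
  by (auto intro: blinfun_eqI)

definition self_adjoint_re :: "('a::complex_hilbert_space \<Rightarrow>\<^sub>L 'a) \<Rightarrow> ('a \<Rightarrow>\<^sub>L 'a)" where
  "self_adjoint_re x = (scalar_op (1/2) o\<^sub>L x) + (scalar_op (1/2) o\<^sub>L adj x)"

definition self_adjoint_im :: "('a::complex_hilbert_space \<Rightarrow>\<^sub>L 'a) \<Rightarrow> ('a \<Rightarrow>\<^sub>L 'a)" where
  "self_adjoint_im x = (scalar_op (- \<i>/2) o\<^sub>L x) + (scalar_op (\<i>/2) o\<^sub>L adj x)"

lemma self_adjoint_decomposition:
  assumes x: "x \<in> bounded_ops"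
  shows "adj (self_adjoint_re x) = self_adjoint_re x" "adj (self_adjoint_im x) = self_adjoint_im x"
    "self_adjoint_re x + (scalar_op \<i> o\<^sub>L self_adjoint_im x) = x"
proof -
  show "adj (self_adjoint_re x) = self_adjoint_re x" "adj (self_adjoint_im x) = self_adjoint_im x"
    using x by (simp_all add: self_adjoint_re_def self_adjoint_im_def adj_add adj_scalar adj_adj add.commute)
  show "self_adjoint_re x + (scalar_op \<i> o\<^sub>L self_adjoint_im x) = x"
  proof (rule blinfun_eqI)
    fix v
    have "(self_adjoint_re x + (scalar_op \<i> o\<^sub>L self_adjoint_im x)) v = (1/2) *\<^sub>C x v + (1/2) *\<^sub>C x v"
      by (simp add: self_adjoint_re_def self_adjoint_im_def blinfun.add_left scaleC_add_right scaleC_diff_right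
          scaleC_scaleC scaleC_minus_left)
    also have "\<dots> = x v" by (simp add: scaleC_add_left[symmetric])
    finally show "(self_adjoint_re x + (scalar_op \<i> o\<^sub>L self_adjoint_im x)) v = x v" .
  qed
qed

lemma norm_op_le_of_cinner:
  assumes "\<And>x y. cmod (cinner (blinfun_apply T x) y) \<le> r * norm x * norm y" "r \<ge> 0"
  shows "norm T \<le> r"
  using assms by (intro norm_blinfun_bound norm_le_of_cinner_le) auto

lemma cmod_cinner_op_le: "cmod (cinner (blinfun_apply T x) y) \<le> norm T * norm x * norm y"
  by (rule order_trans[OF cmod_cinner_le mult_right_mono[OF norm_blinfun norm_ge_zero]])

lemma norm_adj: 
  assumes "T \<in> bounded_ops" shows "norm (adj T) = norm T"
proof -
  have le: "norm (adj T) \<le> norm T" if T: "T \<in> bounded_ops" for T :: "'a \<Rightarrow>\<^sub>L 'a"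
  proof (rule norm_op_le_of_cinner)
    show "cmod (cinner ((adj T) x) y) \<le> norm T * norm x * norm y" for x y
      using cmod_cinner_op_le[of T y x] T by (metis adj_cinner cinner_commute complex_mod_cnj mult.assoc mult.commute)
  qed simp
  show ?thesis using le[of T] le[of "adj T"] assms by (simp add: adj_adj)
qed

interpretation complex_vs: vector_space "scaleC :: complex \<Rightarrow> 'a::complex_hilbert_space \<Rightarrow> 'a"
  by standard (auto simp: scaleC_add_right scaleC_add_left scaleC_scaleC)

section \<open>Resolvents of self-adjoint operators\<close>

lemma Im_cinner_self_adjoint:
  assumes "y \<in> bounded_ops" "adj y = y"
  shows "Im (cinner (y \<xi>) \<xi>) = 0"
proof -
  have "cinner (y \<xi>) \<xi> = cinner \<xi> (y \<xi>)" using adj_cinner[of y \<xi> \<xi>] assms by simp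
  then have "cinner (y \<xi>) \<xi> = cnj (cinner (y \<xi>) \<xi>)"
    by (metis cinner_commute)
  then show ?thesis by (metis cnj.simps(2) equal_neg_zero)
qed

text \<open>
  The cross term is a real multiple of the imaginary part of \<open>\<langle>y \<xi>, \<xi>\<rangle>\<close>, which is zero.
\<close>

lemma norm_real_plus_imag:
  assumes "y \<in> bounded_ops" "adj y = y"
  shows "(norm (s *\<^sub>R \<xi> + (\<i> * complex_of_real t) *\<^sub>C y \<xi>))\<^sup>2
         = s\<^sup>2 * (norm \<xi>)\<^sup>2 + t\<^sup>2 * (norm (y \<xi>))\<^sup>2"
proof -
  have "inner \<xi> ((\<i> * complex_of_real t) *\<^sub>C y \<xi>)
      = Re (cnj (cinner ((\<i> * complex_of_real t) *\<^sub>C y \<xi>) \<xi>))"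
    by (metis Re_cinner cinner_commute)
  also have "\<dots> = 0" using Im_cinner_self_adjoint[OF assms, of \<xi>] by (simp add: cinner_scaleC_left)
  finally have orth: "inner \<xi> ((\<i> * complex_of_real t) *\<^sub>C y \<xi>) = 0" .
  have "(norm (a + b))\<^sup>2 = (norm a)\<^sup>2 + 2 * inner a b + (norm b)\<^sup>2" for a b :: 'a
    by (simp add: power2_norm_eq_inner inner_add_left inner_add_right inner_commute)
  then show ?thesis by (simp add: orth norm_scaleC norm_mult power_mult_distrib)
qed

lemma norm_resolvent_lower:
  assumes "y \<in> bounded_ops" "adj y = y"
  shows "norm \<xi> \<le> norm (y \<xi> + \<i> *\<^sub>C \<xi>)"
proof -
  have "y \<xi> + \<i> *\<^sub>C \<xi> = \<i> *\<^sub>C (1 *\<^sub>R \<xi> + (\<i> * complex_of_real (-1)) *\<^sub>C y \<xi>)"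
    by (simp add: scaleC_diff_right scaleC_add_right scaleC_minus_left scaleC_scaleC)
  then have n: "norm (y \<xi> + \<i> *\<^sub>C \<xi>)
      = norm (1 *\<^sub>R \<xi> + (\<i> * complex_of_real (-1)) *\<^sub>C y \<xi>)"
    by (simp only: norm_scaleC norm_ii mult_1)
  have "(norm (y \<xi> + \<i> *\<^sub>C \<xi>))\<^sup>2
      = 1\<^sup>2 * (norm \<xi>)\<^sup>2 + (-1)\<^sup>2 * (norm (y \<xi>))\<^sup>2"
    unfolding n by (rule norm_real_plus_imag[OF assms])
  then have "(norm \<xi>)\<^sup>2 \<le> (norm (y \<xi> + \<i> *\<^sub>C \<xi>))\<^sup>2" by simp
  then show ?thesis by (rule power2_le_imp_le) simp
qed

text \<open>
  The sets inside which the fixed point iteration for the inverse of \<open>y + i\<close> runs.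
\<close>

definition closed_subalgebra :: "('a::complex_hilbert_space \<Rightarrow>\<^sub>L 'a) set \<Rightarrow> bool" where
  "closed_subalgebra A \<longleftrightarrow> A \<subseteq> bounded_ops \<and> closed A \<and> id_blinfun \<in> A \<and>
     (\<forall>x\<in>A. \<forall>y\<in>A. x + y \<in> A \<and> x o\<^sub>L y \<in> A) \<and> (\<forall>c. \<forall>x\<in>A. scalar_op c o\<^sub>L x \<in> A)"

lemma closed_subalgebraD:
  assumes "closed_subalgebra A"
  shows "A \<subseteq> bounded_ops" "closed A" "id_blinfun \<in> A" "x \<in> A \<Longrightarrow> y \<in> A \<Longrightarrow> x + y \<in> A"
    "x \<in> A \<Longrightarrow> y \<in> A \<Longrightarrow> x o\<^sub>L y \<in> A" "x \<in> A \<Longrightarrow> scalar_op c o\<^sub>L x \<in> A" "x \<in> A \<Longrightarrow> r *\<^sub>R x \<in> A"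
    "x \<in> A \<Longrightarrow> y \<in> A \<Longrightarrow> x - y \<in> A" "0 \<in> A"
proof -
  show 1: "A \<subseteq> bounded_ops" "closed A" "id_blinfun \<in> A" "x \<in> A \<Longrightarrow> y \<in> A \<Longrightarrow> x o\<^sub>L y \<in> A"
     "x \<in> A \<Longrightarrow> scalar_op c o\<^sub>L x \<in> A" for x y c
    using assms by (auto simp: closed_subalgebra_def)
  show add: "x \<in> A \<Longrightarrow> y \<in> A \<Longrightarrow> x + y \<in> A" for x y
    using assms by (auto simp: closed_subalgebra_def)
  show sc: "x \<in> A \<Longrightarrow> r *\<^sub>R x \<in> A" for x r using 1 by (simp add: scaleR_eq_scalar_op)
  show diff: "x \<in> A \<Longrightarrow> y \<in> A \<Longrightarrow> x - y \<in> A" for x y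
    using add[of x "(-1) *\<^sub>R y"] sc[of y "-1"] by simp
  show "0 \<in> A" using diff[OF 1(3) 1(3)] by simp
qed

text \<open>
  With \<open>a = 1 + i \<epsilon> (y + i)\<close> one has \<open>\<parallel>a \<xi>\<parallel>\<^sup>2 = (1 - \<epsilon>)\<^sup>2 \<parallel>\<xi>\<parallel>\<^sup>2 + \<epsilon>\<^sup>2 \<parallel>y \<xi>\<parallel>\<^sup>2\<close>, so \<open>a\<close> is a strict contraction for small
  \<open>\<epsilon>\<close>, and the inverse of \<open>y + i\<close> is the fixed point in \<open>A\<close> of \<open>z \<mapsto> a z - i \<epsilon>\<close>.
\<close>

lemma resolvent_exists:
  assumes A: "closed_subalgebra A" and y: "y \<in> A" "adj y = y"
  obtains z where "z \<in> A" "(y + scalar_op \<i>) o\<^sub>L z = id_blinfun" "z o\<^sub>L (y + scalar_op \<i>) = id_blinfun" "norm z \<le> 1"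
proof -
  have yb: "y \<in> bounded_ops" using A y by (auto simp: closed_subalgebra_def)
  have sc: "scalar_op c \<in> A" for c
    using closed_subalgebraD(6)[OF A closed_subalgebraD(3)[OF A], of c] by simp
  \<comment> \<open>This value makes the square of the contraction constant, \<open>1 - 2 e + e\<^sup>2 (1 + \<parallel>y\<parallel>\<^sup>2)\<close>, equal to \<open>1 - e\<close>.\<close>
  define e where "e = 1 / (1 + (norm y)\<^sup>2)"
  have e: "0 < e" "e \<le> 1" "e * (1 + (norm y)\<^sup>2) = 1"
  proof -
    have "1 + (norm y)\<^sup>2 > 0" by (simp add: add_pos_nonneg)
    then show "0 < e" "e \<le> 1" "e * (1 + (norm y)\<^sup>2) = 1" by (auto simp: e_def)
  qed
  define a where "a = scalar_op (of_real (1 - e)) + (scalar_op (\<i> * of_real e) o\<^sub>L y)"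
  have aA: "a \<in> A" using A y sc by (auto simp: a_def closed_subalgebra_def)
  have a_ap: "a \<xi> = (1 - e) *\<^sub>R \<xi> + (\<i> * of_real e) *\<^sub>C y \<xi>" for \<xi>
    by (simp add: a_def blinfun.add_left scaleR_eq_scaleC)
  have na: "norm a \<le> sqrt (1 - e)"
  proof (rule norm_blinfun_bound)
    fix \<xi>
    have "(norm (a \<xi>))\<^sup>2 = (1 - e)\<^sup>2 * (norm \<xi>)\<^sup>2 + e\<^sup>2 * (norm (y \<xi>))\<^sup>2"
      unfolding a_ap by (rule norm_real_plus_imag[OF yb y(2)])
    also have "\<dots> \<le> (1 - e)\<^sup>2 * (norm \<xi>)\<^sup>2 + e\<^sup>2 * (norm y * norm \<xi>)\<^sup>2"
      by (intro add_left_mono mult_left_mono power_mono norm_blinfun) auto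
    also have "\<dots> = (1 - 2 * e + e * (e * (1 + (norm y)\<^sup>2))) * (norm \<xi>)\<^sup>2"
      by (simp add: power2_eq_square algebra_simps)
    also have "\<dots> = (sqrt (1 - e) * norm \<xi>)\<^sup>2"
      unfolding e(3) using e(2) by (simp add: power_mult_distrib)
    finally show "norm (a \<xi>) \<le> sqrt (1 - e) * norm \<xi>"
      by (rule power2_le_imp_le) (use e in simp)
  qed (use e in simp)
  have "\<exists>!z\<in>A. (a o\<^sub>L z) + scalar_op (- \<i> * of_real e) = z"
  proof (rule Banach_fix)
    show "complete A" using A by (simp add: closed_subalgebra_def complete_eq_closed)
    show "A \<noteq> {}" using aA by auto
    show "sqrt (1 - e) < 1" "0 \<le> sqrt (1 - e)" using e by auto
    show "(\<lambda>z. (a o\<^sub>L z) + scalar_op (- \<i> * of_real e)) ` A \<subseteq> A"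
      using A aA sc by (auto simp: closed_subalgebra_def)
    fix z z' :: "'a \<Rightarrow>\<^sub>L 'a"
    have canc: "(p + s) - (q + s) = p - q" for p q s :: "'a \<Rightarrow>\<^sub>L 'a" by simp
    have "dist ((a o\<^sub>L z) + scalar_op (- \<i> * of_real e)) ((a o\<^sub>L z') + scalar_op (- \<i> * of_real e)) = norm (a o\<^sub>L (z - z'))"
      unfolding dist_norm canc by (simp only: bounded_bilinear.diff_right[OF bounded_bilinear_blinfun_compose])
    also have "\<dots> \<le> norm a * norm (z - z')" by (rule norm_blinfun_compose)
    also have "\<dots> \<le> sqrt (1 - e) * dist z z'" unfolding dist_norm by (intro mult_right_mono na) simp
    finally show "dist ((a o\<^sub>L z) + scalar_op (- \<i> * of_real e)) ((a o\<^sub>L z') + scalar_op (- \<i> * of_real e)) \<le> sqrt (1 - e) * dist z z'" .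
  qed
  then obtain z where z: "z \<in> A" "(a o\<^sub>L z) + scalar_op (- \<i> * of_real e) = z" by blast
  have inv: "y (z v) + \<i> *\<^sub>C z v = v" for v
  proof -
    let ?w = "z v"
    have "?w = ((a o\<^sub>L z) + scalar_op (- \<i> * of_real e)) v" using z(2) by simp
    also have "\<dots> = (1 - e) *\<^sub>R ?w + (\<i> * of_real e) *\<^sub>C y ?w - (\<i> * of_real e) *\<^sub>C v"
      by (simp add: blinfun.add_left a_ap)
    finally have "(\<i> * of_real e) *\<^sub>C v = (\<i> * of_real e) *\<^sub>C y ?w - e *\<^sub>R ?w"
      by (simp add: algebra_simps)
    also have "\<dots> = (\<i> * of_real e) *\<^sub>C (y ?w + \<i> *\<^sub>C ?w)"
    proof -
      have "\<i> * of_real e * \<i> = - complex_of_real e" by (simp add: algebra_simps)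
      then show ?thesis by (simp add: scaleC_add_right scaleC_scaleC scaleR_eq_scaleC scaleC_minus_left)
    qed
    finally show ?thesis using e(1) by (simp add: complex_vs.scale_cancel_left)
  qed
  have inj: "v = 0" if "y v + \<i> *\<^sub>C v = 0" for v
    using norm_resolvent_lower[OF yb y(2), of v] that by simp
  have inv2: "z (y v + \<i> *\<^sub>C v) = v" for v
  proof -
    let ?d = "z (y v + \<i> *\<^sub>C v) - v"
    have "y ?d + \<i> *\<^sub>C ?d = 0"
      using inv[of "y v + \<i> *\<^sub>C v"] by (simp add: blinfun.diff_right scaleC_diff_right algebra_simps)
    then show ?thesis using inj[of ?d] by simp
  qed
  show ?thesis
  proof (rule that[OF z(1)])
    show "(y + scalar_op \<i>) o\<^sub>L z = id_blinfun" by (rule blinfun_eqI) (simp add: blinfun.add_left inv)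
    show "z o\<^sub>L (y + scalar_op \<i>) = id_blinfun" by (rule blinfun_eqI) (simp add: blinfun.add_left inv2)
    show "norm z \<le> 1"
    proof (rule norm_blinfun_bound)
      show "norm (z v) \<le> 1 * norm v" for v
        using norm_resolvent_lower[OF yb y(2), of "z v"] unfolding inv by simp
    qed simp
  qed
qed

section \<open>The weak operator topology\<close>

abbreviation (input) WOT :: "('a::complex_hilbert_space \<Rightarrow>\<^sub>L 'a) topology" where
  "WOT \<equiv> weak_operator_topology"

lemma Union_WOT_subbase:
  "\<Union> {{T \<in> bounded_ops. cinner (T x) y \<in> U} | x y U. open U}
    = (bounded_ops :: ('a::complex_hilbert_space \<Rightarrow>\<^sub>L 'a) set)" (is "\<Union> ?B = _")
proof (rule equalityI)
  have "{T :: 'a \<Rightarrow>\<^sub>L 'a. T \<in> bounded_ops \<and> cinner (T 0) 0 \<in> UNIV} \<in> ?B"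
    using open_UNIV by blast
  then show "bounded_ops \<subseteq> \<Union> ?B" by auto
qed blast

lemma topspace_WOT [simp]: "topspace WOT = bounded_ops"
  unfolding weak_operator_topology_def topology_generated_by_topspace by (rule Union_WOT_subbase)

lemma continuous_map_WOT_cinner:
  "continuous_map WOT euclidean (\<lambda>T. cinner (T x) y)"
  unfolding continuous_map_def
proof (intro conjI allI impI)
  fix U :: "complex set" assume "openin euclidean U"
  then have "open U" by simp
  then show "openin WOT {T \<in> topspace WOT. cinner (T x) y \<in> U}"
    unfolding topspace_WOT unfolding weak_operator_topology_def
    by (intro topology_generated_by_Basis) blast
qed auto

lemma continuous_map_into_WOT:
  fixes f :: "'t \<Rightarrow> ('a::complex_hilbert_space \<Rightarrow>\<^sub>L 'a)"
  assumes "\<And>t. t \<in> topspace X \<Longrightarrow> f t \<in> bounded_ops"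
    and "\<And>x y. continuous_map X euclidean (\<lambda>t. cinner ((f t) x) y)"
  shows "continuous_map X WOT f"
  unfolding weak_operator_topology_def
proof (rule continuous_on_generated_topo)
  fix W :: "('a \<Rightarrow>\<^sub>L 'a) set"
  assume "W \<in> {{T \<in> bounded_ops. cinner (T x) y \<in> U} | x y U. open U}"
  then obtain x y U where U: "open U" and W: "W = {T \<in> bounded_ops. cinner (T x) y \<in> U}" by blast
  have "f -` W \<inter> topspace X = {t \<in> topspace X. cinner ((f t) x) y \<in> U}"
    using assms(1) by (auto simp: W)
  then show "openin X (f -` W \<inter> topspace X)"
    using assms(2)[of x y] U by (simp add: continuous_map_def)
next
  show "f ` topspace X \<subseteq> \<Union> {{T \<in> bounded_ops. cinner (T x) y \<in> U} | x y U. open U}"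
    unfolding Union_WOT_subbase using assms(1) by auto
qed

text \<open>
  Closed sets of operators are usually given by conditions on all matrix coefficients.
\<close>

lemma closedin_WOT_all:
  assumes "\<And>i. closedin WOT {T \<in> bounded_ops. P i T}"
  shows "closedin WOT {T \<in> bounded_ops. \<forall>i. P i T}"
proof -
  have "{T \<in> bounded_ops. \<forall>i. P i T} = (\<Inter>i. {T \<in> bounded_ops. P i T})" by auto
  then show ?thesis using assms by auto
qed

lemma closedin_WOT_functional:
  fixes f :: "('a::complex_hilbert_space \<Rightarrow>\<^sub>L 'a) \<Rightarrow> 'b::topological_space"
  assumes "continuous_map WOT euclidean f" "closed C"
  shows "closedin WOT {T \<in> bounded_ops. f T \<in> C}"
  using closedin_continuous_map_preimage[OF assms(1), of C] assms(2) by simp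

definition op_ball :: "real \<Rightarrow> ('a::complex_hilbert_space \<Rightarrow>\<^sub>L 'a) set" where
  "op_ball r = {T \<in> bounded_ops. norm T \<le> r}"

lemma op_ball_eq:
  assumes "r \<ge> 0"
  shows "op_ball r = {T \<in> bounded_ops. \<forall>x y. cmod (cinner (T x) y) \<le> r * norm x * norm y}"
proof (intro equalityI subsetI)
  fix T :: "'a \<Rightarrow>\<^sub>L 'a" assume T: "T \<in> op_ball r"
  then have "norm T * norm x * norm y \<le> r * norm x * norm y" for x y
    by (intro mult_right_mono) (auto simp: op_ball_def)
  then show "T \<in> {T \<in> bounded_ops. \<forall>x y. cmod (cinner (T x) y) \<le> r * norm x * norm y}"
    using T by (auto simp: op_ball_def intro: order_trans[OF cmod_cinner_op_le])
qed (use norm_op_le_of_cinner[OF _ assms] in \<open>auto simp: op_ball_def\<close>)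

lemma closedin_WOT_op_ball:
  assumes "r \<ge> 0" shows "closedin WOT (op_ball r)"
proof -
  have "closedin WOT {T \<in> bounded_ops. cinner (T x) y \<in> cball 0 (r * norm x * norm y)}"
    for x y :: 'a
    by (rule closedin_WOT_functional[OF continuous_map_WOT_cinner closed_cball])
  then have "closedin WOT {T \<in> bounded_ops. cmod (cinner (T x) y) \<le> r * norm x * norm y}"
    for x y :: 'a by (simp only: mem_cball_0)
  then show ?thesis unfolding op_ball_eq[OF assms] by (intro closedin_WOT_all)
qed

text \<open>
  By Tychonoff's theorem the sesquilinear forms bounded by \<open>r\<close> are compact for pointwise convergence, and the map
  from forms to operators is continuous.
\<close>

lemma compactin_WOT_op_ball:
  assumes r: "r \<ge> 0"
  shows "compactin WOT (op_ball r :: ('a::complex_hilbert_space \<Rightarrow>\<^sub>L 'a) set)"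
proof -
  define K where "K = (PiE UNIV (\<lambda>(x, y). cball 0 (r * norm x * norm y)) :: ('a \<times> 'a \<Rightarrow> complex) set)"
  define F where "F = {b :: 'a \<times> 'a \<Rightarrow> complex.
      (\<forall>x x' y. b (x + x', y) = b (x, y) + b (x', y)) \<and> (\<forall>c x y. b (c *\<^sub>C x, y) = c * b (x, y)) \<and>
      (\<forall>x y y'. b (x, y + y') = b (x, y) + b (x, y')) \<and> (\<forall>c x y. b (x, c *\<^sub>C y) = cnj c * b (x, y))}"
  have "compactin (product_topology (\<lambda>_. euclidean) UNIV) K"
    unfolding K_def by (subst compactin_PiE) auto
  then have "compact K" by (simp add: euclidean_product_topology)
  moreover have "closed F" unfolding F_def
    by (intro closed_Collect_conj closed_Collect_all closed_Collect_eq continuous_intros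
        continuous_on_product_coordinates)
  ultimately have cp: "compact (K \<inter> F)" by (rule compact_Int_closed)
  have "\<exists>T. T \<in> bounded_ops \<and> (\<forall>x y. cinner (T x) y = b (x, y))" if b: "b \<in> K \<inter> F" for b
  proof -
    have "cmod (b (x, y)) \<le> r * norm x * norm y" for x y
      using b by (auto simp: K_def PiE_def Pi_def)
    then obtain T where "T \<in> bounded_ops" "\<And>x y. cinner (T x) y = b (x, y)"
      using b by - (rule sesquilinear_form_operator[of "\<lambda>x y. b (x, y)" r], auto simp: F_def)
    then show ?thesis by blast
  qed
  then obtain \<Psi> where \<Psi>: "\<And>b. b \<in> K \<inter> F \<Longrightarrow> \<Psi> b \<in> bounded_ops"
    "\<And>b x y. b \<in> K \<inter> F \<Longrightarrow> cinner ((\<Psi> b) x) y = b (x, y)" by metis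
  have "continuous_map (top_of_set (K \<inter> F)) WOT \<Psi>"
  proof (rule continuous_map_into_WOT)
    fix x y
    have "continuous_map (top_of_set (K \<inter> F)) euclidean (\<lambda>b. b (x, y))"
      using continuous_on_subset[OF continuous_on_product_coordinates] by simp
    then show "continuous_map (top_of_set (K \<inter> F)) euclidean (\<lambda>b. cinner ((\<Psi> b) x) y)"
      by (rule continuous_map_eq) (simp add: \<Psi>)
  qed (use \<Psi> in simp)
  moreover have "compactin (top_of_set (K \<inter> F)) (K \<inter> F)"
    using cp by (simp add: compactin_subtopology)
  ultimately have "compactin WOT (\<Psi> ` (K \<inter> F))"
    by (metis image_compactin)
  moreover have "\<Psi> ` (K \<inter> F) = op_ball r"
  proof (intro equalityI subsetI)
    fix T assume "T \<in> \<Psi> ` (K \<inter> F)"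
    then obtain b where b: "b \<in> K \<inter> F" "T = \<Psi> b" by blast
    then have "cmod (b (x, y)) \<le> r * norm x * norm y" for x y
      by (auto simp: K_def PiE_def Pi_def)
    then show "T \<in> op_ball r" using b \<Psi> by (simp add: op_ball_eq[OF r])
  next
    fix T :: "'a \<Rightarrow>\<^sub>L 'a" assume T: "T \<in> op_ball r"
    define b where "b = (\<lambda>(x, y). cinner (T x) y)"
    have Tb: "T \<in> bounded_ops" using T by (simp add: op_ball_def)
    have "b \<in> K" using T by (auto simp: op_ball_eq[OF r] K_def b_def)
    moreover have "b \<in> F"
      by (auto simp: F_def b_def blinfun.add_right cinner_add_left cinner_add_right bounded_opsD[OF Tb]
          cinner_scaleC_left cinner_scaleC_right)
    ultimately have bKF: "b \<in> K \<inter> F" by simp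
    have "\<Psi> b = T"
      by (intro blinfun_eqI cinner_ext) (simp add: \<Psi>[OF bKF], simp add: b_def)
    then show "T \<in> \<Psi> ` (K \<inter> F)" using bKF by blast
  qed
  ultimately show ?thesis by simp
qed

lemma compactin_fip_indexed:
  assumes C: "compactin X C" and D: "\<And>i. i \<in> I \<Longrightarrow> closedin X (D i)"
    and fin: "\<And>F. finite F \<Longrightarrow> F \<subseteq> I \<Longrightarrow> \<exists>x\<in>C. \<forall>i\<in>F. x \<in> D i"
  obtains x where "x \<in> C" "\<And>i. i \<in> I \<Longrightarrow> x \<in> D i"
proof -
  have "C \<inter> \<Inter> (D ` I) \<noteq> {}"
  proof (rule C[unfolded compactin_fip, THEN conjunct2, rule_format])
    show "(\<forall>C\<in>D ` I. closedin X C) \<and> (\<forall>\<F>. finite \<F> \<and> \<F> \<subseteq> D ` I \<longrightarrow> C \<inter> \<Inter> \<F> \<noteq> {})"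
    proof (intro conjI allI impI)
      fix \<F> assume "finite \<F> \<and> \<F> \<subseteq> D ` I"
      then obtain F where "finite F" "F \<subseteq> I" "\<F> = D ` F" by (metis finite_subset_image)
      then show "C \<inter> \<Inter> \<F> \<noteq> {}" using fin[of F] by blast
    qed (use D in auto)
  qed
  then show ?thesis using that by blast
qed

lemma WOT_closure_approx:
  assumes X: "X \<in> WOT closure_of S" and E: "finite E" and d: "d > 0"
  obtains Y where "Y \<in> S" "\<And>x y. (x, y) \<in> E \<Longrightarrow> cmod (cinner ((Y - X) x) y) < d"
proof -
  have Xb: "X \<in> bounded_ops" using X by (simp add: in_closure_of)
  let ?N = "\<lambda>E. {T \<in> bounded_ops. \<forall>(x, y)\<in>E. cmod (cinner ((T - X) x) y) < d}"
  have "openin WOT (?N E)"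
    using E
  proof induction
    case empty
    then show ?case using openin_topspace[of WOT] by simp
  next
    case (insert p E)
    obtain x y where p: "p = (x, y)" by (cases p)
    have "?N {p} = {T \<in> topspace WOT.
        cinner (T x) y \<in> ball (cinner (X x) y) d}"
      by (auto simp: p dist_norm blinfun.diff_left cinner.diff_left norm_minus_commute)
    moreover have "openin WOT \<dots>"
      by (rule openin_continuous_map_preimage[OF continuous_map_WOT_cinner]) simp
    moreover have "?N (insert p E) = ?N {p} \<inter> ?N E" by auto
    ultimately show ?case using insert.IH by (metis (no_types, lifting) openin_Int)
  qed
  moreover have "X \<in> ?N E" using Xb d by (simp add: cinner.zero_left case_prod_unfold)
  ultimately obtain Y where "Y \<in> S" "Y \<in> ?N E"
    using X[unfolded in_closure_of, THEN conjunct2, rule_format, of "?N E"] by auto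
  then show ?thesis using that by auto
qed

text \<open>
  Finitely many matrix coefficients define a neighborhood base.
\<close>

lemma WOT_open_basic_nbhd:
  assumes "openin WOT U" "X \<in> U"
  obtains E d where "finite E" "d > 0"
    "\<And>Y. Y \<in> bounded_ops \<Longrightarrow> (\<And>x y. (x, y) \<in> E \<Longrightarrow> cmod (cinner ((Y - X) x) y) < d) \<Longrightarrow> Y \<in> U"
proof -
  have "generate_topology_on {{T \<in> bounded_ops. cinner (T x) y \<in> U} | x y U. open U} U"
    using assms(1) unfolding weak_operator_topology_def by (rule openin_topology_generated_by)
  then have "X \<in> U \<longrightarrow> (\<exists>E d. finite E \<and> d > 0 \<and> (\<forall>Y\<in>bounded_ops.
      (\<forall>(x, y)\<in>E. cmod (cinner ((Y - X) x) y) < d) \<longrightarrow> Y \<in> U))"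
  proof induction
    case (Int a b)
    show ?case
    proof
      assume "X \<in> a \<inter> b"
      then have X: "X \<in> a" "X \<in> b" by auto
      obtain E d where 1: "finite E" "d > 0"
        "\<forall>Y\<in>bounded_ops. (\<forall>(x, y)\<in>E. cmod (cinner ((Y - X) x) y) < d) \<longrightarrow> Y \<in> a"
        using Int.IH(1)[rule_format, OF X(1)] by blast
      obtain E' d' where 2: "finite E'" "d' > 0"
        "\<forall>Y\<in>bounded_ops. (\<forall>(x, y)\<in>E'. cmod (cinner ((Y - X) x) y) < d') \<longrightarrow> Y \<in> b"
        using Int.IH(2)[rule_format, OF X(2)] by blast
      have "Y \<in> a \<inter> b" if "Y \<in> bounded_ops"
        "\<forall>(x, y)\<in>E \<union> E'. cmod (cinner ((Y - X) x) y) < min d d'" for Y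
        using 1(3) 2(3) that by fastforce
      then show "\<exists>E d. finite E \<and> d > 0 \<and> (\<forall>Y\<in>bounded_ops.
          (\<forall>(x, y)\<in>E. cmod (cinner ((Y - X) x) y) < d) \<longrightarrow> Y \<in> a \<inter> b)"
        using 1(1,2) 2(1,2) by (intro exI[of _ "E \<union> E'"] exI[of _ "min d d'"]) auto
    qed
  next
    case (UN K)
    then show ?case by (meson Union_iff)
  next
    case (Basis s)
    then obtain x y V where V: "open V" and s: "s = {T \<in> bounded_ops. cinner (T x) y \<in> V}" by blast
    show ?case
    proof
      assume "X \<in> s"
      then obtain d where "d > 0" "\<And>w. dist w (cinner (X x) y) < d \<Longrightarrow> w \<in> V"
        using V by (auto simp: s open_dist)
      then show "\<exists>E d. finite E \<and> d > 0 \<and> (\<forall>Y\<in>bounded_ops.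
          (\<forall>(x, y)\<in>E. cmod (cinner ((Y - X) x) y) < d) \<longrightarrow> Y \<in> s)"
        by (intro exI[of _ "{(x, y)}"] exI[of _ d]) (auto simp: s dist_norm blinfun.diff_left cinner.diff_left)
    qed
  qed auto
  then show ?thesis using assms(2) that by (metis (no_types, lifting) case_prodI2)
qed

lemma in_WOT_closureI:
  assumes "S \<subseteq> bounded_ops" "X \<in> bounded_ops"
    and "\<And>E d. finite E \<Longrightarrow> d > 0 \<Longrightarrow> \<exists>Y\<in>S. \<forall>(x, y)\<in>E. cmod (cinner ((Y - X) x) y) < d"
  shows "X \<in> WOT closure_of S"
  unfolding in_closure_of
proof (intro conjI allI impI)
  show "X \<in> topspace WOT" using assms by simp
  fix U assume "X \<in> U \<and> openin WOT U"
  then obtain E d where E: "finite E" "d > 0" and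
    U: "\<And>Y. Y \<in> bounded_ops \<Longrightarrow> (\<And>x y. (x, y) \<in> E \<Longrightarrow> cmod (cinner ((Y - X) x) y) < d) \<Longrightarrow> Y \<in> U"
    using WOT_open_basic_nbhd by metis
  obtain Y where "Y \<in> S" "\<forall>(x, y)\<in>E. cmod (cinner ((Y - X) x) y) < d"
    using assms(3)[OF E] by blast
  then show "\<exists>y. y \<in> S \<and> y \<in> U" using U[of Y] assms(1) by auto
qed

lemma convex_WOT_closure:
  assumes S: "convex S" "S \<subseteq> bounded_ops"
  shows "convex (WOT closure_of S)"
proof (rule convexI)
  fix X Y and u v :: real
  assume X: "X \<in> WOT closure_of S" and Y: "Y \<in> WOT closure_of S"
    and uv: "0 \<le> u" "0 \<le> v" "u + v = 1"
  have b: "X \<in> bounded_ops" "Y \<in> bounded_ops" using X Y by (auto simp: in_closure_of)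
  show "u *\<^sub>R X + v *\<^sub>R Y \<in> WOT closure_of S"
  proof (rule in_WOT_closureI[OF S(2)])
    show "u *\<^sub>R X + v *\<^sub>R Y \<in> bounded_ops" using b by simp
    fix E :: "('a \<times> 'a) set" and d :: real assume E: "finite E" "d > 0"
    obtain X' where X': "X' \<in> S" "\<And>x y. (x, y) \<in> E \<Longrightarrow> cmod (cinner ((X' - X) x) y) < d"
      using WOT_closure_approx[OF X E] by blast
    obtain Y' where Y': "Y' \<in> S" "\<And>x y. (x, y) \<in> E \<Longrightarrow> cmod (cinner ((Y' - Y) x) y) < d"
      using WOT_closure_approx[OF Y E] by blast
    have "cmod (cinner ((u *\<^sub>R X' + v *\<^sub>R Y' - (u *\<^sub>R X + v *\<^sub>R Y)) x) y) < d" if "(x, y) \<in> E" for x y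
    proof -
      let ?a = "cinner ((X' - X) x) y" and ?b = "cinner ((Y' - Y) x) y"
      have "u *\<^sub>R X' + v *\<^sub>R Y' - (u *\<^sub>R X + v *\<^sub>R Y) = u *\<^sub>R (X' - X) + v *\<^sub>R (Y' - Y)"
        by (simp add: algebra_simps)
      then have "cinner ((u *\<^sub>R X' + v *\<^sub>R Y' - (u *\<^sub>R X + v *\<^sub>R Y)) x) y = u *\<^sub>R ?a + v *\<^sub>R ?b"
        by (simp only: blinfun.add_left blinfun.scaleR_left cinner_add_left cinner.scaleR_left)
      moreover have "norm (u *\<^sub>R ?a + v *\<^sub>R ?b) \<le> u * norm ?a + v * norm ?b"
        using norm_triangle_ineq[of "u *\<^sub>R ?a" "v *\<^sub>R ?b"] uv by simp
      moreover have "u * norm ?a + v * norm ?b < d"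
        using convex_bound_lt[OF X'(2)[OF that] Y'(2)[OF that] uv] by simp
      ultimately show ?thesis by simp
    qed
    moreover have "u *\<^sub>R X' + v *\<^sub>R Y' \<in> S" using S(1) X'(1) Y'(1) uv by (simp add: convexD)
    ultimately show "\<exists>Z\<in>S. \<forall>(x, y)\<in>E. cmod (cinner ((Z - (u *\<^sub>R X + v *\<^sub>R Y)) x) y) < d"
      by blast
  qed
qed

text \<open>
  On a linear subspace weak approximability implies strong approximability. The residuals \<open>\<eta>\<close> of the vectors
  \<open>X \<xi>\<close> are orthogonal to the subspace, hence, by weak approximation, to \<open>X\<close> itself, and therefore vanish.
\<close>

lemma subspace_WOT_to_SOT:
  fixes S :: "('a::complex_hilbert_space \<Rightarrow>\<^sub>L 'a) set"
  assumes S: "subspace S" and \<Xi>: "finite \<Xi>" and e: "e > 0"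
    and X: "\<And>E d. finite E \<Longrightarrow> d > 0 \<Longrightarrow> \<exists>Y\<in>S. \<forall>(x, y)\<in>E. cmod (cinner (blinfun_apply (Y - X) x) y) < d"
  obtains Y where "Y \<in> S" "\<And>\<xi>. \<xi> \<in> \<Xi> \<Longrightarrow> norm (blinfun_apply (X - Y) \<xi>) < e"
proof -
  obtain y \<eta> where y: "\<And>n::nat. y n \<in> S"
    and lim: "\<And>\<xi>. \<xi> \<in> \<Xi> \<Longrightarrow> (\<lambda>n. blinfun_apply (X - y n) \<xi>) \<longlonglongrightarrow> \<eta> \<xi>"
    and orth: "\<And>s. s \<in> S \<Longrightarrow> (\<Sum>\<xi>\<in>\<Xi>. inner (\<eta> \<xi>) (blinfun_apply s \<xi>)) = 0"
    by (rule orthogonal_residual[OF S \<Xi>, of "\<lambda>\<xi> T. blinfun_apply T \<xi>" X])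
      (auto simp: blinfun.add_left blinfun.scaleR_left intro: linearI)
  have "\<bar>\<Sum>\<xi>\<in>\<Xi>. inner (\<eta> \<xi>) (blinfun_apply X \<xi>)\<bar> \<le> 0 + d" if d: "d > 0" for d
  proof -
    define c where "c = d / (card \<Xi> + 1)"
    have c: "c > 0" using d by (simp add: c_def)
    obtain Y where Y: "Y \<in> S" "\<And>\<xi>. \<xi> \<in> \<Xi> \<Longrightarrow> cmod (cinner (blinfun_apply (Y - X) \<xi>) (\<eta> \<xi>)) < c"
      using X[of "(\<lambda>\<xi>. (\<xi>, \<eta> \<xi>)) ` \<Xi>" c] \<Xi> c by auto
    have "(\<Sum>\<xi>\<in>\<Xi>. inner (\<eta> \<xi>) (blinfun_apply X \<xi>)) = - (\<Sum>\<xi>\<in>\<Xi>. inner (\<eta> \<xi>) (blinfun_apply (Y - X) \<xi>))"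
      using orth[OF Y(1)] by (simp add: blinfun.diff_left inner_diff_right sum_subtractf)
    then have "\<bar>\<Sum>\<xi>\<in>\<Xi>. inner (\<eta> \<xi>) (blinfun_apply X \<xi>)\<bar> \<le> (\<Sum>\<xi>\<in>\<Xi>. \<bar>inner (\<eta> \<xi>) (blinfun_apply (Y - X) \<xi>)\<bar>)"
      by (simp add: sum_abs)
    also have "\<dots> \<le> (\<Sum>\<xi>\<in>\<Xi>. c)"
    proof (rule sum_mono)
      fix \<xi> assume "\<xi> \<in> \<Xi>"
      then have "cmod (cinner (blinfun_apply (Y - X) \<xi>) (\<eta> \<xi>)) < c" by (rule Y(2))
      then show "\<bar>inner (\<eta> \<xi>) (blinfun_apply (Y - X) \<xi>)\<bar> \<le> c"
        using abs_Re_le_cmod[of "cinner (blinfun_apply (Y - X) \<xi>) (\<eta> \<xi>)"] by (simp add: Re_cinner inner_commute)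
    qed
    also have "\<dots> \<le> d" using d by (simp add: c_def field_simps)
    finally show ?thesis by simp
  qed
  then have "\<bar>\<Sum>\<xi>\<in>\<Xi>. inner (\<eta> \<xi>) (blinfun_apply X \<xi>)\<bar> \<le> 0" by (rule field_le_epsilon)
  then have "(\<Sum>\<xi>\<in>\<Xi>. inner (\<eta> \<xi>) (blinfun_apply (X - y n) \<xi>)) = 0" for n
    using orth[OF y] by (simp add: blinfun.diff_left inner_diff_right sum_subtractf)
  moreover have "(\<lambda>n. \<Sum>\<xi>\<in>\<Xi>. inner (\<eta> \<xi>) (blinfun_apply (X - y n) \<xi>)) \<longlonglongrightarrow> (\<Sum>\<xi>\<in>\<Xi>. inner (\<eta> \<xi>) (\<eta> \<xi>))"
    using lim by (auto intro!: tendsto_intros)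
  ultimately have "(\<Sum>\<xi>\<in>\<Xi>. inner (\<eta> \<xi>) (\<eta> \<xi>)) = 0" by (simp add: LIMSEQ_const_iff)
  then have "\<eta> \<xi> = 0" if "\<xi> \<in> \<Xi>" for \<xi> using \<Xi> that by (simp add: sum_nonneg_eq_0_iff)
  then have "\<forall>\<^sub>F n in sequentially. norm (blinfun_apply (X - y n) \<xi>) < e" if "\<xi> \<in> \<Xi>" for \<xi>
    using lim[OF that] that e by (auto simp: tendsto_iff)
  then have "\<forall>\<^sub>F n in sequentially. \<forall>\<xi>\<in>\<Xi>. norm (blinfun_apply (X - y n) \<xi>) < e"
    using \<Xi> by (simp add: eventually_ball_finite)
  then obtain n where "\<forall>\<xi>\<in>\<Xi>. norm (blinfun_apply (X - y n) \<xi>) < e"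
    using eventually_happens'[OF sequentially_bot] by blast
  then show ?thesis using y that by blast
qed

text \<open>
  On bounded sets the series that define the ultraweak topology converge uniformly, so that there the weak operator
  topology is as fine as the ultraweak one. This is how normality of the trace enters.
\<close>

lemma continuous_map_ball_WOT_ultraweak:
  "continuous_map (subtopology WOT (op_ball r)) ultraweak_topology id"
  unfolding ultraweak_topology_def
proof (rule continuous_on_generated_topo)
  let ?X = "subtopology WOT (op_ball r :: ('a \<Rightarrow>\<^sub>L 'a) set)"
  have ts: "topspace ?X = op_ball r" by (auto simp: op_ball_def)
  let ?B = "{{T \<in> bounded_ops. (\<Sum>n. cinner (T (\<xi> n)) (\<eta> n)) \<in> U} | \<xi> \<eta> U.
        summable (\<lambda>n::nat. (norm (\<xi> n :: 'a))\<^sup>2) \<and> summable (\<lambda>n. (norm (\<eta> n))\<^sup>2) \<and> open U}"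
  fix W assume "W \<in> ?B"
  then obtain \<xi> \<eta> U where sm: "summable (\<lambda>n::nat. (norm (\<xi> n :: 'a))\<^sup>2)" "summable (\<lambda>n. (norm (\<eta> n :: 'a))\<^sup>2)"
    and U: "open U" and W: "W = {T \<in> bounded_ops. (\<Sum>n. cinner (T (\<xi> n)) (\<eta> n)) \<in> U}"
    by blast
  have summ: "summable (\<lambda>n. r * ((norm (\<xi> n))\<^sup>2 + (norm (\<eta> n))\<^sup>2))"
    using sm by (intro summable_mult summable_add)
  have "uniform_limit (op_ball r) (\<lambda>N T. \<Sum>n<N. cinner (T (\<xi> n)) (\<eta> n))
      (\<lambda>T. \<Sum>n. cinner (T (\<xi> n)) (\<eta> n)) sequentially"
  proof (rule Weierstrass_m_test[OF _ summ])
    fix n and T :: "'a \<Rightarrow>\<^sub>L 'a" assume T: "T \<in> op_ball r"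
    have r: "norm T \<le> r" "r \<ge> 0" using T norm_ge_zero[of T] by (auto simp: op_ball_def intro: order_trans[OF norm_ge_zero])
    have ab: "a * b \<le> a\<^sup>2 + b\<^sup>2" for a b :: real
      using sum_squares_bound[of a b] sum_power2_ge_zero[of a b] unfolding mult.assoc by linarith
    have "cmod (cinner (T (\<xi> n)) (\<eta> n)) \<le> norm T * norm (\<xi> n) * norm (\<eta> n)" by (rule cmod_cinner_op_le)
    also have "\<dots> \<le> r * (norm (\<xi> n) * norm (\<eta> n))" using r by (simp add: mult_right_mono mult.assoc)
    also have "\<dots> \<le> r * ((norm (\<xi> n))\<^sup>2 + (norm (\<eta> n))\<^sup>2)" using r ab by (intro mult_left_mono) auto
    finally show "norm (cinner (T (\<xi> n)) (\<eta> n)) \<le> r * ((norm (\<xi> n))\<^sup>2 + (norm (\<eta> n))\<^sup>2)" by simp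
  qed
  then have ul: "\<forall>\<^sub>F N in sequentially. \<forall>T\<in>op_ball r. dist (\<Sum>n<N. cinner (T (\<xi> n)) (\<eta> n))
      (\<Sum>n. cinner (T (\<xi> n)) (\<eta> n)) < e" if "e > 0" for e
    using that by (rule uniform_limitD)
  have "continuous_map ?X Met_TC.mtopology (\<lambda>T. \<Sum>n. cinner (T (\<xi> n)) (\<eta> n))"
  proof (rule Met_TC.continuous_map_uniform_limit[where F = sequentially])
    have "continuous_map ?X euclidean (\<lambda>T. \<Sum>n<N. cinner (T (\<xi> n)) (\<eta> n))" for N :: nat
      by (intro continuous_map_sum continuous_map_from_subtopology continuous_map_WOT_cinner) simp
    then show "\<forall>\<^sub>F N in sequentially. continuous_map ?X Met_TC.mtopology (\<lambda>T. \<Sum>n<N. cinner (T (\<xi> n)) (\<eta> n))"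
      by simp
    show "\<forall>\<^sub>F N in sequentially. \<forall>T\<in>topspace ?X. (\<Sum>n. cinner (T (\<xi> n)) (\<eta> n)) \<in> UNIV \<and>
       dist (\<Sum>n<N. cinner (T (\<xi> n)) (\<eta> n)) (\<Sum>n. cinner (T (\<xi> n)) (\<eta> n)) < e" if "e > 0" for e
      using ul[OF that] unfolding ts by simp
  qed simp
  then have "openin ?X {T \<in> topspace ?X. (\<Sum>n. cinner (T (\<xi> n)) (\<eta> n)) \<in> U}"
    using U by (simp add: continuous_map_def)
  moreover have "id -` W \<inter> topspace ?X = {T \<in> topspace ?X. (\<Sum>n. cinner (T (\<xi> n)) (\<eta> n)) \<in> U}"
    unfolding ts by (auto simp: W op_ball_def)
  ultimately show "openin ?X (id -` W \<inter> topspace ?X)" by simp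
next
  let ?B = "{{T \<in> bounded_ops. (\<Sum>n. cinner (T (\<xi> n)) (\<eta> n)) \<in> U} | \<xi> \<eta> U.
        summable (\<lambda>n::nat. (norm (\<xi> n :: 'a))\<^sup>2) \<and> summable (\<lambda>n. (norm (\<eta> n))\<^sup>2) \<and> open U}"
  have "bounded_ops = {T::'a \<Rightarrow>\<^sub>L 'a. T \<in> bounded_ops \<and> (\<Sum>n. cinner (T ((\<lambda>_. 0) n)) ((\<lambda>_. 0) n)) \<in> UNIV}" by simp
  moreover have "\<dots> \<in> ?B"
    by (intro CollectI exI[of _ "\<lambda>_. 0"] exI[of _ UNIV]) simp
  ultimately have "bounded_ops \<in> ?B" by simp
  then have "bounded_ops \<subseteq> \<Union> ?B" by blast
  then show "id ` topspace (subtopology WOT (op_ball r)) \<subseteq> \<Union> ?B"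
    by auto
qed

lemma norm_continuous_WOT: "continuous_map (top_of_set bounded_ops) WOT (\<lambda>T. T)"
proof (rule continuous_map_into_WOT)
  fix x y :: 'a
  have "continuous_on bounded_ops (\<lambda>T. cinner (T x) y)"
    by (intro continuous_intros)
  then show "continuous_map (top_of_set bounded_ops) euclidean (\<lambda>T. cinner (T x) y)" by simp
qed simp

lemma closed_bounded_ops: "closed (bounded_ops :: ('a::complex_hilbert_space \<Rightarrow>\<^sub>L 'a) set)"
  unfolding bounded_ops_def
  by (intro closed_Collect_all closed_Collect_eq continuous_intros bounded_linear.continuous_on[OF bounded_linear_scaleC])

lemma closedin_WOT_imp_closed:
  assumes "closedin WOT S" shows "closed S"
proof -
  have "closedin (top_of_set bounded_ops) {T \<in> topspace (top_of_set bounded_ops). T \<in> S}"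
    by (rule closedin_continuous_map_preimage[OF norm_continuous_WOT assms])
  moreover have "{T \<in> topspace (top_of_set bounded_ops). T \<in> S} = S"
    using closedin_subset[OF assms] by auto
  ultimately show ?thesis using closed_bounded_ops closedin_closed_trans by fastforce
qed

lemma closed_subalgebra_von_neumann: "von_neumann_algebra M \<Longrightarrow> closed_subalgebra M"
  unfolding von_neumann_algebra_def closed_subalgebra_def using closedin_WOT_imp_closed by blast

section \<open>The standard representation of a tracial algebra\<close>

text \<open>
  The constant disappears on taking \<open>2\<^sup>k\<close>-th roots.
\<close>

lemma le_of_pow_le:
  fixes a b C :: real
  assumes "a \<ge> 0" "b \<ge> 0" "\<And>k::nat. a ^ (2 ^ k) \<le> C * b ^ (2 ^ k)"
  shows "a \<le> b"
proof (rule ccontr)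
  assume "\<not> a \<le> b"
  then have ab: "a > b" by simp
  show False
  proof (cases "b = 0")
    case True
    then show False using assms(3)[of 0] ab by simp
  next
    case False
    then have b: "b > 0" using assms by simp
    then have "a / b > 1" using ab by simp
    then obtain k where k: "C < (a / b) ^ k" using real_arch_pow by blast
    also have "(a / b) ^ k \<le> (a / b) ^ (2 ^ k)"
      using \<open>a / b > 1\<close> by (intro power_increasing) (auto intro: less_imp_le)
    also have "\<dots> \<le> C" using assms(3)[of k] b by (simp add: power_divide divide_le_eq)
    finally show False by simp
  qed
qed

lemma dense_extension:
  fixes f :: "'b::real_normed_vector \<Rightarrow> 'c::banach"
  assumes D: "subspace D" "closure D = UNIV"
    and add: "\<And>x y. x \<in> D \<Longrightarrow> y \<in> D \<Longrightarrow> f (x + y) = f x + f y"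
    and scale: "\<And>r x. x \<in> D \<Longrightarrow> f (r *\<^sub>R x) = r *\<^sub>R f x"
    and bd: "\<And>x. x \<in> D \<Longrightarrow> norm (f x) \<le> K * norm x" and K: "K \<ge> 0"
  obtains B where "\<And>x. x \<in> D \<Longrightarrow> blinfun_apply B x = f x" "norm B \<le> K"
proof -
  have diff: "f x - f y = f (x - y)" if "x \<in> D" "y \<in> D" for x y
  proof -
    have "x - y \<in> D" using D that by (simp add: subspace_diff)
    from add[OF this that(2)] show ?thesis by simp
  qed
  have "uniformly_continuous_on D f"
    unfolding uniformly_continuous_on_def
  proof (intro allI impI)
    fix e :: real assume e: "e > 0"
    show "\<exists>d>0. \<forall>x\<in>D. \<forall>x'\<in>D. dist x' x < d \<longrightarrow> dist (f x') (f x) < e"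
    proof (intro exI[of _ "e / (K + 1)"] conjI ballI impI)
      show "e / (K + 1) > 0" using e K by simp
      fix x x' assume x: "x \<in> D" "x' \<in> D" "dist x' x < e / (K + 1)"
      have "dist (f x') (f x) = norm (f (x' - x))" by (simp add: dist_norm diff x)
      also have "\<dots> \<le> K * norm (x' - x)" using D x by (intro bd) (simp add: subspace_diff)
      also have "\<dots> \<le> (K + 1) * norm (x' - x)" by (intro mult_right_mono) auto
      also have "\<dots> < e" using x(3) K by (simp add: dist_norm field_simps)
      finally show "dist (f x') (f x) < e" .
    qed
  qed
  then obtain g where ug: "uniformly_continuous_on (closure D) g" and g: "\<And>x. x \<in> D \<Longrightarrow> f x = g x"
    using uniformly_continuous_on_extension_on_closure by metis
  have cg: "continuous_on UNIV g" using ug D by (simp add: uniformly_continuous_imp_continuous)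
  have seq: "\<exists>s. (\<forall>n::nat. s n \<in> D) \<and> s \<longlonglongrightarrow> x" for x
    using D(2) closure_sequential by blast
  have lim: "(\<lambda>n. g (s n)) \<longlonglongrightarrow> g x" if "s \<longlonglongrightarrow> x" for s x
    by (rule continuous_on_tendsto_compose[OF cg that]) auto
  have bl: "bounded_linear g"
  proof (rule bounded_linear_intro)
    show "g (x + y) = g x + g y" for x y
    proof -
      obtain s t where s: "\<And>n::nat. s n \<in> D" "s \<longlonglongrightarrow> x" and t: "\<And>n::nat. t n \<in> D" "t \<longlonglongrightarrow> y"
        using seq[of x] seq[of y] by blast
      have "(\<lambda>n. g (s n + t n)) \<longlonglongrightarrow> g (x + y)" by (intro lim tendsto_add s t)
      moreover have "g (s n + t n) = g (s n) + g (t n)" for n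
        using add[OF s(1) t(1)] g s t D by (metis subspace_add)
      moreover have "(\<lambda>n. g (s n) + g (t n)) \<longlonglongrightarrow> g x + g y" by (intro lim tendsto_add s t)
      ultimately show ?thesis by (simp add: LIMSEQ_unique)
    qed
    show "g (r *\<^sub>R x) = r *\<^sub>R g x" for r x
    proof -
      obtain s where s: "\<And>n::nat. s n \<in> D" "s \<longlonglongrightarrow> x" using seq[of x] by blast
      have "(\<lambda>n. g (r *\<^sub>R s n)) \<longlonglongrightarrow> g (r *\<^sub>R x)" by (intro lim tendsto_scaleR tendsto_const s)
      moreover have "g (r *\<^sub>R s n) = r *\<^sub>R g (s n)" for n
        using scale[OF s(1)] g s D by (metis subspace_scale)
      moreover have "(\<lambda>n. r *\<^sub>R g (s n)) \<longlonglongrightarrow> r *\<^sub>R g x" by (intro lim tendsto_scaleR tendsto_const s)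
      ultimately show ?thesis by (simp add: LIMSEQ_unique)
    qed
    show "norm (g x) \<le> norm x * K" for x
    proof -
      obtain s where s: "\<And>n::nat. s n \<in> D" "s \<longlonglongrightarrow> x" using seq[of x] by blast
      show ?thesis
      proof (rule LIMSEQ_le)
        show "(\<lambda>n. norm (g (s n))) \<longlonglongrightarrow> norm (g x)" by (intro tendsto_norm lim s)
        show "(\<lambda>n. norm (s n) * K) \<longlonglongrightarrow> norm x * K" by (intro tendsto_mult tendsto_norm tendsto_const s)
        show "\<exists>N. \<forall>n\<ge>N. norm (g (s n)) \<le> norm (s n) * K" using bd[OF s(1)] g[OF s(1)] by (simp add: mult.commute)
      qed
    qed
  qed
  show ?thesis
  proof (rule that[of "Blinfun g"])
    show "x \<in> D \<Longrightarrow> blinfun_apply (Blinfun g) x = f x" for x by (simp add: bounded_linear_Blinfun_apply[OF bl] g)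
    show "norm (Blinfun g) \<le> K"
    proof (rule norm_blinfun_bound[OF K])
      fix x
      obtain s where s: "\<And>n::nat. s n \<in> D" "s \<longlonglongrightarrow> x" using seq[of x] by blast
      have "norm (g x) \<le> K * norm x"
      proof (rule LIMSEQ_le)
        show "(\<lambda>n. norm (g (s n))) \<longlonglongrightarrow> norm (g x)" by (intro tendsto_norm lim s)
        show "(\<lambda>n. K * norm (s n)) \<longlonglongrightarrow> K * norm x" by (intro tendsto_mult tendsto_norm tendsto_const s)
        show "\<exists>N. \<forall>n\<ge>N. norm (g (s n)) \<le> K * norm (s n)" using bd[OF s(1)] g[OF s(1)] by simp
      qed
      then show "norm (blinfun_apply (Blinfun g) x) \<le> K * norm x" by (simp add: bounded_linear_Blinfun_apply[OF bl])
    qed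
  qed
qed

locale tracial_algebra =
  fixes M :: "('a::complex_hilbert_space \<Rightarrow>\<^sub>L 'a) set"
    and \<tau> :: "('a \<Rightarrow>\<^sub>L 'a) \<Rightarrow> complex"
    and hat :: "('a \<Rightarrow>\<^sub>L 'a) \<Rightarrow> 'b::complex_hilbert_space"
  assumes vN: "von_neumann_algebra M"
    and trace: "faithful_normal_tracial_state M \<tau>"
    and L2: "L2_completion M \<tau> hat"
begin

lemma M_bounded: "x \<in> M \<Longrightarrow> x \<in> bounded_ops" using vN by (auto simp: von_neumann_algebra_def)
lemma M_id [simp]: "id_blinfun \<in> M" using vN by (simp add: von_neumann_algebra_def)
lemma M_add [simp]: "x \<in> M \<Longrightarrow> y \<in> M \<Longrightarrow> x + y \<in> M" using vN by (simp add: von_neumann_algebra_def)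
lemma M_compose [simp]: "x \<in> M \<Longrightarrow> y \<in> M \<Longrightarrow> x o\<^sub>L y \<in> M" using vN by (simp add: von_neumann_algebra_def)
lemma M_scalar [simp]: "x \<in> M \<Longrightarrow> scalar_op c o\<^sub>L x \<in> M" using vN by (simp add: von_neumann_algebra_def)
lemma M_adj [simp]: "x \<in> M \<Longrightarrow> adj x \<in> M" using vN by (simp add: von_neumann_algebra_def)
lemma M_scaleR [simp]: "x \<in> M \<Longrightarrow> r *\<^sub>R x \<in> M" by (simp add: scaleR_eq_scalar_op)
lemma M_diff [simp]: "x \<in> M \<Longrightarrow> y \<in> M \<Longrightarrow> x - y \<in> M"
  using M_add[of x "(-1) *\<^sub>R y"] M_scaleR[of y "-1"] by simp
lemma M_zero [simp]: "0 \<in> M" using M_diff[OF M_id M_id] by simp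

lemma adj_adj_M [simp]: "x \<in> M \<Longrightarrow> adj (adj x) = x" by (simp add: adj_adj M_bounded)
lemma adj_compose_M: "x \<in> M \<Longrightarrow> y \<in> M \<Longrightarrow> adj (x o\<^sub>L y) = adj y o\<^sub>L adj x"
  by (simp add: adj_compose M_bounded)

lemma tau_add: "x \<in> M \<Longrightarrow> y \<in> M \<Longrightarrow> \<tau> (x + y) = \<tau> x + \<tau> y"
  using trace by (simp add: faithful_normal_tracial_state_def)
lemma tau_scalar: "x \<in> M \<Longrightarrow> \<tau> (scalar_op c o\<^sub>L x) = c * \<tau> x"
  using trace by (simp add: faithful_normal_tracial_state_def)
lemma tau_commute: "x \<in> M \<Longrightarrow> y \<in> M \<Longrightarrow> \<tau> (x o\<^sub>L y) = \<tau> (y o\<^sub>L x)"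
  using trace by (simp add: faithful_normal_tracial_state_def)
lemma tau_faithful: "x \<in> M \<Longrightarrow> \<tau> (adj x o\<^sub>L x) = 0 \<Longrightarrow> x = 0"
  using trace by (simp add: faithful_normal_tracial_state_def)

lemma hat_add: "x \<in> M \<Longrightarrow> y \<in> M \<Longrightarrow> hat (x + y) = hat x + hat y"
  using L2 by (simp add: L2_completion_def)
lemma hat_scalar: "x \<in> M \<Longrightarrow> hat (scalar_op c o\<^sub>L x) = c *\<^sub>C hat x"
  using L2 by (simp add: L2_completion_def)
lemma cinner_hat: "x \<in> M \<Longrightarrow> y \<in> M \<Longrightarrow> cinner (hat x) (hat y) = \<tau> (adj y o\<^sub>L x)"
  using L2 by (simp add: L2_completion_def)
lemma hat_dense: "closure (hat ` M) = UNIV"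
  using L2 by (simp add: L2_completion_def)
lemma hat_scaleR: "x \<in> M \<Longrightarrow> hat (r *\<^sub>R x) = r *\<^sub>R hat x"
  by (simp add: scaleR_eq_scalar_op hat_scalar scaleR_eq_scaleC)
lemma hat_diff: "x \<in> M \<Longrightarrow> y \<in> M \<Longrightarrow> hat (x - y) = hat x - hat y"
  using hat_add[of "x - y" y] by simp

lemma hat_inj: "inj_on hat M"
proof (rule inj_onI)
  fix x y assume xy: "x \<in> M" "y \<in> M" "hat x = hat y"
  then have "cinner (hat (x - y)) (hat (x - y)) = 0" by (simp add: hat_diff cinner.zero_left)
  then have "\<tau> (adj (x - y) o\<^sub>L (x - y)) = 0" using cinner_hat[of "x - y" "x - y"] xy by simp
  then have "x - y = 0" using xy by (intro tau_faithful) auto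
  then show "x = y" by simp
qed

lemma norm_hat_sq: "x \<in> M \<Longrightarrow> (norm (hat x))\<^sup>2 = Re (\<tau> (adj x o\<^sub>L x))"
  by (metis cinner_hat cinner_self Re_complex_of_real)

lemma norm_hat_adj: "x \<in> M \<Longrightarrow> norm (hat (adj x)) = norm (hat x)"
  using norm_hat_sq[of x] norm_hat_sq[of "adj x"] tau_commute[of x "adj x"]
  by simp (metis norm_ge_zero power2_eq_imp_eq)

lemma subspace_hat: "subspace (hat ` M)"
proof (rule subspaceI)
  show "0 \<in> hat ` M" using hat_scaleR[of 0 0] M_zero by (metis imageI scaleR_zero_left)
  fix u assume "u \<in> hat ` M"
  then obtain x where x: "x \<in> M" "u = hat x" by blast
  show "c *\<^sub>R u \<in> hat ` M" for c using x hat_scaleR[of x c] by (metis M_scaleR imageI)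
  fix v assume "v \<in> hat ` M"
  then obtain y where y: "y \<in> M" "v = hat y" by blast
  then show "u + v \<in> hat ` M" using x hat_add[of x y] by (metis M_add imageI)
qed

lemma continuous_tau_ball:
  "continuous_map (subtopology WOT (M \<inter> op_ball r)) euclidean \<tau>"
proof -
  have 1: "continuous_map (subtopology ultraweak_topology M) euclidean \<tau>"
    using trace by (simp add: faithful_normal_tracial_state_def)
  have "continuous_map (subtopology WOT (M \<inter> op_ball r)) ultraweak_topology id"
    using continuous_map_from_subtopology_mono[OF continuous_map_ball_WOT_ultraweak[of r], of "M \<inter> op_ball r"] by simp
  then have "continuous_map (subtopology WOT (M \<inter> op_ball r)) (subtopology ultraweak_topology M) id"
    by (rule continuous_map_into_subtopology) auto
  from continuous_map_compose[OF this 1] show ?thesis by simp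
qed

lemma continuous_tau_left_ball:
  assumes y: "y \<in> M"
  shows "continuous_map (subtopology WOT (M \<inter> op_ball r)) euclidean (\<lambda>z. \<tau> (y o\<^sub>L z))"
proof -
  have "continuous_map (subtopology WOT (M \<inter> op_ball r)) WOT (\<lambda>z. y o\<^sub>L z)"
  proof (rule continuous_map_into_WOT)
    fix v w
    have "continuous_map (subtopology WOT (M \<inter> op_ball r)) euclidean
      (\<lambda>t. cinner (t v) ((adj y) w))"
      by (intro continuous_map_from_subtopology continuous_map_WOT_cinner)
    then show "continuous_map (subtopology WOT (M \<inter> op_ball r)) euclidean
      (\<lambda>t. cinner ((y o\<^sub>L t) v) w)"
      using y by (simp add: adj_cinner_right M_bounded)
  qed (use y M_bounded in auto)
  then have "continuous_map (subtopology WOT (M \<inter> op_ball r))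
      (subtopology WOT (M \<inter> op_ball (norm y * r))) (\<lambda>z. y o\<^sub>L z)"
  proof (rule continuous_map_into_subtopology)
    have "norm (y o\<^sub>L z) \<le> norm y * r" if "norm z \<le> r" for z
      using order_trans[OF norm_blinfun_compose mult_left_mono[OF that norm_ge_zero]] .
    then show "(\<lambda>z. y o\<^sub>L z) \<in> topspace (subtopology WOT (M \<inter> op_ball r)) \<rightarrow> M \<inter> op_ball (norm y * r)"
      using y M_bounded by (auto simp: op_ball_def)
  qed
  from continuous_map_compose[OF this continuous_tau_ball] show ?thesis by (simp add: o_def)
qed

text \<open>
  Weak continuity on the unit ball gives norm continuity there, which for a linear functional is boundedness.
\<close>

lemma tau_bounded: obtains K where "K \<ge> 0" "\<And>x. x \<in> M \<Longrightarrow> cmod (\<tau> x) \<le> K * norm x"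
proof -
  have cl: "continuous_map (top_of_set (M \<inter> op_ball 1)) (subtopology WOT (M \<inter> op_ball 1)) (\<lambda>T. T)"
  proof (rule continuous_map_into_subtopology)
    show "continuous_map (top_of_set (M \<inter> op_ball 1)) WOT (\<lambda>T. T)"
      by (rule continuous_map_from_subtopology_mono[OF norm_continuous_WOT]) (use M_bounded in auto)
  qed auto
  have "continuous_on (M \<inter> op_ball 1) \<tau>"
    using continuous_map_compose[OF cl continuous_tau_ball] by (simp add: o_def)
  moreover have "0 \<in> M \<inter> op_ball 1" by (simp add: op_ball_def)
  ultimately obtain d where d: "d > 0" "\<And>x. x \<in> M \<inter> op_ball 1 \<Longrightarrow> dist x 0 < d \<Longrightarrow> dist (\<tau> x) (\<tau> 0) < 1"
    unfolding continuous_on_iff by (metis zero_less_one)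
  have t0: "\<tau> 0 = 0" using tau_add[of 0 0] by simp
  define c where "c = min (d / 2) 1"
  have c: "c > 0" "c < d" "c \<le> 1" using d by (auto simp: c_def)
  show ?thesis
  proof (rule that[of "1 / c"])
    fix x assume x: "x \<in> M"
    show "cmod (\<tau> x) \<le> 1 / c * norm x"
    proof (cases "x = 0")
      case False
      define y where "y = (c / norm x) *\<^sub>R x"
      have "norm y = c" using False c by (simp add: y_def)
      then have "dist (\<tau> y) (\<tau> 0) < 1"
      proof (intro d(2))
        have "y \<in> M" using x by (simp add: y_def)
        then show "y \<in> M \<inter> op_ball 1" using \<open>norm y = c\<close> c M_bounded by (simp add: op_ball_def)
      qed (use \<open>norm y = c\<close> c in simp)
      moreover have "\<tau> y = of_real (c / norm x) * \<tau> x"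
        using x by (simp add: y_def scaleR_eq_scalar_op tau_scalar)
      ultimately have "c / norm x * cmod (\<tau> x) < 1" using c by (simp add: t0 norm_mult norm_divide)
      then show ?thesis using False c by (simp add: field_simps)
    qed (simp add: t0)
  qed (use c in simp)
qed

lemma hat_bounded: obtains K where "K \<ge> 0" "\<And>x. x \<in> M \<Longrightarrow> norm (hat x) \<le> K * norm x"
proof -
  obtain K where K: "K \<ge> 0" "\<And>x. x \<in> M \<Longrightarrow> cmod (\<tau> x) \<le> K * norm x" using tau_bounded by blast
  show ?thesis
  proof (rule that[of "sqrt K"])
    fix x assume x: "x \<in> M"
    have "(norm (hat x))\<^sup>2 \<le> cmod (\<tau> (adj x o\<^sub>L x))" using x by (simp add: norm_hat_sq complex_Re_le_cmod)
    also have "\<dots> \<le> K * norm (adj x o\<^sub>L x)" using x by (intro K) simp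
    also have "\<dots> \<le> K * (norm (adj x) * norm x)" using K by (intro mult_left_mono norm_blinfun_compose)
    also have "\<dots> = (sqrt K * norm x)\<^sup>2" using K x by (simp add: norm_adj M_bounded power_mult_distrib power2_eq_square)
    finally show "norm (hat x) \<le> sqrt K * norm x" by (rule power2_le_imp_le) (use K in simp)
  qed (use K in simp)
qed

text \<open>
  Left multiplication is bounded on \<open>L\<^sup>2\<close>. The usual argument needs a square root of \<open>\<parallel>x\<parallel>\<^sup>2 - x\<^sup>* x\<close>; iterating the
  Cauchy-Schwarz inequality avoids it. With \<open>h = x\<^sup>* x\<close> and \<open>\<rho>\<^sub>k = \<parallel>h\<^sup>n y\<parallel>\<^sub>2 / \<parallel>y\<parallel>\<^sub>2\<close> for \<open>n = 2\<^sup>k\<close> one gets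
  \<open>\<rho>\<^sub>k\<^sup>2 \<le> \<rho>\<^sub>k\<^sub>+\<^sub>1\<close>, while boundedness of the trace gives \<open>\<rho>\<^sub>k \<le> C \<parallel>h\<parallel>\<^sup>n\<close>. Hence \<open>\<rho>\<^sub>0 \<le> \<parallel>h\<parallel>\<close>.
\<close>

lemma norm_hat_compose:
  assumes x: "x \<in> M" and y: "y \<in> M"
  shows "norm (hat (x o\<^sub>L y)) \<le> norm x * norm (hat y)"
proof (cases "hat y = 0")
  case True
  then have "y = 0" using inj_onD[OF hat_inj, of y 0] y hat_scaleR[of 0 0] by simp
  then show ?thesis using hat_scaleR[of 0 0] by simp
next
  case False
  have sq: "(norm (hat (g o\<^sub>L y)))\<^sup>2 \<le> norm (hat ((adj g o\<^sub>L g) o\<^sub>L y)) * norm (hat y)" if g: "g \<in> M" for g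
  proof -
    have "cinner (hat (g o\<^sub>L y)) (hat (g o\<^sub>L y)) = cinner (hat ((adj g o\<^sub>L g) o\<^sub>L y)) (hat y)"
      using g y by (simp add: cinner_hat adj_compose_M blinfun_compose_assoc)
    then have "(norm (hat (g o\<^sub>L y)))\<^sup>2 = Re (cinner (hat ((adj g o\<^sub>L g) o\<^sub>L y)) (hat y))"
      by (metis cinner_self Re_complex_of_real)
    also have "\<dots> \<le> norm (hat ((adj g o\<^sub>L g) o\<^sub>L y)) * norm (hat y)"
      by (rule order_trans[OF complex_Re_le_cmod cmod_cinner_le])
    finally show ?thesis .
  qed
  define h where "h = adj x o\<^sub>L x"
  have hM: "h \<in> M" "adj h = h" using x by (auto simp: h_def adj_compose_M)
  \<comment> \<open>The power \<open>h\<^sup>n\<close> with \<open>n = 2\<^sup>k\<close>, by repeated squaring.\<close>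
  define g where "g = rec_nat h (\<lambda>_ w. w o\<^sub>L w)"
  have g0: "g 0 = h" and gS: "g (Suc k) = g k o\<^sub>L g k" for k by (auto simp: g_def)
  have gM: "g k \<in> M \<and> adj (g k) = g k \<and> norm (g k) \<le> norm h ^ (2 ^ k)" for k
  proof (induction k)
    case 0 then show ?case using hM by (simp add: g0)
  next
    case (Suc k)
    have "norm (g k o\<^sub>L g k) \<le> norm (g k) * norm (g k)" by (rule norm_blinfun_compose)
    also have "\<dots> \<le> norm h ^ (2 ^ k) * norm h ^ (2 ^ k)" using Suc by (intro mult_mono) auto
    also have "\<dots> = norm h ^ (2 ^ Suc k)" by (simp add: power_add[symmetric] mult_2)
    finally show ?case using Suc by (simp add: gS adj_compose_M)
  qed
  define \<rho> where "\<rho> k = norm (hat (g k o\<^sub>L y)) / norm (hat y)" for k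
  have rS: "(\<rho> k)\<^sup>2 \<le> \<rho> (Suc k)" for k
  proof -
    have "(\<rho> k)\<^sup>2 = (norm (hat (g k o\<^sub>L y)))\<^sup>2 / (norm (hat y))\<^sup>2" by (simp add: \<rho>_def power_divide)
    also have "\<dots> \<le> (norm (hat (g (Suc k) o\<^sub>L y)) * norm (hat y)) / (norm (hat y))\<^sup>2"
      using sq[of "g k"] gM[of k] by (intro divide_right_mono) (auto simp: gS)
    also have "\<dots> = \<rho> (Suc k)" using False by (simp add: \<rho>_def power2_eq_square)
    finally show ?thesis .
  qed
  have r0: "\<rho> k \<ge> 0" for k by (simp add: \<rho>_def)
  have rk: "(\<rho> 0) ^ (2 ^ k) \<le> \<rho> k" for k
  proof (induction k)
    case (Suc k)
    have "(\<rho> 0) ^ (2 ^ Suc k) = ((\<rho> 0) ^ (2 ^ k))\<^sup>2" by (simp only: power_Suc2 power_mult)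
    also have "\<dots> \<le> (\<rho> k)\<^sup>2" using Suc r0 by (intro power_mono) auto
    also have "\<dots> \<le> \<rho> (Suc k)" by (rule rS)
    finally show ?case .
  qed simp
  obtain K where K: "K \<ge> 0" "\<And>x. x \<in> M \<Longrightarrow> norm (hat x) \<le> K * norm x" using hat_bounded by blast
  have "\<rho> 0 \<le> norm h"
  proof (rule le_of_pow_le[where C = "K * norm y / norm (hat y)"])
    fix k
    have "norm (hat (g k o\<^sub>L y)) \<le> K * norm (g k o\<^sub>L y)" using K gM y by simp
    also have "\<dots> \<le> K * (norm (g k) * norm y)" using K by (intro mult_left_mono norm_blinfun_compose)
    also have "\<dots> \<le> K * (norm h ^ (2 ^ k) * norm y)" using K gM by (intro mult_left_mono mult_right_mono) auto
    finally have "\<rho> k \<le> K * (norm h ^ (2 ^ k) * norm y) / norm (hat y)"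
      unfolding \<rho>_def by (rule divide_right_mono) simp
    then show "(\<rho> 0) ^ (2 ^ k) \<le> K * norm y / norm (hat y) * norm h ^ (2 ^ k)"
      using rk[of k] by (simp add: mult_ac)
  qed (auto simp: r0)
  then have "norm (hat (h o\<^sub>L y)) \<le> norm h * norm (hat y)"
    using False by (simp add: \<rho>_def g0 divide_le_eq)
  moreover have "norm h \<le> norm x * norm x"
    unfolding h_def using norm_blinfun_compose[of "adj x" x] x by (simp add: norm_adj M_bounded)
  ultimately have "norm (hat (h o\<^sub>L y)) \<le> (norm x * norm x) * norm (hat y)"
    by (meson mult_right_mono norm_ge_zero order_trans)
  then have "norm (hat (h o\<^sub>L y)) * norm (hat y) \<le> ((norm x * norm x) * norm (hat y)) * norm (hat y)"
    by (rule mult_right_mono) simp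
  then have "(norm (hat (x o\<^sub>L y)))\<^sup>2 \<le> (norm x * norm (hat y))\<^sup>2"
    using sq[OF x] by (simp add: h_def power2_eq_square mult_ac)
  then show ?thesis by (rule power2_le_imp_le) simp
qed

lemma eq_if_eq_on_hat:
  fixes f g :: "'b \<Rightarrow> 'c::t2_space"
  assumes "continuous_on UNIV f" "continuous_on UNIV g" "\<And>x. x \<in> M \<Longrightarrow> f (hat x) = g (hat x)"
  shows "f k = g k"
proof -
  have "closed {k. f k = g k}" using assms by (intro closed_Collect_eq)
  then have "closure (hat ` M) \<subseteq> {k. f k = g k}" using assms(3) by (intro closure_minimal) auto
  then show ?thesis by (auto simp: hat_dense)
qed

lemma op_eqI_hat:
  fixes S T :: "'b \<Rightarrow>\<^sub>L 'c::real_normed_vector"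
  assumes "\<And>x. x \<in> M \<Longrightarrow> S (hat x) = T (hat x)"
  shows "S = T"
proof (rule blinfun_eqI)
  show "S k = T k" for k
    by (rule eq_if_eq_on_hat[of "blinfun_apply S" "blinfun_apply T"]) (simp_all add: assms linear_continuous_on blinfun.bounded_linear_right)
qed

lemma vector_eqI_hat:
  assumes "\<And>z. z \<in> M \<Longrightarrow> cinner k (hat z) = cinner l (hat z)"
  shows "k = l"
proof (rule cinner_ext)
  show "cinner k m = cinner l m" for m
    by (rule eq_if_eq_on_hat[of "cinner k" "cinner l"]) (simp_all add: assms continuous_on_cinner)
qed

lemma hat_extension:
  assumes "\<And>x. x \<in> M \<Longrightarrow> g x \<in> M" "\<And>x y. x \<in> M \<Longrightarrow> y \<in> M \<Longrightarrow> g (x + y) = g x + g y"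
    "\<And>r x. x \<in> M \<Longrightarrow> g (r *\<^sub>R x) = r *\<^sub>R g x" "\<And>x. x \<in> M \<Longrightarrow> norm (hat (g x)) \<le> K * norm (hat x)" "K \<ge> 0"
  obtains B where "norm B \<le> K" "\<And>x. x \<in> M \<Longrightarrow> blinfun_apply B (hat x) = hat (g x)"
    "(THE B. \<forall>x\<in>M. blinfun_apply B (hat x) = hat (g x)) = B"
proof -
  define f where "f k = hat (g (inv_into M hat k))" for k
  have f: "f (hat x) = hat (g x)" if "x \<in> M" for x using that by (simp add: f_def inv_into_f_f[OF hat_inj])
  obtain B where B: "\<And>k. k \<in> hat ` M \<Longrightarrow> blinfun_apply B k = f k" "norm B \<le> K"
  proof (rule dense_extension[OF subspace_hat hat_dense, of f K])
    show "f (x + y) = f x + f y" if xy: "x \<in> hat ` M" "y \<in> hat ` M" for x y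
    proof -
      obtain a b where ab: "a \<in> M" "b \<in> M" "x = hat a" "y = hat b" using xy by auto
      then show ?thesis using f[of "a + b"] by (simp add: hat_add f assms)
    qed
    show "f (r *\<^sub>R x) = r *\<^sub>R f x" if "x \<in> hat ` M" for r x
    proof -
      obtain a where a: "a \<in> M" "x = hat a" using \<open>x \<in> hat ` M\<close> by auto
      then show ?thesis using f[of "r *\<^sub>R a"] by (simp add: hat_scaleR f assms)
    qed
    show "norm (f x) \<le> K * norm x" if "x \<in> hat ` M" for x using that assms by (auto simp: f)
  qed (use assms in auto)
  have B2: "blinfun_apply B (hat x) = hat (g x)" if "x \<in> M" for x using B(1)[of "hat x"] that f by simp
  have "(THE B. \<forall>x\<in>M. blinfun_apply B (hat x) = hat (g x)) = B"
  proof (rule the_equality)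
    fix B' :: "'b \<Rightarrow>\<^sub>L 'b" assume "\<forall>x\<in>M. blinfun_apply B' (hat x) = hat (g x)"
    then show "B' = B" by (intro op_eqI_hat) (simp add: B2)
  qed (use B2 in blast)
  with B(2) B2 show ?thesis using that by blast
qed

abbreviation L where "L \<equiv> left_mult M hat"
abbreviation J where "J \<equiv> canonical_conj M hat"
text \<open>
  The operator \<open>J x\<^sup>* J\<close> is right multiplication by \<open>x\<close>.
\<close>

definition R where "R y = J o\<^sub>L L (adj y) o\<^sub>L J"

lemma L_props: assumes x: "x \<in> M"
  shows "norm (L x) \<le> norm x" "y \<in> M \<Longrightarrow> blinfun_apply (L x) (hat y) = hat (x o\<^sub>L y)"
proof -
  obtain B where "norm B \<le> norm x" "\<And>y. y \<in> M \<Longrightarrow> blinfun_apply B (hat y) = hat (x o\<^sub>L y)"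
    "(THE B. \<forall>y\<in>M. blinfun_apply B (hat y) = hat (x o\<^sub>L y)) = B"
    by (rule hat_extension[of "\<lambda>y. x o\<^sub>L y" "norm x"])
      (use x norm_hat_compose in \<open>auto simp: bounded_bilinear.add_right[OF bounded_bilinear_blinfun_compose]
        bounded_bilinear.scaleR_right[OF bounded_bilinear_blinfun_compose]\<close>)
  then show "norm (L x) \<le> norm x" "y \<in> M \<Longrightarrow> blinfun_apply (L x) (hat y) = hat (x o\<^sub>L y)"
    by (auto simp: left_mult_def)
qed

lemma norm_L: "x \<in> M \<Longrightarrow> norm (L x) \<le> norm x" and L_hat: "x \<in> M \<Longrightarrow> y \<in> M \<Longrightarrow> (L x) (hat y) = hat (x o\<^sub>L y)"
  using L_props by blast+

lemma J_hat:
  assumes "x \<in> M" shows "J (hat x) = hat (adj x)"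
proof -
  obtain B where "\<And>y. y \<in> M \<Longrightarrow> blinfun_apply B (hat y) = hat (adj y)"
    "(THE B. \<forall>y\<in>M. blinfun_apply B (hat y) = hat (adj y)) = B"
    by (rule hat_extension[of adj 1]) (auto simp: adj_add adj_scaleR M_bounded norm_hat_adj)
  then show ?thesis using assms by (simp add: canonical_conj_def)
qed

lemma R_hat: "x \<in> M \<Longrightarrow> y \<in> M \<Longrightarrow> (R y) (hat x) = hat (x o\<^sub>L y)"
  by (simp add: R_def J_hat L_hat adj_compose_M)

lemma bounded_opsI_hat:
  fixes B :: "'b \<Rightarrow>\<^sub>L 'b"
  assumes "\<And>c x. x \<in> M \<Longrightarrow> B (hat (scalar_op c o\<^sub>L x)) = c *\<^sub>C B (hat x)"
  shows "B \<in> bounded_ops"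
proof -
  have "B o\<^sub>L scalar_op c = scalar_op c o\<^sub>L B" for c
    by (rule op_eqI_hat) (simp add: assms hat_scalar[symmetric])
  then show ?thesis unfolding bounded_ops_def mem_Collect_eq by (metis blinfun_apply_blinfun_compose scalar_op_apply)
qed

lemma compose_scalar_right: "x \<in> bounded_ops \<Longrightarrow> x o\<^sub>L (scalar_op c o\<^sub>L y) = scalar_op c o\<^sub>L (x o\<^sub>L y)"
  by (rule blinfun_eqI) (simp add: bounded_opsD)

lemma L_bounded [simp]: "x \<in> M \<Longrightarrow> L x \<in> bounded_ops"
  by (rule bounded_opsI_hat, simp add: L_hat compose_scalar_right M_bounded) (simp add: hat_scalar)

lemma R_bounded [simp]: "y \<in> M \<Longrightarrow> R y \<in> bounded_ops"
  by (rule bounded_opsI_hat, simp add: R_hat blinfun_compose_assoc) (simp add: hat_scalar)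

lemma L_compose: "x \<in> M \<Longrightarrow> y \<in> M \<Longrightarrow> L (x o\<^sub>L y) = L x o\<^sub>L L y"
  by (rule op_eqI_hat) (simp add: L_hat blinfun_compose_assoc)
lemma R_compose: "x \<in> M \<Longrightarrow> y \<in> M \<Longrightarrow> R (x o\<^sub>L y) = R y o\<^sub>L R x"
  by (rule op_eqI_hat) (simp add: R_hat blinfun_compose_assoc)
lemma L_R_commute: "x \<in> M \<Longrightarrow> y \<in> M \<Longrightarrow> L x o\<^sub>L R y = R y o\<^sub>L L x"
  by (rule op_eqI_hat) (simp add: R_hat L_hat blinfun_compose_assoc)
lemma L_id [simp]: "L id_blinfun = id_blinfun" by (rule op_eqI_hat) (simp add: L_hat)
lemma R_id [simp]: "R id_blinfun = id_blinfun" by (rule op_eqI_hat) (simp add: R_hat)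
lemma L_add: "x \<in> M \<Longrightarrow> y \<in> M \<Longrightarrow> L (x + y) = L x + L y"
  by (rule op_eqI_hat) (simp add: L_hat blinfun.add_left hat_add bounded_bilinear.add_left[OF bounded_bilinear_blinfun_compose])
lemma L_scalar: "x \<in> M \<Longrightarrow> L (scalar_op c o\<^sub>L x) = scalar_op c o\<^sub>L L x"
  by (rule op_eqI_hat) (simp add: L_hat blinfun_compose_assoc hat_scalar)
lemma L_scaleR: "x \<in> M \<Longrightarrow> L (r *\<^sub>R x) = r *\<^sub>R L x"
  by (simp add: scaleR_eq_scalar_op L_scalar)

lemma cinner_eqI_hat:
  fixes S T :: "'b \<Rightarrow>\<^sub>L 'b"
  assumes "\<And>x y. x \<in> M \<Longrightarrow> y \<in> M \<Longrightarrow> cinner (S (hat x)) (hat y) = cinner (hat x) (T (hat y))"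
  shows "cinner (S k) l = cinner k (T l)"
proof -
  have 1: "cinner (S k) (hat y) = cinner k (T (hat y))" if "y \<in> M" for k y
  proof (rule eq_if_eq_on_hat[of "\<lambda>k. cinner (S k) (hat y)"])
    show "continuous_on UNIV (\<lambda>k. cinner (S k) (hat y))" "continuous_on UNIV (\<lambda>k. cinner k (T (hat y)))"
      by (intro continuous_intros)+
  qed (use assms that in blast)
  show ?thesis
  proof (rule eq_if_eq_on_hat[of "cinner (S k)"])
    show "continuous_on UNIV (cinner (S k))" "continuous_on UNIV (\<lambda>l. cinner k (T l))"
      by (intro continuous_intros)+
  qed (rule 1)
qed

lemma adj_L: "x \<in> M \<Longrightarrow> adj (L x) = L (adj x)"
  by (rule adj_eqI, simp, rule cinner_eqI_hat)
    (simp add: L_hat cinner_hat adj_compose_M blinfun_compose_assoc)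

lemma adj_R: 
  assumes "x \<in> M" shows "adj (R x) = R (adj x)"
proof (rule adj_eqI)
  fix k l
  show "cinner ((R (adj x)) k) l = cinner k ((R x) l)"
  proof (rule cinner_eqI_hat)
    fix a b assume "a \<in> M" "b \<in> M"
    then show "cinner ((R (adj x)) (hat a)) (hat b) = cinner (hat a) ((R x) (hat b))"
      using assms tau_commute[of "adj b o\<^sub>L a" "adj x"]
      by (simp add: R_hat cinner_hat adj_compose_M blinfun_compose_assoc)
  qed
qed (use assms in simp)

text \<open>
  The image in \<open>L\<^sup>2\<close> of a norm ball of \<open>M\<close> is closed: the ball is weakly compact and the functionals
  \<open>w \<mapsto> \<tau>(y\<^sup>* w)\<close> are weakly continuous on it, so some \<open>w\<close> in the ball has the inner products that the limit
  \<open>\<zeta>\<close> prescribes.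
\<close>

lemma hat_ball_closed:
  fixes z :: "nat \<Rightarrow> 'a \<Rightarrow>\<^sub>L 'a"
  assumes z: "\<And>n. z n \<in> M" "\<And>n. norm (z n) \<le> c" and lim: "(\<lambda>n. hat (z n)) \<longlonglongrightarrow> \<zeta>"
  obtains w where "w \<in> M" "hat w = \<zeta>"
proof -
  have c: "c \<ge> 0" using z(2)[of 0] norm_ge_zero order_trans by blast
  have clM: "closedin WOT M" using vN by (simp add: von_neumann_algebra_def)
  let ?X = "subtopology WOT (M \<inter> op_ball c)"
  have "compactin WOT (M \<inter> op_ball c)"
    by (rule closed_Int_compactin[OF clM compactin_WOT_op_ball[OF c]])
  then have cp: "compactin ?X (M \<inter> op_ball c)" by (simp add: compactin_subtopology)
  have ts: "topspace ?X = M \<inter> op_ball c" using M_bounded by auto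
  define D where "D = (\<lambda>(y, e). {w \<in> topspace ?X. \<tau> (adj y o\<^sub>L w) \<in> cball (cinner \<zeta> (hat y)) e})"
  obtain w where w: "w \<in> M \<inter> op_ball c" "\<And>i. i \<in> M \<times> {0::real<..} \<Longrightarrow> w \<in> D i"
  proof (rule compactin_fip_indexed[OF cp, of "M \<times> {0<..}" D])
    fix i assume "i \<in> M \<times> {0::real<..}"
    then obtain y e where i: "i = (y, e)" "y \<in> M" by auto
    show "closedin ?X (D i)" unfolding D_def i(1) prod.case
      by (rule closedin_continuous_map_preimage[OF continuous_tau_left_ball]) (use i in auto)
  next
    fix F assume F: "finite F" "F \<subseteq> M \<times> {0::real<..}"
    have "\<forall>\<^sub>F n in sequentially. z n \<in> D i" if "i \<in> F" for i
    proof -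
      obtain y e where i: "i = (y, e)" "y \<in> M" "e > 0" using \<open>i \<in> F\<close> F(2) by (cases i) auto
      have "(\<lambda>n. cinner (hat (z n)) (hat y)) \<longlonglongrightarrow> cinner \<zeta> (hat y)" by (intro tendsto_intros lim)
      then have "\<forall>\<^sub>F n in sequentially. dist (cinner (hat (z n)) (hat y)) (cinner \<zeta> (hat y)) < e"
        using i(3) by (rule tendstoD)
      then show ?thesis
        by (rule eventually_mono) (use i z M_bounded in \<open>auto simp: D_def ts op_ball_def cinner_hat dist_commute\<close>)
    qed
    then have "\<forall>\<^sub>F n in sequentially. \<forall>i\<in>F. z n \<in> D i" using F by (simp add: eventually_ball_finite)
    then obtain n where "\<forall>i\<in>F. z n \<in> D i" using eventually_happens'[OF sequentially_bot] by blast
    moreover have "z n \<in> M \<inter> op_ball c" using z M_bounded by (simp add: op_ball_def)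
    ultimately show "\<exists>x\<in>M \<inter> op_ball c. \<forall>i\<in>F. x \<in> D i" by blast
  qed blast
  have eq: "cinner (hat w) (hat y) = cinner \<zeta> (hat y)" if y: "y \<in> M" for y
  proof -
    have "dist (cinner \<zeta> (hat y)) (\<tau> (adj y o\<^sub>L w)) \<le> 0 + e" if "e > 0" for e
      using w(2)[of "(y, e)"] y that by (simp add: D_def)
    then have "dist (cinner \<zeta> (hat y)) (\<tau> (adj y o\<^sub>L w)) \<le> 0" by (rule field_le_epsilon)
    then show ?thesis using y w(1) by (simp add: cinner_hat)
  qed
  then have "hat w = \<zeta>" by (rule vector_eqI_hat)
  then show ?thesis using that w(1) by blast
qed

end

section \<open>Density of the span of a generating group\<close>

lemma continuous_map_WOT_combination:
  "continuous_map WOT WOT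
     (\<lambda>T. (scalar_op a o\<^sub>L T) + (scalar_op b o\<^sub>L adj T))"
proof (rule continuous_map_into_WOT)
  fix v w :: 'a
  have "continuous_map WOT euclidean
    (\<lambda>T. a * cinner (T v) w + b * cnj (cinner (T w) v))"
  proof -
    have "continuous_map euclidean euclidean (\<lambda>c. a * c)" "continuous_map euclidean euclidean (\<lambda>c. b * cnj c)"
      by (auto intro!: continuous_intros)
    from this[THEN continuous_map_compose[OF continuous_map_WOT_cinner]] show ?thesis
      unfolding o_def by (intro continuous_map_add)
  qed
  then show "continuous_map WOT euclidean
    (\<lambda>T. cinner (((scalar_op a o\<^sub>L T) + (scalar_op b o\<^sub>L adj T)) v) w)"
  proof (rule continuous_map_eq)
    fix T :: "'a \<Rightarrow>\<^sub>L 'a" assume "T \<in> topspace WOT"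
    then have "cinner ((adj T) v) w = cnj (cinner (T w) v)"
      using adj_cinner[of T v w] cinner_commute[of v "T w"] by simp
    then show "a * cinner (T v) w + b * cnj (cinner (T w) v)
       = cinner (((scalar_op a o\<^sub>L T) + (scalar_op b o\<^sub>L adj T)) v) w"
      by (simp add: blinfun.add_left cinner_add_left cinner_scaleC_left)
  qed
qed simp

text \<open>
  The bounded approximation that Kaplansky's density theorem provides, for resolvents only. The self-adjoint
  part of \<open>A\<close> approximates \<open>x\<close> weakly, hence strongly at the vectors \<open>z a\<close>, by some \<open>y\<close> whose norm is not controlled;
  its resolvent \<open>r\<close> lies in the unit ball and \<open>r - z = r (x - y) z\<close>.
\<close>

lemma resolvent_in_WOT_closure:
  assumes A: "closed_subalgebra A" and Aadj: "\<And>a. a \<in> A \<Longrightarrow> adj a \<in> A"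
    and x: "x \<in> WOT closure_of A" "adj x = x"
    and z: "z \<in> bounded_ops" "(x + scalar_op \<i>) o\<^sub>L z = id_blinfun"
  shows "z \<in> WOT closure_of (A \<inter> op_ball 1)"
proof (rule in_WOT_closureI)
  note AD = closed_subalgebraD[OF A]
  have Ab: "a \<in> bounded_ops" if "a \<in> A" for a using AD(1) that by blast
  have xb: "x \<in> bounded_ops" using x(1) by (simp add: in_closure_of)
  show "A \<inter> op_ball 1 \<subseteq> bounded_ops" using AD(1) by blast
  show "z \<in> bounded_ops" by fact
  fix E :: "('a \<times> 'a) set" and d :: real assume E: "finite E" "d > 0"
  let ?S = "{y \<in> A. adj y = y}"
  define N where "N = 1 + (\<Sum>(a, b)\<in>E. norm b)"
  have bN: "norm b < N" if "(a, b) \<in> E" for a b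
  proof -
    have "norm b \<le> (\<Sum>(a, b)\<in>E. norm b)"
      using member_le_sum[of "(a, b)" E "\<lambda>(a, b). norm b"] that E by auto
    then show ?thesis by (simp add: N_def)
  qed
  have N: "N > 0" unfolding N_def by (intro add_pos_nonneg sum_nonneg) auto
  have adj0: "adj 0 = (0 :: 'a \<Rightarrow>\<^sub>L 'a)" by (rule adj_eqI) (auto simp: cinner.zero_left cinner.zero_right)
  have S: "subspace ?S"
    by (rule subspaceI) (use AD Ab adj0 in \<open>auto simp: adj_add adj_scaleR \<close>)
  obtain y where y: "y \<in> ?S" and close: "\<And>\<xi>. \<xi> \<in> (\<lambda>(a, b). z a) ` E \<Longrightarrow> norm ((x - y) \<xi>) < d / N"
  proof (rule subspace_WOT_to_SOT[OF S])
    show "finite ((\<lambda>(a, b). z a) ` E)" "d / N > 0" using E N by auto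
    fix E' :: "('a \<times> 'a) set" and e :: real assume E': "finite E'" "e > 0"
    \<comment> \<open>The swapped pairs make \<open>Y\<^sup>*\<close> approximate \<open>x\<^sup>* = x\<close> as well, hence also the self-adjoint part of \<open>Y\<close>.\<close>
    have "finite (E' \<union> prod.swap ` E')" using E' by simp
    from WOT_closure_approx[OF x(1) this E'(2)] obtain Y where Y: "Y \<in> A"
      "\<And>a b. (a, b) \<in> E' \<union> prod.swap ` E' \<Longrightarrow> cmod (cinner ((Y - x) a) b) < e" by blast
    define H where "H = (1/2) *\<^sub>R (Y + adj Y)"
    have "H \<in> A" using Y Aadj AD by (simp add: H_def)
    moreover have "adj H = H" using Y Ab by (simp add: H_def adj_scaleR adj_add adj_adj add.commute)
    moreover have "cmod (cinner ((H - x) a) b) < e" if ab: "(a, b) \<in> E'" for a b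
    proof -
      have 1: "cmod (cinner ((Y - x) a) b) < e" using Y(2) ab by blast
      have 2: "cmod (cinner ((Y - x) b) a) < e" using Y(2)[of b a] ab by force
      have "cinner ((adj Y - x) a) b = cinner a ((Y - x) b)"
        using adj_cinner[OF Ab[OF Y(1)], of a b] adj_cinner[OF xb, of a b] x(2)
        by (simp add: blinfun.diff_left cinner.diff_left cinner.diff_right)
      then have 3: "cmod (cinner ((adj Y - x) a) b) < e"
        using 2 by (metis cinner_commute complex_mod_cnj)
      have "(1/2) *\<^sub>R x + (1/2) *\<^sub>R x = x" by (simp flip: scaleR_add_left)
      then have "H - x = (1/2) *\<^sub>R (Y + adj Y) - ((1/2) *\<^sub>R x + (1/2) *\<^sub>R x)" by (simp only: H_def)
      also have "\<dots> = (1/2) *\<^sub>R (Y - x) + (1/2) *\<^sub>R (adj Y - x)"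
        by (simp only: scaleR_diff_right scaleR_add_right) (simp add: algebra_simps)
      finally have "H - x = (1/2) *\<^sub>R (Y - x) + (1/2) *\<^sub>R (adj Y - x)" .
      then have "cinner ((H - x) a) b = (1/2) *\<^sub>R cinner ((Y - x) a) b
          + (1/2) *\<^sub>R cinner ((adj Y - x) a) b"
        by (simp only: blinfun.add_left blinfun.scaleR_left cinner_add_left cinner.scaleR_left)
      then have "cmod (cinner ((H - x) a) b) \<le> (1/2) * cmod (cinner ((Y - x) a) b)
          + (1/2) * cmod (cinner ((adj Y - x) a) b)"
        by (metis (no_types, lifting) norm_triangle_ineq norm_scaleR abs_of_nonneg zero_le_divide_1_iff zero_le_numeral)
      then show ?thesis using 1 3 by simp
    qed
    ultimately show "\<exists>Y\<in>?S. \<forall>(a, b)\<in>E'. cmod (cinner ((Y - x) a) b) < e" by blast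
  qed blast
  obtain r where r: "r \<in> A" "(y + scalar_op \<i>) o\<^sub>L r = id_blinfun" "r o\<^sub>L (y + scalar_op \<i>) = id_blinfun" "norm r \<le> 1"
    using resolvent_exists[OF A, of y] y by blast
  have key: "(r - z) v = r ((x - y) (z v))" for v
  proof -
    have "v = ((x + scalar_op \<i>) o\<^sub>L z) v" using z(2) by simp
    then have 1: "v = x (z v) + \<i> *\<^sub>C z v" by (simp add: blinfun.add_left)
    have "z v = (r o\<^sub>L (y + scalar_op \<i>)) (z v)" using r(3) by simp
    then have 2: "z v = r (y (z v) + \<i> *\<^sub>C z v)"
      by (simp add: blinfun.add_left)
    have "(r - z) v = r v - z v" by (simp add: blinfun.diff_left)
    also have "\<dots> = r (x (z v) + \<i> *\<^sub>C z v)
        - r (y (z v) + \<i> *\<^sub>C z v)"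
      using 1 2 by metis
    also have "\<dots> = r ((x - y) (z v))"
      by (simp add: blinfun.diff_right[symmetric] blinfun.diff_left)
    finally show ?thesis .
  qed
  have "cmod (cinner ((r - z) a) b) < d" if ab: "(a, b) \<in> E" for a b
  proof -
    have "norm ((r - z) a) \<le> norm r * norm ((x - y) (z a))"
      unfolding key by (rule norm_blinfun)
    also have "\<dots> \<le> 1 * norm ((x - y) (z a))" by (intro mult_right_mono r) simp
    also have "\<dots> \<le> d / N" using close[of "z a"] ab by force
    finally have "cmod (cinner ((r - z) a) b) \<le> d / N * norm b"
      by (intro order_trans[OF cmod_cinner_le] mult_right_mono) auto
    also have "\<dots> < d / N * N" using bN[OF ab] E N by (intro mult_strict_left_mono) auto
    finally show ?thesis using N by simp
  qed
  moreover have "r \<in> A \<inter> op_ball 1" using r Ab by (simp add: op_ball_def)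
  ultimately show "\<exists>Y\<in>A \<inter> op_ball 1. \<forall>(a, b)\<in>E. cmod (cinner ((Y - z) a) b) < d" by blast
qed

text \<open>
  An operator is the norm limit of \<open>i x (s x + i)\<^sup>-\<^sup>1 = (i / s) (1 - i (s x + i)\<^sup>-\<^sup>1)\<close> as \<open>s\<close> tends to \<open>0\<close>.
\<close>

lemma mem_of_resolvents:
  assumes A: "closed_subalgebra A" and x: "x \<in> bounded_ops"
    and res: "\<And>s::real. s > 0 \<Longrightarrow> \<exists>z\<in>A. (s *\<^sub>R x + scalar_op \<i>) o\<^sub>L z = id_blinfun \<and>
        z o\<^sub>L (s *\<^sub>R x + scalar_op \<i>) = id_blinfun \<and> norm z \<le> 1"
  shows "x \<in> A"
proof -
  note AD = closed_subalgebraD[OF A]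
  have near: "\<exists>w\<in>A. dist w x \<le> s * (norm x)\<^sup>2" if s: "s > 0" for s :: real
  proof -
    obtain z where z: "z \<in> A" "(s *\<^sub>R x + scalar_op \<i>) o\<^sub>L z = id_blinfun"
      "z o\<^sub>L (s *\<^sub>R x + scalar_op \<i>) = id_blinfun" "norm z \<le> 1" using res[OF s] by blast
    define w where "w = scalar_op (\<i> / of_real s) o\<^sub>L (id_blinfun - (scalar_op \<i> o\<^sub>L z))"
    have wA: "w \<in> A" using AD z by (simp add: w_def)
    have sm: "norm (v - \<i> *\<^sub>C z v) \<le> s * norm x * norm v" for v
    proof -
      have zb: "z \<in> bounded_ops" using AD(1) z(1) by blast
      have "v = (z o\<^sub>L (s *\<^sub>R x + scalar_op \<i>)) v" using z(3) by simp
      then have "v = z (s *\<^sub>R x v) + \<i> *\<^sub>C z v"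
        by (simp add: blinfun.add_left blinfun.scaleR_left blinfun.add_right bounded_opsD[OF zb])
      then have "v - \<i> *\<^sub>C z v = z (s *\<^sub>R x v)"
        by (simp add: algebra_simps)
      then have "norm (v - \<i> *\<^sub>C z v) \<le> norm z * norm (s *\<^sub>R x v)"
        by (metis norm_blinfun)
      also have "\<dots> \<le> 1 * (s * (norm x * norm v))" using z(4) s norm_blinfun[of x v]
        by (intro mult_mono) auto
      finally show ?thesis by (simp add: mult.assoc)
    qed
    have "norm (w - x) \<le> s * (norm x)\<^sup>2"
    proof (rule norm_blinfun_bound)
      fix v
      let ?z = "z v"
      have "v = ((s *\<^sub>R x + scalar_op \<i>) o\<^sub>L z) v" using z(2) by simp
      then have "v - \<i> *\<^sub>C ?z = s *\<^sub>R x ?z"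
        by (simp add: blinfun.add_left blinfun.scaleR_left algebra_simps)
      then have "w v = (\<i> / of_real s) *\<^sub>C (s *\<^sub>R x ?z)"
        by (simp add: w_def blinfun.diff_left)
      also have "\<dots> = x (\<i> *\<^sub>C ?z)"
        using s by (simp add: scaleR_eq_scaleC scaleC_scaleC bounded_opsD[OF x])
      finally have "(w - x) v = - x (v - \<i> *\<^sub>C ?z)"
        by (simp add: blinfun.diff_left blinfun.diff_right)
      then have "norm ((w - x) v) \<le> norm x * norm (v - \<i> *\<^sub>C ?z)" by (simp add: norm_blinfun)
      also have "\<dots> \<le> norm x * (s * norm x * norm v)" by (intro mult_left_mono sm) simp
      finally show "norm ((w - x) v) \<le> s * (norm x)\<^sup>2 * norm v"
        by (simp add: power2_eq_square mult_ac)
    qed (use s in simp)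
    then show ?thesis using wA by (auto simp: dist_norm)
  qed
  have "\<exists>w\<in>A. dist w x < e" if e: "e > 0" for e
  proof -
    have p: "(norm x)\<^sup>2 + 1 > 0" by (simp add: add_nonneg_pos)
    obtain w where w: "w \<in> A" "dist w x \<le> e / ((norm x)\<^sup>2 + 1) * (norm x)\<^sup>2"
      using near[of "e / ((norm x)\<^sup>2 + 1)"] e p by auto
    have "e / ((norm x)\<^sup>2 + 1) * (norm x)\<^sup>2 < e / ((norm x)\<^sup>2 + 1) * ((norm x)\<^sup>2 + 1)"
      using e p by (intro mult_strict_left_mono) auto
    also have "\<dots> = e" using p by simp
    finally show ?thesis using w by (intro bexI[of _ w]) auto
  qed
  then have "x \<in> closure A" by (simp add: closure_approachable)
  then show ?thesis using AD(2) by simp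
qed

lemma subspace_closure:
  fixes S :: "'b::real_normed_vector set"
  assumes S: "subspace S"
  shows "subspace (closure S)"
proof (rule subspaceI)
  show "0 \<in> closure S" using closure_subset subspace_0[OF S] by blast
  fix x assume "x \<in> closure S"
  then obtain s where s: "\<And>n::nat. s n \<in> S" "s \<longlonglongrightarrow> x" unfolding closure_sequential by blast
  show "c *\<^sub>R x \<in> closure S" for c
    unfolding closure_sequential
    by (rule exI[of _ "\<lambda>n. c *\<^sub>R s n"]) (use s S in \<open>auto intro: tendsto_scaleR subspace_scale\<close>)
  fix y assume "y \<in> closure S"
  then obtain t where t: "\<And>n::nat. t n \<in> S" "t \<longlonglongrightarrow> y" unfolding closure_sequential by blast
  show "x + y \<in> closure S"
    unfolding closure_sequential
    by (rule exI[of _ "\<lambda>n. s n + t n"]) (use s t S in \<open>auto intro: tendsto_add subspace_add\<close>)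
qed

lemma blinfun_image_closed_span:
  fixes B :: "'b::real_normed_vector \<Rightarrow>\<^sub>L 'c::real_normed_vector"
  assumes V: "subspace V" "closed V" and S: "\<And>s. s \<in> S \<Longrightarrow> B s \<in> V"
    and k: "k \<in> closure (span S)"
  shows "B k \<in> V"
proof -
  have "subspace {k. B k \<in> V}"
    using V(1) by (auto simp: subspace_def blinfun.add_right blinfun.scaleR_right)
  then have "span S \<subseteq> {k. B k \<in> V}" by (intro span_minimal) (use S in auto)
  moreover have "closed {k. B k \<in> V}"
    using continuous_closed_vimage[OF V(2), of "blinfun_apply B"]
    by (simp add: vimage_def linear_continuous_at blinfun.bounded_linear_right)
  ultimately have "closure (span S) \<subseteq> {k. B k \<in> V}" by (intro closure_minimal)
  then show ?thesis using k by blast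
qed

context tracial_algebra
begin

lemma J_scaleC: "J (c *\<^sub>C k) = cnj c *\<^sub>C J k"
proof -
  have "J o\<^sub>L scalar_op c = scalar_op (cnj c) o\<^sub>L J"
  proof (rule op_eqI_hat)
    fix x assume x: "x \<in> M"
    then have "J (hat (scalar_op c o\<^sub>L x)) = hat (scalar_op (cnj c) o\<^sub>L adj x)"
      by (simp only: J_hat[OF M_scalar] adj_scalar M_bounded)
    then show "(J o\<^sub>L scalar_op c) (hat x) = (scalar_op (cnj c) o\<^sub>L J) (hat x)"
      using x by (simp add: hat_scalar J_hat)
  qed
  then show ?thesis by (metis blinfun_apply_blinfun_compose scalar_op_apply)
qed

text \<open>
  The closed complex-linear span; the scalars are put into the generators because \<open>span\<close> is real-linear.
\<close>

definition group_span :: "('a \<Rightarrow>\<^sub>L 'a) set \<Rightarrow> 'b set" where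
  "group_span G = closure (span {c *\<^sub>C hat g | c g. g \<in> G})"

lemma group_span_subspace: "subspace (group_span G)" "closed (group_span G)"
  by (auto simp: group_span_def subspace_closure)

lemma group_span_gen: "g \<in> G \<Longrightarrow> c *\<^sub>C hat g \<in> group_span G"
  unfolding group_span_def by (rule subsetD[OF closure_subset]) (auto intro: span_base)

lemma group_span_image:
  assumes "\<And>c g. g \<in> G \<Longrightarrow> blinfun_apply B (c *\<^sub>C hat g) \<in> group_span G" "k \<in> group_span G"
  shows "blinfun_apply B k \<in> group_span G"
  by (rule blinfun_image_closed_span[OF group_span_subspace _ assms(2)[unfolded group_span_def]])
    (use assms(1) in auto)

lemma group_span_scaleC: 
  assumes "k \<in> group_span G" shows "c *\<^sub>C k \<in> group_span G"
  using group_span_image[of G "scalar_op c" k] assms by (simp add: scaleC_scaleC group_span_gen)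

text \<open>
  For a group \<open>G\<close> this turns out to be a von Neumann algebra, hence to be all of \<open>M\<close> when \<open>G\<close> generates \<open>M\<close>.
\<close>

definition span_part :: "('a \<Rightarrow>\<^sub>L 'a) set \<Rightarrow> ('a \<Rightarrow>\<^sub>L 'a) set" where
  "span_part G = {x \<in> M. hat x \<in> group_span G}"

text \<open>
  If \<open>\<eta>\<close> is the component of \<open>z\<close> orthogonal to the span, then the real inner product with \<open>\<eta>\<close> vanishes on the span. It is a norm
  limit of the functionals \<open>a \<mapsto> Re \<tau>(w\<^sup>* a)\<close>, which are weakly continuous on the unit ball, so it almost vanishes at
  \<open>z\<close>, where its value is \<open>\<parallel>\<eta>\<parallel>\<^sup>2\<close>.
\<close>

lemma hat_mem_group_span_of_closure:
  assumes z: "z \<in> M" "norm z \<le> 1" "z \<in> WOT closure_of (span_part G \<inter> op_ball 1)"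
  shows "hat z \<in> group_span G"
proof -
  let ?K = "group_span G"
  obtain y \<eta>' where y: "\<And>n::nat. y n \<in> ?K" and lim': "(\<lambda>n. hat z - y n) \<longlonglongrightarrow> \<eta>' ()"
    and orth': "\<And>s. s \<in> ?K \<Longrightarrow> inner (\<eta>' ()) s = 0"
    using orthogonal_residual[OF group_span_subspace(1)[of G], where I = "{()}" and \<phi> = "\<lambda>k x. x" and x = "hat z"]
    by (auto simp: linear_id[unfolded id_def])
  define \<eta> where "\<eta> = \<eta>' ()"
  have lim: "(\<lambda>n. hat z - y n) \<longlonglongrightarrow> \<eta>" and orth: "\<And>s. s \<in> ?K \<Longrightarrow> inner \<eta> s = 0"
    using lim' orth' by (auto simp: \<eta>_def)
  obtain K where K: "K \<ge> 0" "\<And>x. x \<in> M \<Longrightarrow> norm (hat x) \<le> K * norm x" using hat_bounded by blast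
  have "(\<lambda>n. inner \<eta> (hat z - y n)) \<longlonglongrightarrow> inner \<eta> \<eta>" by (intro tendsto_inner tendsto_const lim)
  moreover have "inner \<eta> (hat z - y n) = inner \<eta> (hat z)" for n using orth[OF y] by (simp add: inner_diff_right)
  ultimately have zz: "inner \<eta> (hat z) = (norm \<eta>)\<^sup>2" by (simp add: LIMSEQ_const_iff power2_norm_eq_inner)
  have bound: "(norm \<eta>)\<^sup>2 \<le> (K + norm (hat z)) * e" if e: "e > 0" for e
  proof -
    have "\<eta> \<in> closure (hat ` M)" by (simp add: hat_dense)
    then obtain w where w: "w \<in> M" "dist (hat w) \<eta> < e" using e by (auto simp: closure_approachable)
    have small: "\<bar>inner v (hat w) - inner v \<eta>\<bar> \<le> norm v * e" for v
    proof -
      have "\<bar>inner v (hat w) - inner v \<eta>\<bar> = \<bar>inner v (hat w - \<eta>)\<bar>" by (simp add: inner_diff_right)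
      also have "\<dots> \<le> norm v * norm (hat w - \<eta>)" by (rule Cauchy_Schwarz_ineq2)
      also have "\<dots> \<le> norm v * e" using w by (intro mult_left_mono) (auto simp: dist_norm)
      finally show ?thesis .
    qed
    let ?X = "subtopology WOT (M \<inter> op_ball 1)"
    let ?C = "{a \<in> topspace ?X. \<tau> (adj w o\<^sub>L a) \<in> {c. \<bar>Re c\<bar> \<le> K * e}}"
    have "closed {c. \<bar>Re c\<bar> \<le> K * e}" by (intro closed_Collect_le continuous_intros)
    then have C: "closedin ?X ?C"
      by (intro closedin_continuous_map_preimage[OF continuous_tau_left_ball]) (use w in auto)
    have ts: "topspace ?X = M \<inter> op_ball 1" using M_bounded by auto
    have re: "Re (\<tau> (adj w o\<^sub>L a)) = inner (hat a) (hat w)" if "a \<in> M" for a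
      using that w by (metis Re_cinner cinner_hat)
    have "span_part G \<inter> op_ball 1 \<subseteq> ?C"
    proof
      fix a assume a: "a \<in> span_part G \<inter> op_ball 1"
      then have aM: "a \<in> M" "norm a \<le> 1" "hat a \<in> ?K" by (auto simp: span_part_def op_ball_def)
      have "\<bar>inner (hat a) (hat w)\<bar> \<le> norm (hat a) * e" using small[of "hat a"] orth[OF aM(3)] by (simp add: inner_commute)
      also have "\<dots> \<le> (K * 1) * e"
        using e K aM by (intro mult_right_mono order_trans[OF K(2) mult_left_mono]) auto
      finally have "\<bar>Re (\<tau> (adj w o\<^sub>L a))\<bar> \<le> K * e" using aM by (simp add: re)
      moreover have "a \<in> topspace ?X" unfolding ts using a aM by blast
      ultimately show "a \<in> ?C" by blast
    qed
    moreover have "z \<in> ?X closure_of (span_part G \<inter> op_ball 1)"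
    proof -
      have "(M \<inter> op_ball 1) \<inter> (span_part G \<inter> op_ball 1) = span_part G \<inter> op_ball 1" by (auto simp: span_part_def)
      then show ?thesis using z M_bounded by (simp add: closure_of_subtopology op_ball_def)
    qed
    ultimately have "z \<in> ?C" using closure_of_minimal[OF _ C] by blast
    then have "\<bar>inner (hat z) (hat w)\<bar> \<le> K * e" using z by (simp add: re)
    then have "(norm \<eta>)\<^sup>2 \<le> K * e + norm (hat z) * e" using small[of "hat z"] zz by (simp add: inner_commute)
    then show ?thesis by (simp add: algebra_simps)
  qed
  have "(norm \<eta>)\<^sup>2 \<le> 0 + e" if e: "e > 0" for e
  proof -
    have p: "K + norm (hat z) + 1 > 0" using K by (simp add: add_nonneg_pos)
    have "(norm \<eta>)\<^sup>2 \<le> (K + norm (hat z)) * (e / (K + norm (hat z) + 1))" using e p by (intro bound) simp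
    also have "\<dots> \<le> (K + norm (hat z) + 1) * (e / (K + norm (hat z) + 1))" using e p by (intro mult_right_mono) auto
    also have "\<dots> = e" using p by simp
    finally show ?thesis by simp
  qed
  then have "(norm \<eta>)\<^sup>2 \<le> 0" by (rule field_le_epsilon)
  then have "\<eta> = 0" by simp
  then have "(\<lambda>n. hat z - (hat z - y n)) \<longlonglongrightarrow> hat z - 0" using lim by (intro tendsto_diff tendsto_const) simp
  then have "y \<longlonglongrightarrow> hat z" by simp
  then show ?thesis using closed_sequentially[OF group_span_subspace(2)] y by blast
qed

text \<open>
  Only weak closedness is not immediate. The resolvents of a self-adjoint element \<open>x\<close> of the weak closure are weak
  limits of elements of the unit ball, hence their images stay in the closed span, and \<open>x\<close> is recovered
  from its resolvents in norm.
\<close>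

lemma von_neumann_span_part:
  assumes GM: "G \<subseteq> M" and G1: "id_blinfun \<in> G"
    and Gm: "\<And>g h. g \<in> G \<Longrightarrow> h \<in> G \<Longrightarrow> g o\<^sub>L h \<in> G" and Ga: "\<And>g. g \<in> G \<Longrightarrow> adj g \<in> G"
  shows "von_neumann_algebra (span_part G)"
proof -
  let ?N = "span_part G"
  have NM: "?N \<subseteq> M" by (auto simp: span_part_def)
  have Nb: "?N \<subseteq> bounded_ops" using NM M_bounded by auto
  have gen: "hat g \<in> group_span G" if "g \<in> G" for g using group_span_gen[OF that, of 1] by simp
  have N1: "id_blinfun \<in> ?N" using G1 gen by (simp add: span_part_def)
  have Nadd: "x + y \<in> ?N" if "x \<in> ?N" "y \<in> ?N" for x y
    using that by (simp add: span_part_def hat_add subspace_add[OF group_span_subspace(1)])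
  have Nsc: "scalar_op c o\<^sub>L x \<in> ?N" if "x \<in> ?N" for c x
    using that by (simp add: span_part_def hat_scalar group_span_scaleC)
  have Nadj: "adj x \<in> ?N" if x: "x \<in> ?N" for x
  proof -
    have "blinfun_apply J (hat x) \<in> group_span G"
    proof (rule group_span_image)
      show "blinfun_apply J (c *\<^sub>C hat g) \<in> group_span G" if "g \<in> G" for c g
        using that GM Ga by (simp add: J_scaleC J_hat subsetD group_span_gen)
    qed (use x in \<open>simp add: span_part_def\<close>)
    then show ?thesis using x by (simp add: span_part_def J_hat)
  qed
  have Lg: "blinfun_apply (L g) k \<in> group_span G" if g: "g \<in> G" and k: "k \<in> group_span G" for g k
  proof (rule group_span_image[OF _ k])
    fix c h assume h: "h \<in> G"
    have "g \<in> M" "h \<in> M" using g h GM by auto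
    then have "blinfun_apply (L g) (c *\<^sub>C hat h) = c *\<^sub>C hat (g o\<^sub>L h)"
      by (simp add: bounded_opsD[OF L_bounded] L_hat)
    then show "blinfun_apply (L g) (c *\<^sub>C hat h) \<in> group_span G" using Gm[OF g h] by (simp add: group_span_gen)
  qed
  have Nm: "x o\<^sub>L y \<in> ?N" if x: "x \<in> ?N" and y: "y \<in> ?N" for x y
  proof -
    have xy: "x \<in> M" "y \<in> M" "hat x \<in> group_span G" "hat y \<in> group_span G" using x y by (auto simp: span_part_def)
    have "blinfun_apply (R y) (hat x) \<in> group_span G"
    proof (rule group_span_image[OF _ xy(3)])
      fix c g assume g: "g \<in> G"
      then have "blinfun_apply (R y) (c *\<^sub>C hat g) = c *\<^sub>C blinfun_apply (L g) (hat y)"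
        using GM xy by (simp add: bounded_opsD[OF R_bounded] R_hat L_hat subsetD)
      then show "blinfun_apply (R y) (c *\<^sub>C hat g) \<in> group_span G"
        using Lg[OF g xy(4)] by (simp add: group_span_scaleC)
    qed
    then show ?thesis using xy by (simp add: span_part_def R_hat)
  qed
  have clN: "closed ?N"
  proof -
    have Mcl: "closed M" using vN closedin_WOT_imp_closed by (auto simp: von_neumann_algebra_def)
    obtain K where K: "K \<ge> 0" "\<And>x. x \<in> M \<Longrightarrow> norm (hat x) \<le> K * norm x" using hat_bounded by blast
    show ?thesis unfolding closed_sequential_limits
    proof (intro allI impI, elim conjE)
      fix s l assume s: "\<forall>n. s n \<in> ?N" "s \<longlonglongrightarrow> l"
      have l: "l \<in> M" using s NM Mcl closed_sequentially by (metis subsetD)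
      have "(\<lambda>n. K * norm (s n - l)) \<longlonglongrightarrow> K * 0"
        using s(2) by (intro tendsto_mult tendsto_const) (simp add: LIM_zero_iff tendsto_norm_zero_iff)
      then have lim0: "(\<lambda>n. K * norm (s n - l)) \<longlonglongrightarrow> 0" by simp
      have "(\<lambda>n. hat (s n) - hat l) \<longlonglongrightarrow> 0"
      proof (rule Lim_null_comparison[OF always_eventually lim0], rule allI)
        fix n
        have "s n \<in> M" using s(1) NM by blast
        then show "norm (hat (s n) - hat l) \<le> K * norm (s n - l)" using K(2)[of "s n - l"] l by (simp add: hat_diff)
      qed
      then have "(\<lambda>n. hat (s n)) \<longlonglongrightarrow> hat l" by (simp add: LIM_zero_iff)
      then have "hat l \<in> group_span G"
        using closed_sequentially[OF group_span_subspace(2), of "\<lambda>n. hat (s n)"] s(1) by (auto simp: span_part_def)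
      then show "l \<in> ?N" using l by (simp add: span_part_def)
    qed
  qed
  have csN: "closed_subalgebra ?N"
    unfolding closed_subalgebra_def by (intro conjI ballI allI Nb clN N1 Nadd Nm Nsc)
  have csM: "closed_subalgebra M" by (rule closed_subalgebra_von_neumann[OF vN])
  note ND = closed_subalgebraD[OF csN]
  have clM: "WOT closure_of ?N \<subseteq> M"
    using vN NM by (intro closure_of_minimal) (auto simp: von_neumann_algebra_def)
  have zero: "scalar_op 0 o\<^sub>L y = 0" for y :: "'a \<Rightarrow>\<^sub>L 'a" by (rule blinfun_eqI) simp
  have comb: "(scalar_op a o\<^sub>L x) + (scalar_op b o\<^sub>L adj x) \<in> WOT closure_of ?N"
    if x: "x \<in> WOT closure_of ?N" for x a b
  proof -
    have "(\<lambda>T. (scalar_op a o\<^sub>L T) + (scalar_op b o\<^sub>L adj T)) ` ?N \<subseteq> ?N"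
      using ND Nadj by auto
    then have "WOT closure_of ((\<lambda>T. (scalar_op a o\<^sub>L T) + (scalar_op b o\<^sub>L adj T)) ` ?N)
        \<subseteq> WOT closure_of ?N" by (rule closure_of_mono)
    then show ?thesis
      using continuous_map_image_closure_subset[OF continuous_map_WOT_combination[of a b], of ?N] x by blast
  qed
  have sa: "x \<in> ?N" if x: "x \<in> WOT closure_of ?N" "adj x = x" for x
  proof (rule mem_of_resolvents[OF csN])
    have xM: "x \<in> M" using x clM by blast
    then show "x \<in> bounded_ops" by (rule M_bounded)
    fix s :: real assume s: "s > 0"
    have sx: "s *\<^sub>R x \<in> M" "adj (s *\<^sub>R x) = s *\<^sub>R x" using xM x(2) by (auto simp: adj_scaleR M_bounded)
    obtain z where z: "z \<in> M" "(s *\<^sub>R x + scalar_op \<i>) o\<^sub>L z = id_blinfun"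
      "z o\<^sub>L (s *\<^sub>R x + scalar_op \<i>) = id_blinfun" "norm z \<le> 1"
      using resolvent_exists[OF csM sx] by blast
    have "s *\<^sub>R x \<in> WOT closure_of ?N"
      using comb[OF x(1), of "of_real s" 0] x(2) zero by (simp add: scaleR_eq_scalar_op)
    then have "z \<in> WOT closure_of (?N \<inter> op_ball 1)"
      using sx z M_bounded by (intro resolvent_in_WOT_closure[OF csN Nadj]) auto
    then have "hat z \<in> group_span G" by (intro hat_mem_group_span_of_closure z)
    then have "z \<in> ?N" using z by (simp add: span_part_def)
    then show "\<exists>z\<in>?N. (s *\<^sub>R x + scalar_op \<i>) o\<^sub>L z = id_blinfun \<and>
        z o\<^sub>L (s *\<^sub>R x + scalar_op \<i>) = id_blinfun \<and> norm z \<le> 1" using z by blast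
  qed
  have "x \<in> ?N" if x: "x \<in> WOT closure_of ?N" for x
  proof -
    have xb: "x \<in> bounded_ops" using x clM M_bounded by blast
    note dec = self_adjoint_decomposition[OF xb]
    have "self_adjoint_re x \<in> ?N" "self_adjoint_im x \<in> ?N"
      using dec comb[OF x] sa by (simp_all add: self_adjoint_re_def self_adjoint_im_def)
    then have "self_adjoint_re x + (scalar_op \<i> o\<^sub>L self_adjoint_im x) \<in> ?N" using ND by simp
    then show ?thesis using dec(3) by simp
  qed
  then have "closedin WOT ?N"
    using Nb by (intro closure_of_subset_eq[THEN iffD1]) auto
  then show ?thesis unfolding von_neumann_algebra_def by (intro conjI ballI allI Nb N1 Nadd Nm Nsc Nadj)
qed

lemma group_span_eq_UNIV:
  assumes "G \<subseteq> M" "id_blinfun \<in> G" "\<And>g h. g \<in> G \<Longrightarrow> h \<in> G \<Longrightarrow> g o\<^sub>L h \<in> G" "\<And>g. g \<in> G \<Longrightarrow> adj g \<in> G"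
    and gen: "von_neumann_algebra hull G = M"
  shows "group_span G = UNIV"
proof -
  have "G \<subseteq> span_part G" using assms(1) group_span_gen[of _ G 1] by (auto simp: span_part_def)
  then have "M \<subseteq> span_part G"
    using hull_minimal[of G "span_part G" von_neumann_algebra] von_neumann_span_part[OF assms(1-4)] gen by simp
  then have "hat ` M \<subseteq> group_span G" by (auto simp: span_part_def)
  then have "closure (hat ` M) \<subseteq> group_span G" by (rule closure_minimal) (rule group_span_subspace)
  then show ?thesis using hat_dense by auto
qed

end

section \<open>Operators commuting with left and right multiplication\<close>

lemma compose_eq_idD:
  assumes "S o\<^sub>L T = id_blinfun" shows "S (T v) = v"
  using arg_cong[OF assms, of "\<lambda>U. U v"] by simp

context tracial_algebra
begin

lemma op_eqI_generators:
  assumes G: "group_span G = UNIV" and ST: "S \<in> bounded_ops" "T \<in> bounded_ops"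
    and eq: "\<And>g. g \<in> G \<Longrightarrow> S (hat g) = T (hat g)"
  shows "S = T"
proof (rule blinfun_eqI)
  fix k
  have "(S - T) k \<in> {0}"
  proof (rule blinfun_image_closed_span)
    show "k \<in> closure (span {c *\<^sub>C hat g |c g. g \<in> G})" using G by (simp add: group_span_def)
    fix s assume "s \<in> {c *\<^sub>C hat g |c g. g \<in> G}"
    then show "(S - T) s \<in> {0}"
      using ST eq by (auto simp: blinfun.diff_left bounded_opsD)
  qed (auto simp: subspace_def)
  then show "S k = T k" by (simp add: blinfun.diff_left)
qed

lemma functional_eqI_generators:
  fixes f g :: "'b \<Rightarrow> complex"
  assumes G: "group_span G = UNIV" and bl: "bounded_linear f" "bounded_linear g"
    and sc: "\<And>c k. f (c *\<^sub>C k) = c * f k" "\<And>c k. g (c *\<^sub>C k) = c * g k"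
    and eq: "\<And>h. h \<in> G \<Longrightarrow> f (hat h) = g (hat h)"
  shows "f k = g k"
proof -
  have b: "bounded_linear (\<lambda>k. f k - g k)" using bl by (rule bounded_linear_sub)
  have "(Blinfun (\<lambda>k. f k - g k)) k \<in> {0}"
  proof (rule blinfun_image_closed_span)
    show "k \<in> closure (span {c *\<^sub>C hat g |c g. g \<in> G})" using G by (simp add: group_span_def)
    fix s assume "s \<in> {c *\<^sub>C hat g |c g. g \<in> G}"
    then show "(Blinfun (\<lambda>k. f k - g k)) s \<in> {0}"
      using sc eq by (auto simp: bounded_linear_Blinfun_apply[OF b])
  qed (auto simp: subspace_def)
  then show ?thesis by (simp add: bounded_linear_Blinfun_apply[OF b])
qed

lemma bounded_linear_matrix_coefficient:
  fixes S :: "'b \<Rightarrow>\<^sub>L 'b"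
  shows "bounded_linear (\<lambda>k. cinner (S k) l)" "bounded_linear (\<lambda>k. cinner l (S k))"
  by (auto intro: bounded_linear_compose[OF cinner.bounded_linear_left] bounded_linear_compose[OF cinner.bounded_linear_right]
      simp: blinfun.bounded_linear_right)

text \<open>
  Stated for an abstract pair of multiplications, so that it applies with \<open>\<Lambda>\<close> and \<open>\<Gamma>\<close> the left and the right
  multiplications in either order. The matrix coefficients of both products at \<open>y\<close> and \<open>z\<close> are \<open>\<langle>X \<Gamma>\<^sub>y x, z\<rangle>\<close> and
  \<open>\<langle>X y, \<Gamma>\<^sub>z J x\<rangle>\<close>. These depend continuously and linearly on the vector \<open>x\<close> in \<open>L\<^sup>2\<close>, and they agree when \<open>x\<close> is in \<open>G\<close>.
\<close>

lemma commute_of_generators: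
  fixes \<Lambda> \<Gamma> :: "('a \<Rightarrow>\<^sub>L 'a) \<Rightarrow> ('b \<Rightarrow>\<^sub>L 'b)"
  assumes G: "group_span G = UNIV" "G \<subseteq> M" and X: "X \<in> bounded_ops"
    and bo: "\<And>a. a \<in> M \<Longrightarrow> \<Lambda> a \<in> bounded_ops" "\<And>a. a \<in> M \<Longrightarrow> \<Gamma> a \<in> bounded_ops"
    and swap: "\<And>a b. a \<in> M \<Longrightarrow> b \<in> M \<Longrightarrow> \<Lambda> a (hat b) = \<Gamma> b (hat a)"
    and adj: "\<And>a. a \<in> M \<Longrightarrow> adj (\<Lambda> a) = \<Lambda> (adj a)"
    and XG: "\<And>g. g \<in> G \<Longrightarrow> X o\<^sub>L \<Lambda> g = \<Lambda> g o\<^sub>L X" and x: "x \<in> M"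
  shows "X o\<^sub>L \<Lambda> x = \<Lambda> x o\<^sub>L X"
proof (rule op_eqI_hat)
  fix y assume y: "y \<in> M"
  show "(X o\<^sub>L \<Lambda> x) (hat y) = (\<Lambda> x o\<^sub>L X) (hat y)"
  proof (rule vector_eqI_hat)
    fix z assume z: "z \<in> M"
    have key: "cinner (\<Lambda> a k) (hat z) = cinner k ((\<Gamma> z o\<^sub>L J) (hat a))" if "a \<in> M" for a k
      using adj_cinner[OF bo(1), of "adj a" k "hat z"] that z by (simp add: adj swap J_hat)
    have "cinner ((X o\<^sub>L \<Gamma> y) (hat x)) (hat z) = cinner (X (hat y)) ((\<Gamma> z o\<^sub>L J) (hat x))"
    proof (rule functional_eqI_generators[OF G(1), where f = "\<lambda>k. cinner ((X o\<^sub>L \<Gamma> y) k) (hat z)"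
          and g = "\<lambda>k. cinner (X (hat y)) ((\<Gamma> z o\<^sub>L J) k)"])
      show "cinner ((X o\<^sub>L \<Gamma> y) (c *\<^sub>C k)) (hat z) = c * cinner ((X o\<^sub>L \<Gamma> y) k) (hat z)" for c k
        using X bo(2)[OF y] by (simp add: bounded_opsD cinner_scaleC_left)
      show "cinner (X (hat y)) ((\<Gamma> z o\<^sub>L J) (c *\<^sub>C k)) = c * cinner (X (hat y)) ((\<Gamma> z o\<^sub>L J) k)" for c k
        using bo(2)[OF z] by (simp add: bounded_opsD J_scaleC cinner_scaleC_right)
      fix g assume g: "g \<in> G"
      then have gM: "g \<in> M" using G by blast
      have "(X o\<^sub>L \<Gamma> y) (hat g) = (X o\<^sub>L \<Lambda> g) (hat y)" using swap[OF gM y] by simp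
      also have "\<dots> = \<Lambda> g (X (hat y))" by (simp add: XG[OF g])
      finally show "cinner ((X o\<^sub>L \<Gamma> y) (hat g)) (hat z) = cinner (X (hat y)) ((\<Gamma> z o\<^sub>L J) (hat g))"
        using key[OF gM] by simp
    qed (rule bounded_linear_matrix_coefficient)+
    then show "cinner ((X o\<^sub>L \<Lambda> x) (hat y)) (hat z) = cinner ((\<Lambda> x o\<^sub>L X) (hat y)) (hat z)"
      using key[OF x, of "X (hat y)"] swap[OF x y] by simp
  qed
qed

text \<open>
  Its elements turn out to be the left multiplications by central elements of \<open>M\<close>.
\<close>

definition bicommuting :: "('b \<Rightarrow>\<^sub>L 'b) set" where
  "bicommuting = {X \<in> bounded_ops. \<forall>x\<in>M. X o\<^sub>L L x = L x o\<^sub>L X \<and> X o\<^sub>L R x = R x o\<^sub>L X}"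

lemma bicommutingD:
  assumes "X \<in> bicommuting"
  shows "X \<in> bounded_ops" "x \<in> M \<Longrightarrow> X o\<^sub>L L x = L x o\<^sub>L X" "x \<in> M \<Longrightarrow> X o\<^sub>L R x = R x o\<^sub>L X"
  using assms by (auto simp: bicommuting_def)

lemma closed_subalgebra_commutant:
  assumes "\<And>s. s \<in> S \<Longrightarrow> s \<in> bounded_ops"
  shows "closed_subalgebra {X \<in> bounded_ops. \<forall>s\<in>S. X o\<^sub>L s = s o\<^sub>L (X :: 'c::complex_hilbert_space \<Rightarrow>\<^sub>L 'c)}" (is "closed_subalgebra ?C")
  unfolding closed_subalgebra_def
proof (intro conjI ballI allI)
  note comp = bounded_bilinear.bounded_linear_left[OF bounded_bilinear_blinfun_compose]
    bounded_bilinear.bounded_linear_right[OF bounded_bilinear_blinfun_compose]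
  have "closed {X. X o\<^sub>L s = s o\<^sub>L X}" for s :: "'c \<Rightarrow>\<^sub>L 'c"
    by (intro closed_Collect_eq linear_continuous_on comp)
  then have "closed (bounded_ops \<inter> (\<Inter>s\<in>S. {X. X o\<^sub>L s = s o\<^sub>L X}))"
    by (intro closed_Int closed_bounded_ops closed_INT ballI)
  moreover have "bounded_ops \<inter> (\<Inter>s\<in>S. {X. X o\<^sub>L s = s o\<^sub>L X}) = ?C" by blast
  ultimately show "closed ?C" by simp
  fix x y assume x: "x \<in> ?C" and y: "y \<in> ?C"
  show "x + y \<in> ?C" using x y
    by (simp add: bounded_bilinear.add_left[OF bounded_bilinear_blinfun_compose] bounded_bilinear.add_right[OF bounded_bilinear_blinfun_compose])
  have "(x o\<^sub>L y) o\<^sub>L s = s o\<^sub>L (x o\<^sub>L y)" if s: "s \<in> S" for s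
  proof -
    have "(x o\<^sub>L y) o\<^sub>L s = x o\<^sub>L (s o\<^sub>L y)" using y s by (simp add: blinfun_compose_assoc)
    also have "\<dots> = (s o\<^sub>L x) o\<^sub>L y" using x s by (simp add: blinfun_compose_assoc[symmetric])
    finally show ?thesis by (simp add: blinfun_compose_assoc)
  qed
  then show "x o\<^sub>L y \<in> ?C" using x y by simp
next
  fix c x assume x: "x \<in> ?C"
  have "(scalar_op c o\<^sub>L x) o\<^sub>L s = s o\<^sub>L (scalar_op c o\<^sub>L x)" if s: "s \<in> S" for s
  proof (rule blinfun_eqI)
    fix v
    have "x (s v) = s (x v)"
      using x s by (metis (mono_tags, lifting) blinfun_apply_blinfun_compose mem_Collect_eq)
    then show "((scalar_op c o\<^sub>L x) o\<^sub>L s) v = (s o\<^sub>L (scalar_op c o\<^sub>L x)) v"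
      using assms[OF s] by (simp add: bounded_opsD)
  qed
  then show "scalar_op c o\<^sub>L x \<in> ?C" using x by simp
qed auto

lemma closed_subalgebra_bicommuting: "closed_subalgebra bicommuting"
proof -
  have "bicommuting = {X \<in> bounded_ops. \<forall>s \<in> L ` M \<union> R ` M. X o\<^sub>L s = s o\<^sub>L X}"
    by (auto simp: bicommuting_def)
  moreover have "closed_subalgebra {X \<in> bounded_ops. \<forall>s \<in> L ` M \<union> R ` M. X o\<^sub>L s = s o\<^sub>L X}"
    by (rule closed_subalgebra_commutant) auto
  ultimately show ?thesis by simp
qed

lemma bicommuting_adj:
  assumes X: "X \<in> bicommuting" shows "adj X \<in> bicommuting"
proof -
  note XD = bicommutingD[OF X]
  have "adj X o\<^sub>L L x = L x o\<^sub>L adj X" if x: "x \<in> M" for x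
  proof -
    have "adj (L (adj x) o\<^sub>L X) = adj (X o\<^sub>L L (adj x))" using XD(2)[of "adj x"] x by simp
    then show ?thesis using x XD(1) by (simp add: adj_compose adj_L)
  qed
  moreover have "adj X o\<^sub>L R x = R x o\<^sub>L adj X" if x: "x \<in> M" for x
  proof -
    have "adj (R (adj x) o\<^sub>L X) = adj (X o\<^sub>L R (adj x))" using XD(3)[of "adj x"] x by simp
    then show ?thesis using x XD(1) by (simp add: adj_compose adj_R)
  qed
  ultimately show ?thesis using XD(1) by (simp add: bicommuting_def)
qed

lemma cinner_J: "cinner (J k) (hat x) = cinner (hat (adj x)) k" if x: "x \<in> M"
proof (rule eq_if_eq_on_hat[of "\<lambda>k. cinner (J k) (hat x)"])
  show "cinner (J (hat y)) (hat x) = cinner (hat (adj x)) (hat y)" if "y \<in> M" for y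
    using x that tau_commute by (simp add: J_hat cinner_hat)
qed (intro continuous_intros)+

text \<open>
  This is what allows the approximants of \<open>Y \<Omega>\<close> to be taken self-adjoint.
\<close>

lemma J_fixes_self_adjoint_vector:
  assumes Y: "Y \<in> bicommuting" "adj Y = Y"
  shows "J (Y (hat id_blinfun)) = Y (hat id_blinfun)"
proof (rule vector_eqI_hat)
  fix x assume x: "x \<in> M"
  let ?o = "hat id_blinfun"
  have Yb: "Y \<in> bounded_ops" using bicommutingD[OF Y(1)] by blast
  have "cinner (J (Y ?o)) (hat x) = cinner (hat (adj x)) (Y ?o)"
    by (rule cinner_J[OF x])
  also have "\<dots> = cinner (Y ((L (adj x)) ?o)) ?o"
    using adj_cinner[OF Yb, of "hat (adj x)" ?o] x by (simp add: Y(2) L_hat)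
  also have "Y ((L (adj x)) ?o) = (L (adj x)) (Y ?o)"
    using bicommutingD(2)[OF Y(1), of "adj x"] x by (metis M_adj blinfun_apply_blinfun_compose)
  also have "cinner ((L (adj x)) (Y ?o)) ?o = cinner (Y ?o) (hat x)"
    using adj_cinner[OF L_bounded[OF x], of "Y ?o" ?o] x by (simp add: adj_L L_hat)
  finally show "cinner (J (Y ?o)) (hat x) = cinner (Y ?o) (hat x)" .
qed

text \<open>
  Choose self-adjoint \<open>h\<^sub>n \<in> M\<close> tending to \<open>Y \<Omega>\<close> in \<open>L\<^sup>2\<close>. As everything commutes, their resolvents \<open>r\<^sub>n\<close> satisfy
  \<open>W \<Omega> - r\<^sub>n \<Omega> = r\<^sub>n W (h\<^sub>n - Y) \<Omega>\<close>, so \<open>W \<Omega>\<close> is the limit of a sequence in the unit ball of \<open>M\<close> and thus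
  comes from some \<open>w \<in> M\<close>. Commutation with the right multiplications extends \<open>W = w\<close> from \<open>\<Omega>\<close> to all vectors.
\<close>

lemma resolvent_bicommuting_in_L:
  assumes Y: "Y \<in> bicommuting" "adj Y = Y" and W: "W \<in> bicommuting"
    and YW: "(Y + scalar_op \<i>) o\<^sub>L W = id_blinfun" "W o\<^sub>L (Y + scalar_op \<i>) = id_blinfun" and nW: "norm W \<le> 1"
  obtains w where "w \<in> M" "W = L w"
proof -
  let ?o = "hat id_blinfun"
  note YD = bicommutingD[OF Y(1)] and WD = bicommutingD[OF W]
  have "Y ?o \<in> closure (hat ` M)" by (simp add: hat_dense)
  then obtain s where s: "\<And>n::nat. s n \<in> hat ` M" "s \<longlonglongrightarrow> Y ?o" unfolding closure_sequential by blast
  then have "\<forall>n. \<exists>y. y \<in> M \<and> s n = hat y" by blast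
  then obtain y where y: "\<And>n. y n \<in> M" "\<And>n. s n = hat (y n)" by metis
  have ylim: "(\<lambda>n. hat (y n)) \<longlonglongrightarrow> Y ?o" using s(2) y(2) by (simp flip: y(2))
  define h where "h n = (1/2) *\<^sub>R (y n + adj (y n))" for n
  have h: "h n \<in> M" "adj (h n) = h n" for n
    using y by (auto simp: h_def adj_scaleR adj_add M_bounded add.commute)
  have hh: "hat (h n) = (1/2) *\<^sub>R (hat (y n) + J (hat (y n)))" for n
    using y by (simp add: h_def hat_scaleR hat_add J_hat)
  have "(\<lambda>n. (1/2) *\<^sub>R (hat (y n) + J (hat (y n)))) \<longlonglongrightarrow>
      (1/2) *\<^sub>R (Y ?o + J (Y ?o))"
    by (intro tendsto_intros ylim)
  also have "(1/2) *\<^sub>R (Y ?o + J (Y ?o)) = Y ?o"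
    by (simp add: J_fixes_self_adjoint_vector[OF Y] flip: scaleR_2)
  finally have hlim: "(\<lambda>n. hat (h n)) \<longlonglongrightarrow> Y ?o" by (simp add: hh)
  have "\<exists>r\<in>M. (h n + scalar_op \<i>) o\<^sub>L r = id_blinfun \<and> r o\<^sub>L (h n + scalar_op \<i>) = id_blinfun \<and> norm r \<le> 1" for n
    using resolvent_exists[OF closed_subalgebra_von_neumann[OF vN] h[of n]] by metis
  then obtain r where r: "\<And>n. r n \<in> M" "\<And>n. (h n + scalar_op \<i>) o\<^sub>L r n = id_blinfun"
    "\<And>n. r n o\<^sub>L (h n + scalar_op \<i>) = id_blinfun" "\<And>n. norm (r n) \<le> 1" by metis
  have scM: "scalar_op \<i> \<in> M" using M_scalar[OF M_id, of \<i>] by simp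
  have Lsc: "L (scalar_op \<i>) = scalar_op \<i>" using L_scalar[OF M_id, of \<i>] by simp
  have diff: "W ?o - hat (r n) = (L (r n)) (W (hat (h n) - Y ?o))" for n
  proof -
    let ?Lr = "(L (r n))" and ?Lh = "(L (h n))"
    have Lr: "L (r n) o\<^sub>L (L (h n) + scalar_op \<i>) = id_blinfun"
      using L_compose[OF r(1) M_add[OF h(1) scM], of n n] r(3)[of n] L_add[OF h(1) scM, of n] Lsc by simp
    have inv: "?Lr (?Lh v + \<i> *\<^sub>C v) = v" for v
      using compose_eq_idD[OF Lr, of v] by (simp add: blinfun.add_left)
    have Wi: "Y (W v) + \<i> *\<^sub>C W v = v"
      "W (Y v) + W (\<i> *\<^sub>C v) = v" for v
      using compose_eq_idD[OF YW(1), of v] compose_eq_idD[OF YW(2), of v]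
      by (simp_all add: blinfun.add_left blinfun.add_right)
    have YWc: "Y (W v) = W (Y v)" for v
      using Wi[of v] by (metis add_right_imp_eq bounded_opsD[OF WD(1)])
    have LhW: "?Lh (W v) = W (?Lh v)" for v
      using WD(2)[OF h(1), of n] by (metis blinfun_apply_blinfun_compose)
    have "W ?o - ?Lr ?o = ?Lr (?Lh (W ?o) + \<i> *\<^sub>C W ?o)
        - ?Lr (Y (W ?o) + \<i> *\<^sub>C W ?o)"
      by (simp only: inv Wi(1))
    also have "\<dots> = ?Lr (?Lh (W ?o) - Y (W ?o))"
      by (simp add: blinfun.diff_right[symmetric])
    also have "\<dots> = ?Lr (W (?Lh ?o - Y ?o))"
      by (simp only: LhW YWc blinfun.diff_right)
    finally show ?thesis using r(1) h(1) by (simp add: L_hat)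
  qed
  have "norm (hat (r n) - W ?o) \<le> norm (hat (h n) - Y ?o)" for n
  proof -
    have "norm (hat (r n) - W ?o) = norm ((L (r n)) (W (hat (h n) - Y ?o)))"
      unfolding diff[symmetric] by (rule norm_minus_commute)
    also have "\<dots> \<le> norm (L (r n)) * (norm W * norm (hat (h n) - Y ?o))"
      by (intro order_trans[OF norm_blinfun mult_left_mono] norm_blinfun) simp
    also have "\<dots> \<le> 1 * (1 * norm (hat (h n) - Y ?o))"
      using order_trans[OF norm_L[OF r(1)] r(4)] nW by (intro mult_mono) auto
    finally show ?thesis by simp
  qed
  moreover have "(\<lambda>n. norm (hat (h n) - Y ?o)) \<longlonglongrightarrow> 0"
    using hlim by (simp add: LIM_zero tendsto_norm_zero)
  ultimately have "(\<lambda>n. hat (r n) - W ?o) \<longlonglongrightarrow> 0"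
    by (rule Lim_null_comparison[OF always_eventually, OF allI])
  then have "(\<lambda>n. hat (r n)) \<longlonglongrightarrow> W ?o" by (rule LIM_zero_cancel)
  then obtain w where w: "w \<in> M" "hat w = W ?o" using hat_ball_closed[of r 1] r by blast
  have "W = L w"
  proof (rule op_eqI_hat)
    fix b assume b: "b \<in> M"
    have "W (hat b) = (W o\<^sub>L R b) ?o" using b by (simp add: R_hat)
    also have "\<dots> = (R b) (hat w)" unfolding WD(3)[OF b] by (simp add: w)
    also have "\<dots> = (L w) (hat b)" using b w(1) by (simp add: R_hat L_hat)
    finally show "W (hat b) = (L w) (hat b)" .
  qed
  with w show ?thesis using that by blast
qed

lemma L_diff: "x \<in> M \<Longrightarrow> y \<in> M \<Longrightarrow> L (x - y) = L x - L y"
  by (rule op_eqI_hat) (simp add: L_hat blinfun.diff_left hat_diff bounded_bilinear.diff_left[OF bounded_bilinear_blinfun_compose])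

text \<open>
  A small self-adjoint \<open>X\<close> is of the form \<open>Y (1 + Y\<^sup>2)\<^sup>-\<^sup>1\<close>, where \<open>Y\<close> is the fixed point of the contraction
  \<open>Y \<mapsto> X (1 + Y\<^sup>2)\<close>; and \<open>Y (1 + Y\<^sup>2)\<^sup>-\<^sup>1 = ((Y + i)\<^sup>-\<^sup>1 - (- Y + i)\<^sup>-\<^sup>1) / 2\<close> is a combination of resolvents.
\<close>

lemma small_self_adjoint_bicommuting_in_L:
  assumes X: "X \<in> bicommuting" "adj X = X" "norm X \<le> 1/4"
  obtains w where "w \<in> M" "X = L w"
proof -
  note AD = closed_subalgebraD[OF closed_subalgebra_bicommuting]
  have Bb: "Y \<in> bounded_ops" if "Y \<in> bicommuting" for Y using AD(1) that by blast
  let ?S = "{Y \<in> bicommuting. adj Y = Y \<and> norm Y \<le> 1/2 \<and> Y o\<^sub>L X = X o\<^sub>L Y}"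
  let ?f = "\<lambda>Y. X o\<^sub>L (id_blinfun + (Y o\<^sub>L Y))"
  note comp = bounded_bilinear.bounded_linear_left[OF bounded_bilinear_blinfun_compose]
    bounded_bilinear.bounded_linear_right[OF bounded_bilinear_blinfun_compose]
  note cl = bounded_bilinear.add_left[OF bounded_bilinear_blinfun_compose] bounded_bilinear.add_right[OF bounded_bilinear_blinfun_compose]
    bounded_bilinear.diff_left[OF bounded_bilinear_blinfun_compose] bounded_bilinear.diff_right[OF bounded_bilinear_blinfun_compose]
  have "\<exists>!Y\<in>?S. ?f Y = Y"
  proof (rule Banach_fix)
    have "?S = bicommuting \<inter> (\<Inter>k l. {Y. cinner (blinfun_apply Y k) l = cinner k (blinfun_apply Y l)})
        \<inter> {Y. norm Y \<le> 1/2} \<inter> {Y. Y o\<^sub>L X = X o\<^sub>L Y}"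
      using Bb by (auto intro: adj_eqI) (metis adj_cinner Bb)
    moreover have "closed \<dots>"
      by (intro closed_Int AD(2) closed_INT ballI closed_Collect_eq closed_Collect_le continuous_intros
          linear_continuous_on comp)
    ultimately show "complete ?S" by (simp add: complete_eq_closed)
    have "0 \<in> ?S"
    proof -
      have "adj 0 = (0 :: 'b \<Rightarrow>\<^sub>L 'b)" by (rule adj_eqI) (auto simp: cinner.zero_left cinner.zero_right)
      moreover have "0 o\<^sub>L X = X o\<^sub>L 0" by (rule blinfun_eqI) simp
      ultimately show ?thesis using AD(9) by simp
    qed
    then show "?S \<noteq> {}" by blast
    show "?f ` ?S \<subseteq> ?S"
    proof (rule image_subsetI)
      fix Y assume Y: "Y \<in> ?S"
      then have YX: "Y o\<^sub>L X = X o\<^sub>L Y" and Yb: "Y \<in> bounded_ops" and Xb: "X \<in> bounded_ops" using Bb X by auto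
      have YYX: "(Y o\<^sub>L Y) o\<^sub>L X = X o\<^sub>L (Y o\<^sub>L Y)" by (metis YX blinfun_compose_assoc)
      have "?f Y \<in> bicommuting" using Y X AD by simp
      moreover have "adj (?f Y) = ?f Y"
        using Y Yb Xb by (simp add: adj_compose adj_add X(2) cl YYX)
      moreover have "norm (?f Y) \<le> 1/2"
      proof -
        have "norm (Y o\<^sub>L Y) \<le> norm Y * norm Y" by (rule norm_blinfun_compose)
        also have "\<dots> \<le> (1/2) * (1/2)" using Y by (intro mult_mono) auto
        finally have "norm (id_blinfun + (Y o\<^sub>L Y) :: 'b \<Rightarrow>\<^sub>L 'b) \<le> 1 + 1/4"
          using norm_triangle_ineq[of id_blinfun "Y o\<^sub>L Y"] norm_blinfun_id_le[where 'a='b] by simp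
        then have "norm (?f Y) \<le> (1/4) * (1 + 1/4)"
          using X(3) by (intro order_trans[OF norm_blinfun_compose mult_mono]) auto
        then show ?thesis by simp
      qed
      moreover have "?f Y o\<^sub>L X = X o\<^sub>L ?f Y" by (simp add: blinfun_compose_assoc cl YYX[unfolded blinfun_compose_assoc])
      ultimately show "?f Y \<in> ?S" by blast
    qed
    fix Y Z assume Y: "Y \<in> ?S" and Z: "Z \<in> ?S"
    have "?f Y - ?f Z = X o\<^sub>L ((Y o\<^sub>L (Y - Z)) + ((Y - Z) o\<^sub>L Z))" by (simp add: cl)
    then have "norm (?f Y - ?f Z) \<le> norm X * norm ((Y o\<^sub>L (Y - Z)) + ((Y - Z) o\<^sub>L Z))"
      by (simp only: norm_blinfun_compose)
    also have "\<dots> \<le> (1/4) * (norm Y * norm (Y - Z) + norm (Y - Z) * norm Z)"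
      using X(3) by (intro mult_mono order_trans[OF norm_triangle_ineq] add_mono norm_blinfun_compose) auto
    also have "\<dots> \<le> (1/4) * ((1/2) * norm (Y - Z) + norm (Y - Z) * (1/2))"
      using Y Z by (intro mult_left_mono add_mono mult_right_mono) auto
    finally show "dist (?f Y) (?f Z) \<le> (1/4) * dist Y Z" by (simp add: dist_norm)
  qed auto
  then obtain Y where Y: "Y \<in> bicommuting" "adj Y = Y" and YX: "?f Y = Y" by blast
  have mY: "- Y \<in> bicommuting" using AD(7)[OF Y(1), of "-1"] by simp
  have amY: "adj (- Y) = - Y" using adj_scaleR[OF Bb[OF Y(1)], of "-1"] Y(2) by simp
  obtain W where W: "W \<in> bicommuting" "(Y + scalar_op \<i>) o\<^sub>L W = id_blinfun" "W o\<^sub>L (Y + scalar_op \<i>) = id_blinfun" "norm W \<le> 1"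
    using resolvent_exists[OF closed_subalgebra_bicommuting Y] by blast
  obtain V where V: "V \<in> bicommuting" "(- Y + scalar_op \<i>) o\<^sub>L V = id_blinfun" "V o\<^sub>L (- Y + scalar_op \<i>) = id_blinfun" "norm V \<le> 1"
    using resolvent_exists[OF closed_subalgebra_bicommuting mY amY] by blast
  obtain w where w: "w \<in> M" "W = L w" using resolvent_bicommuting_in_L[OF Y W] by blast
  obtain v where v: "v \<in> M" "V = L v" using resolvent_bicommuting_in_L[OF mY amY V] by blast
  have "X = (1/2) *\<^sub>R (W - V)"
  proof (rule blinfun_eqI)
    fix u
    let ?W = "blinfun_apply W" and ?V = "blinfun_apply V" and ?Y = "blinfun_apply Y" and ?X = "blinfun_apply X"
    have Yb: "Y \<in> bounded_ops" "V \<in> bounded_ops" "W \<in> bounded_ops" using Bb Y V W by auto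
    have W1: "?Y (?W u) + \<i> *\<^sub>C ?W u = u" for u
      using compose_eq_idD[OF W(2), of u] by (simp add: blinfun.add_left)
    have V1: "- ?Y (?V u) + \<i> *\<^sub>C ?V u = u" for u
      using compose_eq_idD[OF V(2), of u] by (simp add: blinfun.add_left blinfun.minus_left blinfun.diff_left)
    have V2: "?V (- ?Y u + \<i> *\<^sub>C u) = u" for u
      using compose_eq_idD[OF V(3), of u] by (simp add: blinfun.add_left blinfun.minus_left blinfun.diff_left)
    have YV: "?Y (?V u) = ?V (?Y u)" for u
    proof -
      have "?V (- ?Y u + \<i> *\<^sub>C u) = - ?V (?Y u) + \<i> *\<^sub>C ?V u"
        by (simp only: blinfun.add_right blinfun.minus_right bounded_opsD[OF Yb(2)])
      from trans[OF V1 trans[OF V2[symmetric] this]]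
      have "- ?Y (?V u) + \<i> *\<^sub>C ?V u = - ?V (?Y u) + \<i> *\<^sub>C ?V u" .
      then show ?thesis by simp
    qed
    \<comment> \<open>As \<open>- u = (1 + Y\<^sup>2) k\<close>, the fixed point equation gives \<open>X u = - Y k\<close>, and \<open>Y k\<close> is read off from
      \<open>(Y + i) k = V u\<close> and \<open>(- Y + i) k = W u\<close>.\<close>
    define k where "k = ?V (?W u)"
    have Yk: "?Y k + \<i> *\<^sub>C k = ?V u"
    proof -
      have "?V u = ?V (?Y (?W u) + \<i> *\<^sub>C ?W u)" by (simp only: W1)
      then show ?thesis by (simp add: k_def YV blinfun.add_right bounded_opsD[OF Yb(2)])
    qed
    have Yk': "- ?Y k + \<i> *\<^sub>C k = ?W u" unfolding k_def by (rule V1)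
    have k2: "k + ?Y (?Y k) = - u"
    proof -
      have "u = - ?Y (?V u) + \<i> *\<^sub>C ?V u" by (simp only: V1)
      also have "\<dots> = - ?Y (?Y k + \<i> *\<^sub>C k) + \<i> *\<^sub>C (?Y k + \<i> *\<^sub>C k)" by (simp only: Yk)
      also have "\<dots> = - ?Y (?Y k) - k"
        by (simp add: blinfun.add_right bounded_opsD[OF Yb(1)] scaleC_add_right scaleC_scaleC scaleC_minus_left)
      finally have "u = - ?Y (?Y k) - k" .
      from arg_cong[OF this, of uminus] show ?thesis by simp
    qed
    have "?Y k = ?X (k + ?Y (?Y k))"
    proof -
      have "?Y k = blinfun_apply (?f Y) k" using YX by simp
      then show ?thesis by (simp add: blinfun.add_left)
    qed
    then have "?X u = - ?Y k" unfolding k2 by (simp add: blinfun.minus_right)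
    also have "\<dots> = (1/2) *\<^sub>R (?W u - ?V u)"
    proof -
      have "?W u - ?V u = - (2 *\<^sub>R ?Y k)" unfolding Yk[symmetric] Yk'[symmetric] by (simp add: scaleR_2)
      then show ?thesis by simp
    qed
    finally show "?X u = blinfun_apply ((1/2) *\<^sub>R (W - V)) u" by (simp add: blinfun.scaleR_left blinfun.diff_left)
  qed
  also have "\<dots> = L ((1/2) *\<^sub>R (w - v))" using w v by (simp add: L_scaleR L_diff)
  finally show ?thesis by (rule that[rotated]) (use w(1) v(1) in simp)
qed

lemma self_adjoint_bicommuting_in_L:
  assumes X: "X \<in> bicommuting" "adj X = X"
  shows "X \<in> L ` M"
proof -
  note AD = closed_subalgebraD[OF closed_subalgebra_bicommuting]
  \<comment> \<open>Large enough to scale \<open>X\<close> down to norm at most \<open>1 / 4\<close>.\<close>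
  define c where "c = 4 * (norm X + 1)"
  have c: "c > 0" by (simp add: c_def add_nonneg_pos)
  obtain w where w: "w \<in> M" "(1 / c) *\<^sub>R X = L w"
  proof (rule small_self_adjoint_bicommuting_in_L[of "(1 / c) *\<^sub>R X"])
    show "(1 / c) *\<^sub>R X \<in> bicommuting" using AD(7)[OF X(1)] .
    show "adj ((1 / c) *\<^sub>R X) = (1 / c) *\<^sub>R X" using X AD(1) by (simp add: adj_scaleR subsetD)
    show "norm ((1 / c) *\<^sub>R X) \<le> 1 / 4" using c by (simp add: divide_le_eq) (simp add: c_def)
  qed
  have "X = c *\<^sub>R ((1 / c) *\<^sub>R X)" using c by simp
  also have "\<dots> = L (c *\<^sub>R w)" using w by (simp add: L_scaleR)
  finally show ?thesis using w(1) by simp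
qed

lemma bicommuting_in_L:
  assumes X: "X \<in> bicommuting"
  shows "X \<in> L ` M"
proof -
  note AD = closed_subalgebraD[OF closed_subalgebra_bicommuting]
  have Xb: "X \<in> bounded_ops" using X AD(1) by blast
  note dec = self_adjoint_decomposition[OF Xb]
  have aX: "adj X \<in> bicommuting" by (rule bicommuting_adj[OF X])
  then have "self_adjoint_re X \<in> bicommuting" "self_adjoint_im X \<in> bicommuting"
    unfolding self_adjoint_re_def self_adjoint_im_def using AD(4,6) X by blast+
  then obtain a b where ab: "a \<in> M" "self_adjoint_re X = L a" "b \<in> M" "self_adjoint_im X = L b"
    using self_adjoint_bicommuting_in_L[OF _ dec(1)] self_adjoint_bicommuting_in_L[OF _ dec(2)] by blast
  then have "X = L (a + (scalar_op \<i> o\<^sub>L b))" using dec(3) by (simp add: L_add L_scalar)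
  then show ?thesis using ab by auto
qed

lemma L_inj: "inj_on L M"
proof (rule inj_onI)
  fix x y assume xy: "x \<in> M" "y \<in> M" "L x = L y"
  then have "hat x = hat y" using L_hat[OF xy(1) M_id] L_hat[OF xy(2) M_id] by simp
  then show "x = y" using inj_onD[OF hat_inj] xy by blast
qed

lemma bicommuting_in_L_center:
  assumes X: "X \<in> bicommuting"
  shows "X \<in> L ` center M"
proof -
  obtain z where z: "z \<in> M" "X = L z" using bicommuting_in_L[OF X] by blast
  have "z o\<^sub>L x = x o\<^sub>L z" if x: "x \<in> M" for x
  proof -
    have "L (z o\<^sub>L x) = L (x o\<^sub>L z)" using bicommutingD(2)[OF X x] z x by (simp add: L_compose)
    then show ?thesis using inj_onD[OF L_inj] z x by simp
  qed
  then show ?thesis using z by (auto simp: center_def)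
qed

end

section \<open>Biharmonic operators\<close>

text \<open>
  The argument described at the top. The operators \<open>A i\<close> and \<open>B i\<close> are the inverses of the left and right
  translations \<open>U i\<close> and \<open>V i\<close>; only those properties are assumed that are also available with the two sides
  exchanged, so that the lemma gives commutation on either side.
\<close>

lemma biharmonic_commutes_on_orbit:
  fixes X :: "'b::real_inner \<Rightarrow>\<^sub>L 'b" and A B U V :: "'i \<Rightarrow> 'b \<Rightarrow>\<^sub>L 'b"
  assumes I: "finite I" "I \<noteq> {}"
    and Aiso: "\<And>i v. i \<in> I \<Longrightarrow> norm ((A i) v) = norm v"
    and AU: "\<And>i v w. i \<in> I \<Longrightarrow> inner ((A i) v) w = inner v ((U i) w)"
    and Vc: "\<And>i v. i \<in> I \<Longrightarrow> norm ((V i) v) \<le> norm v"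
    and comm: "\<And>i j v. i \<in> I \<Longrightarrow> j \<in> I \<Longrightarrow> (A i) ((B j) v) = (B j) ((A i) v)"
      "\<And>i j v. i \<in> I \<Longrightarrow> j \<in> I \<Longrightarrow> (A i) ((V j) v) = (V j) ((A i) v)"
    and harm_U: "\<And>v. (\<Sum>i\<in>I. (U i) (X ((A i) v))) = real (card I) *\<^sub>R X v"
    and harm_V: "\<And>v. (\<Sum>i\<in>I. (V i) (X ((B i) v))) = real (card I) *\<^sub>R X v"
    and \<Omega>: "\<And>i. i \<in> I \<Longrightarrow> (A i) \<Omega> = (B i) \<Omega>"
    and ij: "i \<in> I" "j \<in> I"
  shows "X ((A i) ((B j) \<Omega>)) = (A i) (X ((B j) \<Omega>))"
proof -
  define n where "n = real (card I)"
  have n: "n > 0" using I by (simp add: n_def card_gt_0_iff)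
  define P where "P f v = (\<Sum>i\<in>I. f ((A i) v)) / n" for f :: "'b \<Rightarrow> real" and v
  define Q where "Q f v = (\<Sum>i\<in>I. f ((B i) v)) / n" for f :: "'b \<Rightarrow> real" and v
  define Y where "Y i v = X ((A i) v) - (A i) (X v)" for i v
  define q where "q v = (norm (X v))\<^sup>2" for v
  define d where "d v = (\<Sum>i\<in>I. (norm (Y i v))\<^sup>2) / n" for v
  have d0: "d v \<ge> 0" for v unfolding d_def using n by (intro divide_nonneg_pos sum_nonneg) auto
  \<comment> \<open>Expand the squared norm of \<open>Y i v\<close>; after averaging, \<open>P\<close>-harmonicity of \<open>X\<close> turns the mixed term into \<open>2 q v\<close>.\<close>
  have Pq: "P q v - q v = d v" for v
  proof -
    have "(norm (Y i v))\<^sup>2 = q ((A i) v) + q v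
        - 2 * inner (X v) ((U i) (X ((A i) v)))" if i: "i \<in> I" for i
    proof -
      have sq: "(norm (a - b))\<^sup>2 = (norm a)\<^sup>2 + (norm b)\<^sup>2 - 2 * inner b a" for a b :: 'b
        by (simp add: power2_norm_eq_inner inner_diff_left inner_diff_right inner_commute)
      show ?thesis unfolding Y_def sq q_def AU[OF i] Aiso[OF i] ..
    qed
    then have "(\<Sum>i\<in>I. (norm (Y i v))\<^sup>2) = (\<Sum>i\<in>I. q ((A i) v) + q v
        - 2 * inner (X v) ((U i) (X ((A i) v))))"
      by (rule sum.cong[OF refl])
    also have "\<dots> = (\<Sum>i\<in>I. q ((A i) v)) + n * q v
        - 2 * inner (X v) (\<Sum>i\<in>I. (U i) (X ((A i) v)))"
      by (simp add: sum.distrib sum_subtractf inner_sum_right sum_distrib_left n_def)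
    also have "\<dots> = (\<Sum>i\<in>I. q ((A i) v)) - n * q v"
      unfolding harm_U by (simp add: q_def n_def power2_norm_eq_inner)
    finally show ?thesis unfolding d_def P_def using n by (simp add: field_simps)
  qed
  \<comment> \<open>Each \<open>Y i\<close> is \<open>Q\<close>-harmonic because \<open>A i\<close> commutes with all \<open>B j\<close> and \<open>V j\<close>, and the square of the norm is convex.\<close>
  have Qd: "d v \<le> Q d v" for v
  proof -
    have "(norm (Y i v))\<^sup>2 \<le> (\<Sum>j\<in>I. (norm (Y i ((B j) v)))\<^sup>2) / n" if i: "i \<in> I" for i
    proof -
      have "(\<Sum>j\<in>I. (V j) (Y i ((B j) v))) = n *\<^sub>R Y i v"
      proof -
        have "(\<Sum>j\<in>I. (V j) (Y i ((B j) v)))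
            = (\<Sum>j\<in>I. (V j) (X ((B j) ((A i) v)))
                - (A i) ((V j) (X ((B j) v))))"
          by (rule sum.cong[OF refl]) (simp add: Y_def blinfun.diff_right comm[OF i])
        also have "\<dots> = (\<Sum>j\<in>I. (V j) (X ((B j) ((A i) v))))
                - (A i) (\<Sum>j\<in>I. (V j) (X ((B j) v)))"
          by (simp add: sum_subtractf blinfun.sum_right)
        also have "\<dots> = n *\<^sub>R Y i v"
          unfolding harm_V by (simp add: Y_def n_def blinfun.scaleR_right scaleR_diff_right)
        finally show ?thesis .
      qed
      then have "n * norm (Y i v) = norm (\<Sum>j\<in>I. (V j) (Y i ((B j) v)))" using n by simp
      also have "\<dots> \<le> (\<Sum>j\<in>I. norm (Y i ((B j) v)))" by (intro sum_norm_le Vc)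
      finally have "(n * norm (Y i v))\<^sup>2 \<le> (\<Sum>j\<in>I. norm (Y i ((B j) v)))\<^sup>2"
        using n by (intro power_mono) auto
      also have "\<dots> \<le> (\<Sum>j\<in>I. (norm (Y i ((B j) v)))\<^sup>2) * n"
        unfolding n_def by (rule sum_squared_le_sum_of_squares)
      finally show ?thesis using n by (simp add: power_mult_distrib power2_eq_square field_simps)
    qed
    then have "d v \<le> (\<Sum>i\<in>I. (\<Sum>j\<in>I. (norm (Y i ((B j) v)))\<^sup>2) / n) / n"
      unfolding d_def using n by (intro divide_right_mono sum_mono) auto
    also have "\<dots> = Q d v"
      unfolding Q_def d_def by (simp add: sum_divide_distrib[symmetric]) (subst sum.swap, simp)
    finally show ?thesis .
  qed
  have Qmono: "Q f v \<le> Q g v" if "\<And>v. f v \<le> g v" for f g v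
    unfolding Q_def using n that by (intro divide_right_mono sum_mono) auto
  have PQ: "P (Q f) = Q (P f)" for f
  proof
    fix v
    have "P (Q f) v = (\<Sum>i\<in>I. \<Sum>j\<in>I. f ((B j) ((A i) v))) / n / n"
      unfolding P_def Q_def by (simp add: sum_divide_distrib[symmetric])
    also have "(\<Sum>i\<in>I. \<Sum>j\<in>I. f ((B j) ((A i) v)))
        = (\<Sum>j\<in>I. \<Sum>i\<in>I. f ((A i) ((B j) v)))"
      by (subst sum.swap) (simp add: comm(1))
    also have "\<dots> / n / n = Q (P f) v"
      unfolding P_def Q_def by (simp add: sum_divide_distrib[symmetric])
    finally show "P (Q f) v = Q (P f) v" .
  qed
  have P\<Omega>: "P f \<Omega> = Q f \<Omega>" for f unfolding P_def Q_def using \<Omega> by simp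
  have PkQ: "(P ^^ k) (Q f) = Q ((P ^^ k) f)" for k f by (induction k) (simp_all add: PQ)
  have PkQk: "(Q ^^ k) f \<Omega> = (P ^^ k) f \<Omega>" for k f
  proof (induction k arbitrary: f)
    case (Suc k)
    have "(Q ^^ Suc k) f \<Omega> = (Q ^^ k) (Q f) \<Omega>" by (simp only: funpow_Suc_right o_def)
    also have "\<dots> = (P ^^ k) (Q f) \<Omega>" by (rule Suc.IH)
    also have "\<dots> = (P ^^ Suc k) f \<Omega>" by (simp add: PkQ P\<Omega>)
    finally show ?case .
  qed simp
  have Pdiff: "P (\<lambda>v. f v - g v) = (\<lambda>v. P f v - P g v)" for f g
    unfolding P_def by (simp add: sum_subtractf diff_divide_distrib)
  have Pkd: "(P ^^ k) d v = (P ^^ Suc k) q v - (P ^^ k) q v" for k v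
  proof (induction k arbitrary: v)
    case (Suc k)
    then have "(P ^^ k) d = (\<lambda>v. (P ^^ Suc k) q v - (P ^^ k) q v)" by blast
    then have "(P ^^ Suc k) d = P (\<lambda>v. (P ^^ Suc k) q v - (P ^^ k) q v)" by simp
    also have "\<dots> = (\<lambda>v. P ((P ^^ Suc k) q) v - P ((P ^^ k) q) v)" by (rule Pdiff)
    finally show ?case by simp
  qed (simp add: Pq)
  define b where "b k = (Q ^^ k) d \<Omega>" for k
  have Qk: "(Q ^^ k) d v \<le> (Q ^^ Suc k) d v" for k v
    by (induction k arbitrary: v) (auto simp: Qd intro: Qmono)
  have bmono: "b k \<le> b (Suc k)" for k unfolding b_def by (rule Qk)
  have b1: "b 1 \<le> b (Suc k)" for k
    using lift_Suc_mono_le[of b 1 "Suc k"] bmono by simp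
  have tel: "(\<Sum>k<N. b k) = (P ^^ N) q \<Omega> - q \<Omega>" for N
    by (induction N) (simp_all add: b_def PkQk Pkd)
  have Pk_bound: "(P ^^ k) q v \<le> (norm X * norm v)\<^sup>2" for k v
  proof (induction k arbitrary: v)
    case 0 show ?case by (simp add: q_def norm_blinfun power_mono)
  next
    case (Suc k)
    have "(P ^^ Suc k) q v \<le> (\<Sum>i\<in>I. (norm X * norm v)\<^sup>2) / n"
      using n Suc Aiso unfolding funpow.simps o_def P_def
      by (intro divide_right_mono sum_mono) (metis, simp)
    also have "\<dots> = (norm X * norm v)\<^sup>2" using n by (simp add: n_def)
    finally show ?case .
  qed
  \<comment> \<open>The index \<open>1\<close> is the one needed: \<open>b 1 = Q d \<Omega>\<close> is an average of values of \<open>d\<close> at the vectors \<open>B j \<Omega>\<close>.\<close>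
  have "b 1 \<le> 0"
  proof (rule ccontr)
    assume "\<not> b 1 \<le> 0"
    then have bp: "b 1 > 0" by simp
    then obtain N where N: "(norm X * norm \<Omega>)\<^sup>2 < real N * b 1" using reals_Archimedean3 by blast
    have "real N * b 1 = (\<Sum>k<N. b 1)" by simp
    also have "\<dots> \<le> (\<Sum>k<N. b (Suc k))" by (intro sum_mono b1)
    also have "\<dots> \<le> (\<Sum>k<Suc N. b k)"
      unfolding sum.lessThan_Suc_shift using d0[of \<Omega>] by (simp add: b_def)
    also have "\<dots> = (P ^^ Suc N) q \<Omega> - q \<Omega>" by (rule tel)
    also have "\<dots> \<le> (P ^^ Suc N) q \<Omega>" by (simp add: q_def del: funpow.simps)
    also have "\<dots> \<le> (norm X * norm \<Omega>)\<^sup>2" by (rule Pk_bound)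
    finally show False using N by simp
  qed
  then have "(\<Sum>j\<in>I. d ((B j) \<Omega>)) \<le> 0" using n by (simp add: b_def Q_def divide_le_0_iff)
  then have "(\<Sum>j\<in>I. d ((B j) \<Omega>)) = 0" using d0 by (meson antisym sum_nonneg)
  then have "d ((B j) \<Omega>) = 0" using I ij d0 by (simp add: sum_nonneg_eq_0_iff)
  then have "(\<Sum>i\<in>I. (norm (Y i ((B j) \<Omega>)))\<^sup>2) = 0" using n by (simp add: d_def)
  then have "Y i ((B j) \<Omega>) = 0" using I ij by (simp add: sum_nonneg_eq_0_iff)
  then show ?thesis by (simp add: Y_def)
qed

section \<open>Averaging the orbit of an operator\<close>

text \<open>
  The Cesaro means \<open>Z N\<close> of the orbit of a point lie in \<open>S\<close> and are almost fixed, as the sum \<open>P (Z N) - Z N\<close>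
  telescopes. The conditions \<open>\<bar>\<langle>(P X - X) x, y\<rangle>\<bar> \<le> e\<close> are weakly closed, so by compactness some point satisfies them all.
\<close>

lemma Markov_fixed_point:
  fixes P :: "('a::complex_hilbert_space \<Rightarrow>\<^sub>L 'a) \<Rightarrow> ('a \<Rightarrow>\<^sub>L 'a)"
  assumes S: "compactin WOT S" "S \<noteq> {}" "convex S" "S \<subseteq> op_ball r"
    and P: "linear P" "continuous_map WOT WOT P" "P ` S \<subseteq> S"
  obtains X where "X \<in> S" "P X = X"
proof -
  obtain X0 where X0: "X0 \<in> S" using S by blast
  have PkS: "(P ^^ k) X0 \<in> S" for k by (induction k) (use X0 P in auto)
  have r: "norm Y \<le> r" if "Y \<in> S" for Y using that S by (auto simp: op_ball_def)
  define Z where "Z N = (\<Sum>k<Suc N. (1 / real (Suc N)) *\<^sub>R (P ^^ k) X0)" for N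
  have Z: "Z N \<in> S" for N
    unfolding Z_def by (rule convex_sum[OF _ S(3)]) (auto simp: PkS)
  have PZ: "norm (P (Z N) - Z N) \<le> (2 * r) / real (Suc N)" for N
  proof -
    have "P (Z N) = (\<Sum>k<Suc N. (1 / real (Suc N)) *\<^sub>R (P ^^ Suc k) X0)"
      unfolding Z_def by (simp only: linear_sum[OF P(1)] linear_scale[OF P(1)] funpow.simps o_def)
    then have "P (Z N) - Z N = (1 / real (Suc N)) *\<^sub>R (\<Sum>k<Suc N. (P ^^ Suc k) X0 - (P ^^ k) X0)"
      unfolding Z_def by (simp only: scaleR_sum_right scaleR_diff_right sum_subtractf)
    also have "(\<Sum>k<Suc N. (P ^^ Suc k) X0 - (P ^^ k) X0) = (P ^^ Suc N) X0 - (P ^^ 0) X0"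
      by (rule sum_lessThan_telescope)
    finally have "norm (P (Z N) - Z N) = (1 / real (Suc N)) * norm ((P ^^ Suc N) X0 - (P ^^ 0) X0)" by simp
    also have "norm ((P ^^ Suc N) X0 - (P ^^ 0) X0) \<le> r + r"
      by (intro order_trans[OF norm_triangle_ineq4] add_mono r PkS)
    finally show ?thesis by (simp add: divide_right_mono)
  qed
  define D where "D = (\<lambda>(x, y, e). {X \<in> bounded_ops. cinner ((P X) x) y - cinner (X x) y \<in> cball 0 e})"
  obtain X where X: "X \<in> S" "\<And>i. i \<in> UNIV \<times> UNIV \<times> {0<..} \<Longrightarrow> X \<in> D i"
  proof (rule compactin_fip_indexed[OF S(1), of "UNIV \<times> UNIV \<times> {0<..}" D])
    fix i :: "'a \<times> 'a \<times> real"
    obtain x y e where i: "i = (x, y, e)" by (cases i)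
    have "continuous_map WOT euclidean (\<lambda>X. cinner ((P X) x) y - cinner (X x) y)"
      using continuous_map_compose[OF P(2) continuous_map_WOT_cinner[of x y]]
      by (intro continuous_map_diff continuous_map_WOT_cinner) (simp add: o_def)
    then show "closedin WOT (D i)"
      unfolding D_def i prod.case by (rule closedin_WOT_functional) simp
  next
    fix F :: "('a \<times> 'a \<times> real) set" assume F: "finite F" "F \<subseteq> UNIV \<times> UNIV \<times> {0<..}"
    have "\<forall>\<^sub>F N in sequentially. Z N \<in> D i" if i: "i \<in> F" for i
    proof -
      obtain x y e where xy: "i = (x, y, e)" "e > 0" using i F by (cases i) auto
      have "(\<lambda>N. (2 * r) * inverse (real (Suc N)) * norm x * norm y) \<longlonglongrightarrow> (2 * r) * 0 * norm x * norm y"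
        by (intro tendsto_intros LIMSEQ_inverse_real_of_nat)
      then have "\<forall>\<^sub>F N in sequentially. (2 * r) * inverse (real (Suc N)) * norm x * norm y < e"
        using xy(2) by (intro order_tendstoD(2)) auto
      then show ?thesis
      proof (rule eventually_mono)
        fix N assume lt: "(2 * r) * inverse (real (Suc N)) * norm x * norm y < e"
        have "cmod (cinner ((P (Z N) - Z N) x) y) \<le> norm (P (Z N) - Z N) * norm x * norm y"
          by (rule cmod_cinner_op_le)
        also have "\<dots> \<le> (2 * r) / real (Suc N) * norm x * norm y" by (intro mult_right_mono PZ) auto
        also have "\<dots> \<le> e" using lt by (simp add: divide_inverse)
        finally have "cmod (cinner ((P (Z N)) x) y - cinner ((Z N) x) y) \<le> e"
          by (simp add: blinfun.diff_left cinner.diff_left)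
        then show "Z N \<in> D i" using Z[of N] S(4) by (auto simp: D_def xy op_ball_def)
      qed
    qed
    then have "\<forall>\<^sub>F N in sequentially. \<forall>i\<in>F. Z N \<in> D i" using F by (simp add: eventually_ball_finite)
    then obtain N where "\<forall>i\<in>F. Z N \<in> D i" using eventually_happens'[OF sequentially_bot] by blast
    then show "\<exists>x\<in>S. \<forall>i\<in>F. x \<in> D i" using Z by blast
  qed blast
  have "P X = X"
  proof (intro blinfun_eqI cinner_ext)
    fix x y
    have "cmod (cinner ((P X) x) y - cinner (X x) y) \<le> 0 + e" if "e > 0" for e
      using X(2)[of "(x, y, e)"] that by (simp add: D_def)
    then have "cmod (cinner ((P X) x) y - cinner (X x) y) \<le> 0" by (rule field_le_epsilon)
    then show "cinner ((P X) x) y = cinner (X x) y" by simp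
  qed
  with X(1) show ?thesis by (rule that)
qed

lemma continuous_map_WOT_sandwich:
  assumes a: "a \<in> bounded_ops" and b: "b \<in> bounded_ops"
  shows "continuous_map WOT WOT (\<lambda>X. a o\<^sub>L (X o\<^sub>L b))"
proof (rule continuous_map_into_WOT)
  fix x y
  have "continuous_map WOT euclidean (\<lambda>X. cinner (X (b x)) ((adj a) y))"
    by (rule continuous_map_WOT_cinner)
  then show "continuous_map WOT euclidean (\<lambda>X. cinner ((a o\<^sub>L (X o\<^sub>L b)) x) y)"
    by (simp add: adj_cinner_right[OF a])
qed (use a b in simp)

lemma norm_sandwich_le:
  assumes a: "norm a \<le> 1" and b: "norm b \<le> 1"
  shows "norm (a o\<^sub>L (X o\<^sub>L b)) \<le> norm X"
proof -
  have "norm (a o\<^sub>L (X o\<^sub>L b)) \<le> norm a * norm (X o\<^sub>L b)" by (rule norm_blinfun_compose)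
  also have "\<dots> \<le> 1 * norm (X o\<^sub>L b)" using a by (rule mult_right_mono) simp
  also have "\<dots> \<le> 1 * (norm X * norm b)" by (intro mult_left_mono norm_blinfun_compose) simp
  also have "\<dots> \<le> 1 * (norm X * 1)" using b by (intro mult_left_mono) auto
  finally show ?thesis by simp
qed

lemma sum_bounded_ops: "(\<And>i. i \<in> I \<Longrightarrow> f i \<in> bounded_ops) \<Longrightarrow> sum f I \<in> bounded_ops"
  by (induction I rule: infinite_finite_induct) auto

lemma linear_sandwich: "linear (\<lambda>X. a o\<^sub>L (X o\<^sub>L b))"
  by (rule linearI) (auto intro!: blinfun_eqI simp: blinfun.add_left blinfun.add_right blinfun.scaleR_left blinfun.scaleR_right)

lemma compose_conjugation_assoc: "a o\<^sub>L b o\<^sub>L T o\<^sub>L c o\<^sub>L d = a o\<^sub>L ((b o\<^sub>L (T o\<^sub>L c)) o\<^sub>L d)"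
  by (simp add: blinfun_compose_assoc)

lemma norm_unitary_le:
  assumes "u \<in> bounded_ops" "adj u o\<^sub>L u = id_blinfun"
  shows "norm u \<le> 1" "norm (u x) = norm x"
proof -
  have iso: "norm (u x) = norm x" for x
  proof -
    have "cinner (u x) (u x) = cinner ((adj u o\<^sub>L u) x) x"
      using adj_cinner[OF assms(1), of "u x" x] by simp
    then have "complex_of_real ((norm (u x))\<^sup>2) = complex_of_real ((norm x)\<^sup>2)"
      using assms(2) by (simp only: cinner_self[symmetric]) simp
    then have "(norm (u x))\<^sup>2 = (norm x)\<^sup>2" by (simp only: of_real_eq_iff)
    then show ?thesis by (simp add: power2_eq_iff_nonneg)
  qed
  then show "norm (u x) = norm x" .
  show "norm u \<le> 1" by (rule norm_blinfun_bound) (simp_all add: iso)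
qed

context tracial_algebra
begin

text \<open>
  The orbit of the theorem, with \<open>J v J\<close> written as a right multiplication and \<open>v\<close> replaced by \<open>v\<^sup>*\<close>.
\<close>

definition orbit :: "('a \<Rightarrow>\<^sub>L 'a) set \<Rightarrow> ('b \<Rightarrow>\<^sub>L 'b) \<Rightarrow> ('b \<Rightarrow>\<^sub>L 'b) set" where
  "orbit G T = {L u o\<^sub>L ((R v o\<^sub>L (T o\<^sub>L R (adj v))) o\<^sub>L L (adj u)) | u v. u \<in> G \<and> v \<in> G}"

definition orbit_hull :: "('a \<Rightarrow>\<^sub>L 'a) set \<Rightarrow> ('b \<Rightarrow>\<^sub>L 'b) \<Rightarrow> ('b \<Rightarrow>\<^sub>L 'b) set" where
  "orbit_hull G T = WOT closure_of (convex hull (orbit G T))"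

context
  fixes G :: "('a \<Rightarrow>\<^sub>L 'a) set"
  assumes GM: "G \<subseteq> M" and G1: "id_blinfun \<in> G"
    and Gm: "\<And>g h. g \<in> G \<Longrightarrow> h \<in> G \<Longrightarrow> g o\<^sub>L h \<in> G" and Ga: "\<And>g. g \<in> G \<Longrightarrow> adj g \<in> G"
    and Gu: "\<And>g. g \<in> G \<Longrightarrow> adj g o\<^sub>L g = id_blinfun"
    and gen: "von_neumann_algebra hull G = M"
begin

lemma G_M: "g \<in> G \<Longrightarrow> g \<in> M" using GM by blast
lemma Gu': "g \<in> G \<Longrightarrow> g o\<^sub>L adj g = id_blinfun" using Gu[OF Ga] G_M by simp

lemma L_conj_orbit:
  assumes g: "g \<in> G" and X: "X \<in> orbit G T" shows "L g o\<^sub>L (X o\<^sub>L L (adj g)) \<in> orbit G T"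
proof -
  obtain u v where uv: "u \<in> G" "v \<in> G" "X = L u o\<^sub>L ((R v o\<^sub>L (T o\<^sub>L R (adj v))) o\<^sub>L L (adj u))"
    using X by (auto simp: orbit_def)
  have "L g o\<^sub>L (X o\<^sub>L L (adj g)) = L (g o\<^sub>L u) o\<^sub>L ((R v o\<^sub>L (T o\<^sub>L R (adj v))) o\<^sub>L L (adj (g o\<^sub>L u)))"
    using g uv G_M by (simp add: L_compose adj_compose_M blinfun_compose_assoc)
  then show ?thesis using Gm[OF g uv(1)] uv(2) unfolding orbit_def by blast
qed

lemma R_conj_orbit:
  assumes g: "g \<in> G" and X: "X \<in> orbit G T" shows "R g o\<^sub>L (X o\<^sub>L R (adj g)) \<in> orbit G T"
proof -
  obtain u v where uv: "u \<in> G" "v \<in> G" "X = L u o\<^sub>L ((R v o\<^sub>L (T o\<^sub>L R (adj v))) o\<^sub>L L (adj u))"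
    using X by (auto simp: orbit_def)
  have gM: "g \<in> M" "u \<in> M" "v \<in> M" using g uv G_M by auto
  have "R g o\<^sub>L (X o\<^sub>L R (adj g)) = (R g o\<^sub>L L u) o\<^sub>L ((R v o\<^sub>L (T o\<^sub>L R (adj v))) o\<^sub>L (L (adj u) o\<^sub>L R (adj g)))"
    by (simp add: uv(3) blinfun_compose_assoc)
  also have "\<dots> = L u o\<^sub>L (((R g o\<^sub>L R v) o\<^sub>L (T o\<^sub>L (R (adj v) o\<^sub>L R (adj g)))) o\<^sub>L L (adj u))"
    using gM by (simp add: L_R_commute[symmetric, of u g] L_R_commute[of "adj u" "adj g"] blinfun_compose_assoc)
  also have "\<dots> = L u o\<^sub>L ((R (v o\<^sub>L g) o\<^sub>L (T o\<^sub>L R (adj (v o\<^sub>L g)))) o\<^sub>L L (adj u))"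
    using gM by (simp add: R_compose adj_compose_M)
  finally show ?thesis using Gm[OF uv(2) g] uv(1) unfolding orbit_def by blast
qed

lemma L_unitary: "g \<in> G \<Longrightarrow> adj (L g) o\<^sub>L L g = id_blinfun"
  using G_M[of g] Gu[of g] by (simp add: adj_L L_compose[symmetric])
lemma R_unitary: "g \<in> G \<Longrightarrow> adj (R g) o\<^sub>L R g = id_blinfun"
  using G_M[of g] Gu'[of g] by (simp add: adj_R R_compose[symmetric])
lemmas norm_L_unitary = norm_unitary_le[OF L_bounded[OF G_M] L_unitary]
lemmas norm_R_unitary = norm_unitary_le[OF R_bounded[OF G_M] R_unitary]

context
  fixes T :: "'b \<Rightarrow>\<^sub>L 'b"
  assumes T: "T \<in> bounded_ops"
begin

lemma orbit_bounded: "orbit G T \<subseteq> op_ball (norm T)"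
proof
  fix X assume "X \<in> orbit G T"
  then obtain u v where uv: "u \<in> G" "v \<in> G" and X: "X = L u o\<^sub>L ((R v o\<^sub>L (T o\<^sub>L R (adj v))) o\<^sub>L L (adj u))"
    by (auto simp: orbit_def)
  have "norm X \<le> norm (R v o\<^sub>L (T o\<^sub>L R (adj v)))"
    unfolding X using uv by (intro norm_sandwich_le norm_L_unitary Ga)
  also have "\<dots> \<le> norm T" using uv by (intro norm_sandwich_le norm_R_unitary Ga)
  finally show "X \<in> op_ball (norm T)" using uv G_M T by (simp add: op_ball_def X)
qed

lemma hull_bounded: "convex hull (orbit G T) \<subseteq> op_ball (norm T)"
proof (rule hull_minimal[OF orbit_bounded])
  have "op_ball (norm T) = bounded_ops \<inter> cball (0 :: 'b \<Rightarrow>\<^sub>L 'b) (norm T)" by (auto simp: op_ball_def)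
  moreover have "convex (bounded_ops :: ('b \<Rightarrow>\<^sub>L 'b) set)" by (rule convexI) simp
  ultimately show "convex (op_ball (norm T) :: ('b \<Rightarrow>\<^sub>L 'b) set)" by (simp add: convex_Int)
qed

lemma orbit_hull_bounded: "orbit_hull G T \<subseteq> op_ball (norm T)"
  unfolding orbit_hull_def by (rule closure_of_minimal[OF hull_bounded closedin_WOT_op_ball]) simp

lemma orbit_hull_compact: "compactin WOT (orbit_hull G T)"
  by (rule closed_compactin[OF compactin_WOT_op_ball[of "norm T"] orbit_hull_bounded]) (simp_all add: orbit_hull_def)

lemma orbit_hull_convex: "convex (orbit_hull G T)"
  unfolding orbit_hull_def using hull_bounded by (intro convex_WOT_closure) (auto simp: op_ball_def)

lemma orbit_hull_nonempty: "orbit_hull G T \<noteq> {}"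
proof -
  have "orbit G T \<noteq> {}" using G1 by (auto simp: orbit_def)
  then have "convex hull (orbit G T) \<noteq> {}" by simp
  moreover have "convex hull (orbit G T) \<subseteq> orbit_hull G T"
    unfolding orbit_hull_def using hull_bounded by (intro closure_of_subset) (auto simp: op_ball_def)
  ultimately show ?thesis by blast
qed

lemma orbit_hull_invariant:
  assumes ab: "a \<in> bounded_ops" "b \<in> bounded_ops" and orb: "\<And>X. X \<in> orbit G T \<Longrightarrow> a o\<^sub>L (X o\<^sub>L b) \<in> orbit G T"
    and X: "X \<in> orbit_hull G T"
  shows "a o\<^sub>L (X o\<^sub>L b) \<in> orbit_hull G T"
proof -
  let ?f = "\<lambda>X. a o\<^sub>L (X o\<^sub>L b)"
  have "?f ` (convex hull (orbit G T)) = convex hull (?f ` orbit G T)"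
    by (rule convex_hull_linear_image[OF linear_sandwich])
  also have "\<dots> \<subseteq> convex hull (orbit G T)" using orb by (intro hull_mono) auto
  finally have "WOT closure_of (?f ` (convex hull (orbit G T))) \<subseteq> orbit_hull G T"
    unfolding orbit_hull_def by (rule closure_of_mono)
  then show ?thesis
    using continuous_map_image_closure_subset[OF continuous_map_WOT_sandwich[OF ab], of "convex hull (orbit G T)"] X
    unfolding orbit_hull_def by blast
qed

text \<open>
  The fixed points of \<open>P\<close> in the hull form a compact convex set, which \<open>Q\<close> maps into itself because it
  commutes with \<open>P\<close>. Applying \<open>Markov_fixed_point\<close> first to \<open>P\<close> and then to \<open>Q\<close> on this set gives a common fixed point.
\<close>

lemma exists_biharmonic:
  assumes F: "finite F" "F \<noteq> {}" "F \<subseteq> G"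
  obtains X where "X \<in> orbit_hull G T"
    "(\<Sum>g\<in>F. L g o\<^sub>L (X o\<^sub>L L (adj g))) = real (card F) *\<^sub>R X"
    "(\<Sum>g\<in>F. R g o\<^sub>L (X o\<^sub>L R (adj g))) = real (card F) *\<^sub>R X"
proof -
  define n where "n = real (card F)"
  have n: "n > 0" using F by (simp add: n_def card_gt_0_iff)
  have FM: "g \<in> M" if "g \<in> F" for g using that F G_M by blast
  define P where "P X = (\<Sum>g\<in>F. (1 / n) *\<^sub>R (L g o\<^sub>L (X o\<^sub>L L (adj g))))" for X
  define Q where "Q X = (\<Sum>g\<in>F. (1 / n) *\<^sub>R (R g o\<^sub>L (X o\<^sub>L R (adj g))))" for X
  have lin: "linear (\<lambda>X. \<Sum>g\<in>F. (1 / n) *\<^sub>R (a g o\<^sub>L (X o\<^sub>L b g)))" for a b :: "('a \<Rightarrow>\<^sub>L 'a) \<Rightarrow> ('b \<Rightarrow>\<^sub>L 'b)"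
    by (intro linear_compose_sum ballI linear_compose_scale_right linear_sandwich)
  have cont: "continuous_map WOT WOT (\<lambda>X. \<Sum>g\<in>F. (1 / n) *\<^sub>R (a g o\<^sub>L (X o\<^sub>L b g)))"
    if ab: "\<And>g. g \<in> F \<Longrightarrow> a g \<in> bounded_ops \<and> b g \<in> bounded_ops" for a b :: "('a \<Rightarrow>\<^sub>L 'a) \<Rightarrow> ('b \<Rightarrow>\<^sub>L 'b)"
  proof (rule continuous_map_into_WOT)
    fix X :: "'b \<Rightarrow>\<^sub>L 'b" assume "X \<in> topspace WOT"
    then show "(\<Sum>g\<in>F. (1 / n) *\<^sub>R (a g o\<^sub>L (X o\<^sub>L b g))) \<in> bounded_ops"
      using ab by (intro sum_bounded_ops) auto
  next
    fix x y :: 'b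
    have "continuous_map WOT euclidean
        (\<lambda>X. \<Sum>g\<in>F. (1 / n) *\<^sub>R cinner ((a g o\<^sub>L (X o\<^sub>L b g)) x) y)"
    proof (intro continuous_map_sum F(1))
      fix g assume g: "g \<in> F"
      have c1: "continuous_map WOT euclidean (\<lambda>X. cinner ((a g o\<^sub>L (X o\<^sub>L b g)) x) y)"
        using continuous_map_compose[OF continuous_map_WOT_sandwich[of "a g" "b g"] continuous_map_WOT_cinner[of x y]] ab[OF g]
        by (simp add: o_def)
      have c2: "continuous_map euclidean euclidean (\<lambda>c::complex. (1 / n) *\<^sub>R c)" by (auto intro!: continuous_intros)
      show "continuous_map WOT euclidean
          (\<lambda>X. (1 / n) *\<^sub>R cinner ((a g o\<^sub>L (X o\<^sub>L b g)) x) y)"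
        using continuous_map_compose[OF c1 c2] by (simp add: o_def)
    qed
    then show "continuous_map WOT euclidean
        (\<lambda>X. cinner ((\<Sum>g\<in>F. (1 / n) *\<^sub>R (a g o\<^sub>L (X o\<^sub>L b g))) x) y)"
      by (simp only: blinfun.sum_left blinfun.scaleR_left cinner.sum_left cinner.scaleR_left)
  qed
  have Pcl: "P X \<in> orbit_hull G T" if X: "X \<in> orbit_hull G T" for X
    unfolding P_def
  proof (rule convex_sum[OF F(1) orbit_hull_convex])
    fix g assume g: "g \<in> F"
    then have "g \<in> G" "g \<in> M" using F FM by auto
    then show "L g o\<^sub>L (X o\<^sub>L L (adj g)) \<in> orbit_hull G T"
      using L_conj_orbit by (intro orbit_hull_invariant X) auto
  qed (use n in \<open>auto simp: n_def\<close>)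
  have Qcl: "Q X \<in> orbit_hull G T" if X: "X \<in> orbit_hull G T" for X
    unfolding Q_def
  proof (rule convex_sum[OF F(1) orbit_hull_convex])
    fix g assume g: "g \<in> F"
    then have "g \<in> G" "g \<in> M" using F FM by auto
    then show "R g o\<^sub>L (X o\<^sub>L R (adj g)) \<in> orbit_hull G T"
      using R_conj_orbit by (intro orbit_hull_invariant X) auto
  qed (use n in \<open>auto simp: n_def\<close>)
  have linP: "linear P" and linQ: "linear Q" unfolding P_def[abs_def] Q_def[abs_def] by (rule lin)+
  have contP: "continuous_map WOT WOT P"
    unfolding P_def[abs_def] by (rule cont) (simp add: FM)
  have contQ: "continuous_map WOT WOT Q"
    unfolding Q_def[abs_def] by (rule cont) (simp add: FM)
  have PQ: "P (Q X) = Q (P X)" for X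
  proof -
    have c: "L g o\<^sub>L ((R h o\<^sub>L (X o\<^sub>L R (adj h))) o\<^sub>L L (adj g)) = R h o\<^sub>L ((L g o\<^sub>L (X o\<^sub>L L (adj g))) o\<^sub>L R (adj h))"
      if "g \<in> F" "h \<in> F" for g h
    proof -
      have gh: "g \<in> M" "h \<in> M" using that FM by auto
      have "L g o\<^sub>L ((R h o\<^sub>L (X o\<^sub>L R (adj h))) o\<^sub>L L (adj g)) = (L g o\<^sub>L R h) o\<^sub>L (X o\<^sub>L (R (adj h) o\<^sub>L L (adj g)))"
        by (simp add: blinfun_compose_assoc)
      also have "\<dots> = (R h o\<^sub>L L g) o\<^sub>L (X o\<^sub>L (L (adj g) o\<^sub>L R (adj h)))"
        using gh by (simp add: L_R_commute)
      finally show ?thesis by (simp add: blinfun_compose_assoc)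
    qed
    have "P (Q X) = (\<Sum>g\<in>F. \<Sum>h\<in>F. (1 / n) *\<^sub>R (1 / n) *\<^sub>R (L g o\<^sub>L ((R h o\<^sub>L (X o\<^sub>L R (adj h))) o\<^sub>L L (adj g))))"
      unfolding P_def
      by (simp add: Q_def linear_sum[OF linear_sandwich] linear_scale[OF linear_sandwich] scaleR_sum_right)
    also have "\<dots> = (\<Sum>g\<in>F. \<Sum>h\<in>F. (1 / n) *\<^sub>R (1 / n) *\<^sub>R (R h o\<^sub>L ((L g o\<^sub>L (X o\<^sub>L L (adj g))) o\<^sub>L R (adj h))))"
      by (intro sum.cong refl) (simp only: c)
    also have "\<dots> = (\<Sum>h\<in>F. \<Sum>g\<in>F. (1 / n) *\<^sub>R (1 / n) *\<^sub>R (R h o\<^sub>L ((L g o\<^sub>L (X o\<^sub>L L (adj g))) o\<^sub>L R (adj h))))"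
      by (rule sum.swap)
    also have "\<dots> = Q (P X)"
      unfolding Q_def
      by (simp add: P_def linear_sum[OF linear_sandwich] linear_scale[OF linear_sandwich] scaleR_sum_right)
    finally show ?thesis .
  qed
  obtain X1 where X1: "X1 \<in> orbit_hull G T" "P X1 = X1"
    using Markov_fixed_point[OF orbit_hull_compact orbit_hull_nonempty orbit_hull_convex orbit_hull_bounded linP contP] Pcl
    by blast
  let ?S = "{X \<in> orbit_hull G T. P X = X}"
  have "\<exists>X\<in>?S. Q X = X"
  proof -
    have "closedin WOT {X \<in> bounded_ops. \<forall>x. \<forall>y. cinner ((P X) x) y - cinner (X x) y \<in> {0}}"
    proof (intro closedin_WOT_all closedin_WOT_functional)
      show "continuous_map WOT euclidean (\<lambda>X. cinner ((P X) x) y - cinner (X x) y)" for x y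
        using continuous_map_compose[OF contP continuous_map_WOT_cinner[of x y]]
        by (intro continuous_map_diff continuous_map_WOT_cinner) (simp add: o_def)
    qed simp
    moreover have "{X \<in> bounded_ops. \<forall>x. \<forall>y. cinner ((P X) x) y - cinner (X x) y \<in> {0}}
        = {X \<in> bounded_ops. P X = X}"
    proof (intro Collect_cong conj_cong refl iffI)
      fix X assume "\<forall>x. \<forall>y. cinner ((P X) x) y - cinner (X x) y \<in> {0}"
      then show "P X = X" by (intro blinfun_eqI cinner_ext) simp
    qed simp
    ultimately have "compactin WOT ({X \<in> bounded_ops. P X = X} \<inter> orbit_hull G T)"
      using closed_Int_compactin[OF _ orbit_hull_compact] by simp
    moreover have "{X \<in> bounded_ops. P X = X} \<inter> orbit_hull G T = ?S"
      using orbit_hull_bounded by (auto simp: op_ball_def)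
    ultimately have 1: "compactin WOT ?S" by simp
    have 2: "?S \<noteq> {}" using X1 by blast
    have 3: "convex ?S"
      by (rule convexI) (simp add: convexD[OF orbit_hull_convex] linear_add[OF linP] linear_scale[OF linP])
    have 4: "?S \<subseteq> op_ball (norm T)" using orbit_hull_bounded by auto
    have 5: "Q ` ?S \<subseteq> ?S" using Qcl PQ by auto
    obtain Y where "Y \<in> ?S" "Q Y = Y" by (rule Markov_fixed_point[OF 1 2 3 4 linQ contQ 5])
    then show ?thesis by (rule bexI[rotated])
  qed
  then obtain X where X: "X \<in> orbit_hull G T" "P X = X" "Q X = X" by blast
  have "(\<Sum>g\<in>F. L g o\<^sub>L (X o\<^sub>L L (adj g))) = n *\<^sub>R P X" "(\<Sum>g\<in>F. R g o\<^sub>L (X o\<^sub>L R (adj g))) = n *\<^sub>R Q X"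
    using n by (simp_all add: P_def Q_def scaleR_sum_right)
  then show ?thesis by (intro that[OF X(1)]) (simp_all only: X(2,3) n_def)
qed

lemma exists_commuting_on_finite:
  assumes F: "finite F" "F \<subseteq> G"
  obtains X where "X \<in> orbit_hull G T"
    "\<And>g h. g \<in> F \<Longrightarrow> h \<in> F \<Longrightarrow> X ((L (adj g)) (hat (adj h))) = (L (adj g)) (X (hat (adj h)))"
    "\<And>g h. g \<in> F \<Longrightarrow> h \<in> F \<Longrightarrow> X ((R (adj g)) (hat (adj h))) = (R (adj g)) (X (hat (adj h)))"
proof (cases "F = {}")
  case True
  then show ?thesis using orbit_hull_nonempty that by auto
next
  case False
  obtain X where X: "X \<in> orbit_hull G T"
    "(\<Sum>g\<in>F. L g o\<^sub>L (X o\<^sub>L L (adj g))) = real (card F) *\<^sub>R X"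
    "(\<Sum>g\<in>F. R g o\<^sub>L (X o\<^sub>L R (adj g))) = real (card F) *\<^sub>R X"
    using exists_biharmonic[OF F(1) False F(2)] by blast
  have FG: "g \<in> G" "g \<in> M" "adj g \<in> G" if "g \<in> F" for g using that F(2) G_M Ga by auto
  have sumL: "(\<Sum>g\<in>F. (L g) (X ((L (adj g)) v))) = real (card F) *\<^sub>R X v" for v
    using arg_cong[OF X(2), of "\<lambda>Z. Z v"] by (simp add: blinfun.sum_left blinfun.scaleR_left)
  have sumR: "(\<Sum>g\<in>F. (R g) (X ((R (adj g)) v))) = real (card F) *\<^sub>R X v" for v
    using arg_cong[OF X(3), of "\<lambda>Z. Z v"] by (simp add: blinfun.sum_left blinfun.scaleR_left)
  have innL: "inner ((L (adj g)) v) w = inner v ((L g) w)" if "g \<in> F" for g v w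
    using adj_cinner[OF L_bounded[OF FG(2)[OF that]], of v w] by (simp add: adj_L FG that flip: Re_cinner)
  have innR: "inner ((R (adj g)) v) w = inner v ((R g) w)" if "g \<in> F" for g v w
    using adj_cinner[OF R_bounded[OF FG(2)[OF that]], of v w] by (simp add: adj_R FG that flip: Re_cinner)
  have LR: "(L a) ((R b) v) = (R b) ((L a) v)" if "a \<in> M" "b \<in> M" for a b v
    using arg_cong[OF L_R_commute[OF that], of "\<lambda>Z. Z v"] by simp
  let ?o = "hat id_blinfun"
  have Lo: "(L (adj g)) ?o = hat (adj g)" and Ro: "(R (adj g)) ?o = hat (adj g)" if "g \<in> F" for g
    using FG[OF that] by (simp_all add: L_hat R_hat)
  show ?thesis
  proof (rule that[OF X(1)])
    fix g h assume gh: "g \<in> F" "h \<in> F"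
    have "X ((L (adj g)) ((R (adj h)) ?o))
        = (L (adj g)) (X ((R (adj h)) ?o))"
    proof (rule biharmonic_commutes_on_orbit[where I = F and A = "\<lambda>g. L (adj g)" and B = "\<lambda>g. R (adj g)" and U = L and V = R])
      show "norm ((L (adj i)) v) = norm v" if "i \<in> F" for i v using norm_L_unitary(2)[OF FG(3)[OF that]] by (simp add: FG that)
      show "norm ((R i) v) \<le> norm v" if "i \<in> F" for i v using norm_R_unitary(2)[OF FG(1)[OF that]] by (simp add: FG that)
    qed (use F False gh in \<open>simp_all add: sumL sumR innL LR Lo Ro FG\<close>)
    then show "X ((L (adj g)) (hat (adj h))) = (L (adj g)) (X (hat (adj h)))"
      by (simp only: Ro[OF gh(2)])
    have "X ((R (adj g)) ((L (adj h)) ?o))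
        = (R (adj g)) (X ((L (adj h)) ?o))"
    proof (rule biharmonic_commutes_on_orbit[where I = F and A = "\<lambda>g. R (adj g)" and B = "\<lambda>g. L (adj g)" and U = R and V = L])
      show "norm ((R (adj i)) v) = norm v" if "i \<in> F" for i v using norm_R_unitary(2)[OF FG(3)[OF that]] by (simp add: FG that)
      show "norm ((L i) v) \<le> norm v" if "i \<in> F" for i v using norm_L_unitary(2)[OF FG(1)[OF that]] by (simp add: FG that)
    qed (use F False gh in \<open>simp_all add: sumL sumR innR LR Lo Ro FG\<close>)
    then show "X ((R (adj g)) (hat (adj h))) = (R (adj g)) (X (hat (adj h)))"
      by (simp only: Lo[OF gh(2)])
  qed
qed

text \<open>
  For each pair \<open>(g, h)\<close> commutation with \<open>g\<close> at the vector \<open>h\<close> is a weakly closed condition, and any finite number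
  of these conditions can be met in the hull.
\<close>

lemma exists_bicommuting_in_orbit_hull: "\<exists>X\<in>orbit_hull G T. X \<in> bicommuting"
proof -
  define D where "D = (\<lambda>(g, h). {X \<in> bounded_ops. \<forall>y.
      cinner (X ((L (adj g)) (hat (adj h)))) y - cinner (X (hat (adj h))) ((L g) y) \<in> {0}}
    \<inter> {X \<in> bounded_ops. \<forall>y.
      cinner (X ((R (adj g)) (hat (adj h)))) y - cinner (X (hat (adj h))) ((R g) y) \<in> {0}})"
  have LL: "cinner (X k) ((L g) y) = cinner ((L (adj g)) (X k)) y"
    and RR: "cinner (X k) ((R g) y) = cinner ((R (adj g)) (X k)) y"
    if "g \<in> G" for X :: "'b \<Rightarrow>\<^sub>L 'b" and k g y
    using adj_cinner[OF L_bounded[OF G_M[OF that]]] adj_cinner[OF R_bounded[OF G_M[OF that]]]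
    by (simp_all add: adj_L adj_R G_M that)
  obtain X where X: "X \<in> orbit_hull G T" "\<And>i. i \<in> G \<times> G \<Longrightarrow> X \<in> D i"
  proof (rule compactin_fip_indexed[OF orbit_hull_compact, of "G \<times> G" D])
    fix i assume "i \<in> G \<times> G"
    show "closedin WOT (D i)"
      unfolding D_def case_prod_unfold
      by (intro closedin_Int closedin_WOT_all closedin_WOT_functional continuous_map_diff continuous_map_WOT_cinner) simp_all
  next
    fix F assume F: "finite F" "F \<subseteq> G \<times> G"
    then have "finite (fst ` F \<union> snd ` F)" "fst ` F \<union> snd ` F \<subseteq> G" by auto
    then obtain X where X: "X \<in> orbit_hull G T" and
      1: "\<And>g h. g \<in> fst ` F \<union> snd ` F \<Longrightarrow> h \<in> fst ` F \<union> snd ` F \<Longrightarrow>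
         X ((L (adj g)) (hat (adj h))) = (L (adj g)) (X (hat (adj h)))" and
      2: "\<And>g h. g \<in> fst ` F \<union> snd ` F \<Longrightarrow> h \<in> fst ` F \<union> snd ` F \<Longrightarrow>
         X ((R (adj g)) (hat (adj h))) = (R (adj g)) (X (hat (adj h)))"
      using exists_commuting_on_finite by metis
    have "X \<in> D i" if i: "i \<in> F" for i
    proof -
      obtain g h where gh: "i = (g, h)" by (cases i)
      have m: "g \<in> fst ` F \<union> snd ` F" "h \<in> fst ` F \<union> snd ` F" "g \<in> G" using i gh F by force+
      have "X \<in> bounded_ops" using X orbit_hull_bounded by (auto simp: op_ball_def)
      then show ?thesis using 1[OF m(1,2)] 2[OF m(1,2)] by (simp add: D_def gh LL[OF m(3)] RR[OF m(3)])
    qed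
    then show "\<exists>x\<in>orbit_hull G T. \<forall>i\<in>F. x \<in> D i" using X by blast
  qed blast
  have Xb: "X \<in> bounded_ops" using X orbit_hull_bounded by (auto simp: op_ball_def)
  have comm: "X ((L g) (hat h)) = (L g) (X (hat h))"
      "X ((R g) (hat h)) = (R g) (X (hat h))"
    if gh: "g \<in> G" "h \<in> G" for g h
  proof -
    have mem: "X \<in> D (adj g, adj h)" using gh Ga X(2) by simp
    have ag: "adj g \<in> G" "adj (adj g) = g" "adj (adj h) = h" using gh Ga G_M by auto
    show "X ((L g) (hat h)) = (L g) (X (hat h))"
      using mem by (intro cinner_ext) (simp add: D_def ag(2,3) LL[OF ag(1)])
    show "X ((R g) (hat h)) = (R g) (X (hat h))"
      using mem by (intro cinner_ext) (simp add: D_def ag(2,3) RR[OF ag(1)])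
  qed
  have K: "group_span G = UNIV" by (rule group_span_eq_UNIV[OF GM G1 Gm Ga gen])
  have "X o\<^sub>L L g = L g o\<^sub>L X" "X o\<^sub>L R g = R g o\<^sub>L X" if g: "g \<in> G" for g
    using Xb G_M[OF g] comm[OF g] by (auto intro!: op_eqI_generators[OF K])
  then have "X \<in> bicommuting"
    unfolding bicommuting_def
    using commute_of_generators[OF K GM Xb, of L R] commute_of_generators[OF K GM Xb, of R L] Xb
    by (simp add: L_hat R_hat adj_L adj_R)
  then show ?thesis using X(1) by blast
qed

end

end

lemma J_L_J: "x \<in> M \<Longrightarrow> J o\<^sub>L L x o\<^sub>L J = R (adj x)" by (simp add: R_def)

end

text \<open>
  The inverse in the unitary group is the adjoint.
\<close>

lemma adj_in_unitary_subgroup: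
  assumes M: "M \<subseteq> bounded_ops" "\<And>x. x \<in> M \<Longrightarrow> adj x \<in> M" and G: "subgroup G (unitary_group M)" and g: "g \<in> G"
  shows "adj g \<in> G"
proof -
  have gc: "g \<in> carrier (unitary_group M)" using subgroup.subset[OF G] g by blast
  then have gM: "g \<in> M" "adj g o\<^sub>L g = id_blinfun" "g o\<^sub>L adj g = id_blinfun" by (auto simp: unitary_group_def)
  have aa: "adj (adj g) = g" using gM M by (auto simp: adj_adj)
  have "m_inv (unitary_group M) g = adj g"
    unfolding m_inv_def
  proof (rule the_equality)
    show "adj g \<in> carrier (unitary_group M) \<and> g \<otimes>\<^bsub>unitary_group M\<^esub> adj g = \<one>\<^bsub>unitary_group M\<^esub> \<and>
       adj g \<otimes>\<^bsub>unitary_group M\<^esub> g = \<one>\<^bsub>unitary_group M\<^esub>"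
      using gM M aa by (simp add: unitary_group_def)
    fix y assume "y \<in> carrier (unitary_group M) \<and> g \<otimes>\<^bsub>unitary_group M\<^esub> y = \<one>\<^bsub>unitary_group M\<^esub> \<and>
       y \<otimes>\<^bsub>unitary_group M\<^esub> g = \<one>\<^bsub>unitary_group M\<^esub>"
    then have "y o\<^sub>L g = id_blinfun" by (simp add: unitary_group_def)
    then have "(y o\<^sub>L g) o\<^sub>L adj g = adj g" by simp
    then show "y = adj g" by (simp add: blinfun_compose_assoc gM)
  qed
  then show ?thesis using subgroup.m_inv_closed[OF G g] by simp
qed

theorem theorem3p3:
  fixes M G :: "('a::complex_hilbert_space \<Rightarrow>\<^sub>L 'a) set"
    and \<tau> :: "('a \<Rightarrow>\<^sub>L 'a) \<Rightarrow> complex"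
    and hat :: "('a \<Rightarrow>\<^sub>L 'a) \<Rightarrow> 'b::complex_hilbert_space"
    and T :: "'b \<Rightarrow>\<^sub>L 'b"
  defines "L \<equiv> left_mult M hat"
    and "J \<equiv> canonical_conj M hat"
  assumes "finite_von_neumann_algebra M"
    and "faithful_normal_tracial_state M \<tau>"
    and "L2_completion M \<tau> hat"
    and "subgroup G (unitary_group M)"
    and "von_neumann_algebra hull G = M"
    and "T \<in> bounded_ops"
  shows "weak_operator_topology closure_of
           (convex hull {L u o\<^sub>L (J o\<^sub>L L v o\<^sub>L J) o\<^sub>L T o\<^sub>L (J o\<^sub>L L (adj v) o\<^sub>L J) o\<^sub>L L (adj u) |
                           u v. u \<in> G \<and> v \<in> G})
         \<inter> L ` center M \<noteq> {}"
proof -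
  have vN: "von_neumann_algebra M" using assms(3) by (simp add: finite_von_neumann_algebra_def)
  interpret tracial_algebra M \<tau> hat by standard (use vN assms in auto)
  have GM: "G \<subseteq> M" and Gu: "\<And>g. g \<in> G \<Longrightarrow> adj g o\<^sub>L g = id_blinfun"
    using subgroup.subset[OF assms(6)] by (auto simp: unitary_group_def)
  have G1: "id_blinfun \<in> G" using subgroup.one_closed[OF assms(6)] by (simp add: unitary_group_def)
  have Gm: "g o\<^sub>L h \<in> G" if "g \<in> G" "h \<in> G" for g h
    using subgroup.m_closed[OF assms(6) that] by (simp add: unitary_group_def)
  have Ga: "adj g \<in> G" if "g \<in> G" for g
    using adj_in_unitary_subgroup[OF _ _ assms(6) that] M_bounded by auto
  obtain X where X: "X \<in> orbit_hull G T" "X \<in> bicommuting"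
    using exists_bicommuting_in_orbit_hull[OF GM G1 Gm Ga Gu assms(7,8)] by blast
  have JLJ: "J o\<^sub>L L v o\<^sub>L J = R (adj v)" if "v \<in> M" for v
    using J_L_J[OF that] by (simp only: L_def J_def)
  have "{L u o\<^sub>L (J o\<^sub>L L v o\<^sub>L J) o\<^sub>L T o\<^sub>L (J o\<^sub>L L (adj v) o\<^sub>L J) o\<^sub>L L (adj u) | u v. u \<in> G \<and> v \<in> G} = orbit G T"
  proof (intro equalityI subsetI)
    fix Z assume "Z \<in> {L u o\<^sub>L (J o\<^sub>L L v o\<^sub>L J) o\<^sub>L T o\<^sub>L (J o\<^sub>L L (adj v) o\<^sub>L J) o\<^sub>L L (adj u) | u v. u \<in> G \<and> v \<in> G}"
    then obtain u v where uv: "u \<in> G" "v \<in> G" and Z: "Z = L u o\<^sub>L (J o\<^sub>L L v o\<^sub>L J) o\<^sub>L T o\<^sub>L (J o\<^sub>L L (adj v) o\<^sub>L J) o\<^sub>L L (adj u)"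
      by blast
    have "v \<in> M" using uv GM by blast
    then have Z': "Z = L u o\<^sub>L ((R (adj v) o\<^sub>L (T o\<^sub>L R (adj (adj v)))) o\<^sub>L L (adj u))"
      unfolding Z compose_conjugation_assoc[symmetric] using JLJ[of v] JLJ[of "adj v"] by simp
    show "Z \<in> orbit G T"
      unfolding orbit_def L_def[symmetric]
      by (rule CollectI, rule exI[of _ u], rule exI[of _ "adj v"], intro conjI Z' uv Ga)
  next
    fix Z assume "Z \<in> orbit G T"
    then obtain u v where uv: "u \<in> G" "v \<in> G" and Z: "Z = L u o\<^sub>L ((R v o\<^sub>L (T o\<^sub>L R (adj v))) o\<^sub>L L (adj u))"
      unfolding orbit_def L_def by blast
    have "v \<in> M" using uv GM by blast
    then have Z': "Z = L u o\<^sub>L (J o\<^sub>L L (adj v) o\<^sub>L J) o\<^sub>L T o\<^sub>L (J o\<^sub>L L (adj (adj v)) o\<^sub>L J) o\<^sub>L L (adj u)"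
      unfolding Z compose_conjugation_assoc[symmetric] using JLJ[of v] JLJ[of "adj v"] by simp
    show "Z \<in> {L u o\<^sub>L (J o\<^sub>L L v o\<^sub>L J) o\<^sub>L T o\<^sub>L (J o\<^sub>L L (adj v) o\<^sub>L J) o\<^sub>L L (adj u) | u v. u \<in> G \<and> v \<in> G}"
      by (rule CollectI, rule exI[of _ u], rule exI[of _ "adj v"], intro conjI Z' uv Ga)
  qed
  then have "X \<in> WOT closure_of
           (convex hull {L u o\<^sub>L (J o\<^sub>L L v o\<^sub>L J) o\<^sub>L T o\<^sub>L (J o\<^sub>L L (adj v) o\<^sub>L J) o\<^sub>L L (adj u) |
                           u v. u \<in> G \<and> v \<in> G})"
    using X(1) unfolding orbit_hull_def by simp
  moreover have "X \<in> L ` center M" using bicommuting_in_L_center[OF X(2)] by (simp add: L_def)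
  ultimately show ?thesis by blast
qed

end
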